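(* Let $b>0$ be fixed and known. For $j=1,2$ let $\rho_j$ belong to the admissible class $\mathcal A$, let $a_j:=\int_0^b\sqrt{\rho_j(x)}\,dx$, let $D_j(k)$ be the corresponding function and $\gamma_j$ the corresponding constant (all as defined in the context, with $\rho=\rho_j$). Suppose that $\rho_1$ and $\rho_2$ have the same special transmission eigenvalues with the same multiplicities (including the multiplicity of the eigenvalue $0$). Then: (a) If $a_1<b$ and $a_2<b$, then $\rho_1\equiv\rho_2$. In other words, when $a<b$, and provided there exists at least one $\rho\in\mathcal A$ corresponding to the data, the special transmission eigenvalues with their multiplicities uniquely determine $\rho$. (b) If $a_1=b$ and $a_2=b$, and moreover $\gamma_1=\gamma_2$, then $\rho_1\equiv\rho_2$. In other words, when $a=b$, and provided there exists at least one $\rho\in\mathcal A$ corresponding to the data, the special transmission eigenvalues with their multiplicities, together with the value of $\gamma$, uniquely determine $\rho$.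
   Context: Fix $b>0$. The admissible class $\mathcal A$ consists of the real-valued functions $\rho$ on $[0,+\infty)$ such that $\rho(x)$ is positive and continuously differentiable, $\rho(x)=1$ for $x\ge b$, and $\rho''(x)$ exists almost everywhere. Special transmission eigenvalues. Let $\Omega\subset\mathbb R^3$ be the ball of radius $b$ centered at the origin and let $\rho(\mathbf x)=\rho(|\mathbf x|)$. Consider the problem $$\Delta\Psi+\lambda\rho(\mathbf x)\Psi=0,\quad \Delta\Psi_0+\lambda\Psi_0=0\ \text{ in }\Omega,\qquad \Psi=\Psi_0,\quad \frac{\partial\Psi}{\partial\mathbf n}=\frac{\partial\Psi_0}{\partial\mathbf n}\ \text{ on }\partial\Omega,$$ where $\mathbf n$ is the outward unit normal. A special transmission eigenvalue is a complex number $\lambda$ for which there are nontrivial solutions $\Psi,\Psi_0$ that are spherically symmetric and continuous in the closure of $\Omega$. The function $D(k)$. For $k\in\mathbb C$ let $\phi(x;k)$ be the unique solution of $\phi''+k^2\rho(x)\phi=0$ for $0<x<b$, $\phi(0;k)=0$, $\phi'(0;k)=1$, and set $$D(k):=\frac{\sin(kb)}{k}\,\phi'(b;k)-\cos(kb)\,\phi(b;k)$$ (with $\sin(kb)/k:=b$ at $k=0$). $D(k)$ is an entire function of $k^2$, and it is known that the special transmission eigenvalues are exactly the values $\lambda=k^2$ where $k$ is a zero of $D$. Multiplicity. The multiplicity of a nonzero special transmission eigenvalue $k_n^2$ is the multiplicity of $k_n$ as a zero of $D(k)$; the multiplicity $d$ of the eigenvalue $0$ is the order of vanishing at $0$ of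 $D$ regarded as a function of $k^2$ (always $d\ge1$). The constant $\gamma$. It is known that $D$ has the representation $$D(k)=\gamma\,E(k),\qquad E(k)=k^{2d}\prod_{n=1}^\infty\Bigl(1-\frac{k^2}{k_n^2}\Bigr),$$ where $\gamma$ is a real constant and the $k_n^2$ are the nonzero special transmission eigenvalues repeated according to multiplicity. If $D\equiv0$ (as happens for $\rho\equiv1$) one has $\gamma=0$. Thus when $D\not\equiv 0$ the eigenvalues with multiplicities are equivalent to the function $E$, and together with $\gamma$ they are equivalent to the function $D$. *)

theory Defs
  imports "HOL-Complex_Analysis.Complex_Analysis"
begin

(* Functions on [0,\<infinity>) are total functions on the reals of which only the values on {0..} matter;
   the derivative at 0 is the one-sided one. *)
definition admissible :: "real \<Rightarrow> (real \<Rightarrow> real) \<Rightarrow> bool" where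
  "admissible b \<rho> \<longleftrightarrow>
     (\<forall>x\<ge>0. \<rho> x > 0) \<and>
     (\<forall>x\<ge>b. \<rho> x = 1) \<and>
     (\<exists>\<rho>'. (\<forall>x\<ge>0. (\<rho> has_real_derivative \<rho>' x) (at x within {0..})) \<and>
           continuous_on {0..} \<rho>' \<and>
           (AE x in lborel. x > 0 \<longrightarrow> \<rho>' differentiable (at x)))"

definition travel_time :: "real \<Rightarrow> (real \<Rightarrow> real) \<Rightarrow> real" where
  "travel_time b \<rho> = integral {0..b} (\<lambda>x. sqrt (\<rho> x))"

definition C2_on :: "('a::euclidean_space \<Rightarrow> complex) \<Rightarrow> 'a set \<Rightarrow> bool" where
  "C2_on f S \<longleftrightarrow>
     (\<exists>(f' :: 'a \<Rightarrow> 'a \<Rightarrow>\<^sub>L complex) (f'' :: 'a \<Rightarrow> 'a \<Rightarrow>\<^sub>L ('a \<Rightarrow>\<^sub>L complex)).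
        (\<forall>x\<in>S. (f has_derivative blinfun_apply (f' x)) (at x)) \<and>
        (\<forall>x\<in>S. (f' has_derivative blinfun_apply (f'' x)) (at x)) \<and>
        continuous_on S f'')"

definition laplacian :: "('a::euclidean_space \<Rightarrow> complex) \<Rightarrow> 'a \<Rightarrow> complex" where
  "laplacian f x =
     (\<Sum>i\<in>Basis. vector_derivative
        (\<lambda>t. vector_derivative (\<lambda>s. f (x + s *\<^sub>R i)) (at t)) (at 0))"

definition spherically_symmetric_on :: "('a::euclidean_space \<Rightarrow> complex) \<Rightarrow> 'a set \<Rightarrow> bool" where
  "spherically_symmetric_on f S \<longleftrightarrow> (\<forall>x\<in>S. \<forall>y\<in>S. norm x = norm y \<longrightarrow> f x = f y)"

(* Derivative at x along the outward unit normal x / b of the sphere of radius b, taken from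
   inside the ball since f is only meaningful there. *)
definition has_outward_normal_derivative ::
    "real \<Rightarrow> ('a::euclidean_space \<Rightarrow> complex) \<Rightarrow> complex \<Rightarrow> 'a \<Rightarrow> bool" where
  "has_outward_normal_derivative b f d x \<longleftrightarrow>
     ((\<lambda>t. f (x + t *\<^sub>R (x /\<^sub>R b))) has_vector_derivative d) (at 0 within {..0})"

definition special_transmission_eigenfunctions ::
    "real \<Rightarrow> (real \<Rightarrow> real) \<Rightarrow> complex \<Rightarrow> (real^3 \<Rightarrow> complex) \<Rightarrow> (real^3 \<Rightarrow> complex) \<Rightarrow> bool" where
  "special_transmission_eigenfunctions b \<rho> \<kappa> \<Psi> \<Psi>0 \<longleftrightarrow>
     continuous_on (cball 0 b) \<Psi> \<and> continuous_on (cball 0 b) \<Psi>0 \<and>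
     C2_on \<Psi> (ball 0 b) \<and> C2_on \<Psi>0 (ball 0 b) \<and>
     spherically_symmetric_on \<Psi> (cball 0 b) \<and> spherically_symmetric_on \<Psi>0 (cball 0 b) \<and>
     (\<forall>x\<in>ball 0 b. laplacian \<Psi> x + \<kappa> * of_real (\<rho> (norm x)) * \<Psi> x = 0) \<and>
     (\<forall>x\<in>ball 0 b. laplacian \<Psi>0 x + \<kappa> * \<Psi>0 x = 0) \<and>
     (\<forall>x\<in>sphere 0 b. \<Psi> x = \<Psi>0 x) \<and>
     (\<forall>x\<in>sphere 0 b. \<exists>d. has_outward_normal_derivative b \<Psi> d x \<and>
                          has_outward_normal_derivative b \<Psi>0 d x)"

(* Nontrivial: the pair does not vanish identically (equivalently, by uniqueness for the
   Cauchy problem, neither function does). *)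
definition special_transmission_eigenvalue :: "real \<Rightarrow> (real \<Rightarrow> real) \<Rightarrow> complex \<Rightarrow> bool" where
  "special_transmission_eigenvalue b \<rho> \<kappa> \<longleftrightarrow>
     (\<exists>\<Psi> \<Psi>0. special_transmission_eigenfunctions b \<rho> \<kappa> \<Psi> \<Psi>0 \<and>
             (\<exists>x\<in>ball 0 b. \<Psi> x \<noteq> 0 \<or> \<Psi>0 x \<noteq> 0))"

definition regular_solution :: "real \<Rightarrow> (real \<Rightarrow> real) \<Rightarrow> complex \<Rightarrow> (real \<Rightarrow> complex) \<Rightarrow> bool" where
  "regular_solution b \<rho> k f \<longleftrightarrow>
     (\<exists>f'. (\<forall>x\<in>{0..b}. (f has_vector_derivative f' x) (at x within {0..b})) \<and>
           continuous_on {0..b} f' \<and>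
           (\<forall>x\<in>{0<..<b}. (f' has_vector_derivative - (k\<^sup>2 * of_real (\<rho> x) * f x)) (at x)) \<and>
           f 0 = 0 \<and> f' 0 = 1)"

(* Regular solutions agree on {0..b}; the choice only concerns values outside this interval. *)
definition phi :: "real \<Rightarrow> (real \<Rightarrow> real) \<Rightarrow> complex \<Rightarrow> real \<Rightarrow> complex" where
  "phi b \<rho> k = (SOME f. regular_solution b \<rho> k f)"

definition D_fun :: "real \<Rightarrow> (real \<Rightarrow> real) \<Rightarrow> complex \<Rightarrow> complex" where
  "D_fun b \<rho> k =
     (if k = 0 then of_real b else sin (k * of_real b) / k)
        * vector_derivative (phi b \<rho> k) (at b within {0..b})
     - cos (k * of_real b) * phi b \<rho> k b"

(* D is even, so either square root of \<kappa> may be used, and \<kappa> \<mapsto> D (csqrt \<kappa>) is D as an (entire)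
   function of k^2.  If D is identically zero, then zorder is an unspecified constant and
   the multiplicity carries no information. *)
definition multiplicity_ste :: "real \<Rightarrow> (real \<Rightarrow> real) \<Rightarrow> complex \<Rightarrow> nat" where
  "multiplicity_ste b \<rho> \<kappa> =
     (if \<kappa> = 0 then nat (zorder (\<lambda>w. D_fun b \<rho> (csqrt w)) 0)
      else nat (zorder (D_fun b \<rho>) (csqrt \<kappa>)))"

definition enumerates_nonzero_ste ::
    "real \<Rightarrow> (real \<Rightarrow> real) \<Rightarrow> (nat \<Rightarrow> complex) \<Rightarrow> bool" where
  "enumerates_nonzero_ste b \<rho> \<mu> \<longleftrightarrow>
     (\<forall>n. \<mu> n \<noteq> 0 \<and> special_transmission_eigenvalue b \<rho> (\<mu> n)) \<and>
     (\<forall>\<kappa>. \<kappa> \<noteq> 0 \<and> special_transmission_eigenvalue b \<rho> \<kappa> \<longrightarrow>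
          finite {n. \<mu> n = \<kappa>} \<and> card {n. \<mu> n = \<kappa>} = multiplicity_ste b \<rho> \<kappa>)"

(* If D is not identically zero, there are infinitely many eigenvalues and the product converges
   absolutely, so its value does not depend on the enumeration chosen. *)
definition E_fun :: "real \<Rightarrow> (real \<Rightarrow> real) \<Rightarrow> complex \<Rightarrow> complex" where
  "E_fun b \<rho> k =
     k ^ (2 * multiplicity_ste b \<rho> 0)
       * (\<Prod>n. 1 - k\<^sup>2 / (SOME \<mu>. enumerates_nonzero_ste b \<rho> \<mu>) n)"

definition gamma_const :: "real \<Rightarrow> (real \<Rightarrow> real) \<Rightarrow> real" where
  "gamma_const b \<rho> =
     (if \<forall>k. D_fun b \<rho> k = 0 then 0
      else (THE \<gamma>. \<forall>k. D_fun b \<rho> k = of_real \<gamma> * E_fun b \<rho> k))"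

definition same_ste_with_multiplicities ::
    "real \<Rightarrow> (real \<Rightarrow> real) \<Rightarrow> (real \<Rightarrow> real) \<Rightarrow> bool" where
  "same_ste_with_multiplicities b \<rho>1 \<rho>2 \<longleftrightarrow>
     (\<forall>\<kappa>. special_transmission_eigenvalue b \<rho>1 \<kappa> \<longleftrightarrow> special_transmission_eigenvalue b \<rho>2 \<kappa>) \<and>
     (\<forall>\<kappa>. special_transmission_eigenvalue b \<rho>1 \<kappa> \<longrightarrow>
          multiplicity_ste b \<rho>1 \<kappa> = multiplicity_ste b \<rho>2 \<kappa>)"

end

theory Submission
  imports Defs
begin

text \<open>Write \<open>\<kappa> = k\<^sup>2\<close>, \<open>Y(\<kappa>) = \<phi>(b;k)\<close>, \<open>Z(\<kappa>) = \<phi>'(b;k)\<close>, and let \<open>S = sin(kb)/k\<close> and \<open>C = cos(kb)\<close> be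
the same two quantities for the constant coefficient 1.  Then \<open>D = S Z - C Y\<close> is an entire function of
\<open>\<kappa>\<close> (here \<open>char_fun\<close>), and the proof goes from the eigenvalues to \<open>D\<close>, from \<open>D\<close> to the boundary
data \<open>Y\<close> and \<open>Z\<close>, and from these to the coefficient.

The eigenvalues give \<open>D\<close> up to a factor.  They are the zeros of \<open>D\<close>, because a spherically symmetric
solution of the Helmholtz equation is \<open>\<phi>(|x|)/|x|\<close> up to a constant
(\<open>eigenvalue_iff_char_fun_zero\<close>).  As a function of \<open>\<kappa>\<close>, \<open>D\<close> has growth of order one half and tends to
0 on the positive axis; hence, unless it vanishes identically, it has infinitely many zeros and is
\<open>\<gamma>\<close> times its Hadamard product (\<open>hadamard_half_order\<close>).  Equal eigenvalues therefore give
\<open>D\<^sub>1 = c D\<^sub>2\<close> for a constant \<open>c\<close>, which is 1 if \<open>\<gamma>\<^sub>1 = \<gamma>\<^sub>2\<close>.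

From \<open>D\<close> to the boundary data.  At \<open>k = n \<pi> / b\<close> with \<open>n \<noteq> 0\<close> the factor \<open>S\<close> vanishes and \<open>D\<close> reduces
to \<open>Y\<close> up to sign, so \<open>g(k) = Y\<^sub>1(k\<^sup>2) - c Y\<^sub>2(k\<^sup>2)\<close> vanishes there.  Since \<open>|k g(k)|\<close> is at most a
constant times \<open>exp(a |Im k|)\<close> with \<open>a = max a\<^sub>1 a\<^sub>2 \<le> b\<close>, the quotient
\<open>k g(k) / sin(kb)\<close> is entire and bounded, thus constant
(\<open>sine_type_interpolation\<close>).  If both travel times are smaller than \<open>b\<close>, growth along the
imaginary axis makes this constant 0, and then \<open>g(0) = b (1 - c)\<close> gives \<open>c = 1\<close>.  If instead \<open>c = 1\<close> is
known, \<open>g(0) = 0\<close> makes the constant 0.  In both cases \<open>Y\<^sub>1 = Y\<^sub>2\<close>, and \<open>D\<^sub>1 = D\<^sub>2\<close> yields \<open>Z\<^sub>1 = Z\<^sub>2\<close>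
wherever \<open>S \<noteq> 0\<close>, in particular for \<open>\<kappa> < 0\<close>.

From the boundary data to the coefficient.  Let \<open>s\<^sub>j\<close> and \<open>c\<^sub>j\<close> be the solutions, as
functions of the depth \<open>b - x\<close>, with Cauchy data \<open>(0,1)\<close> and \<open>(1,0)\<close> at depth 0, and let \<open>\<xi>\<^sub>1\<close>, \<open>\<xi>\<^sub>2\<close> be depths which
a wave starting at \<open>b\<close> reaches after the same time \<open>t\<close> in the two media.  The entire function
\<open>G = s\<^sub>1(\<xi>\<^sub>1) c\<^sub>2(\<xi>\<^sub>2) - c\<^sub>1(\<xi>\<^sub>1) s\<^sub>2(\<xi>\<^sub>2)\<close> of \<open>\<kappa>\<close> is bounded on the positive axis.  At \<open>\<kappa> = - K\<^sup>2\<close> the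
factors \<open>s\<^sub>j\<close> and \<open>c\<^sub>j\<close> grow like \<open>exp(K t)\<close>, but \<open>\<phi>\<^sub>j\<close>, which is the same combination of \<open>c\<^sub>j\<close> and \<open>s\<^sub>j\<close> in
both media, decays from the boundary inwards like \<open>exp(-K t)\<close>; eliminating it shows that \<open>G\<close> is
\<open>O(1/K)\<close>.  As \<open>G\<close> has growth of order one half, the theorem of Phragmen and Lindelof
makes it bounded, hence constant, and the constant is 0.  For \<open>\<kappa> = 0\<close> one has
\<open>s\<^sub>j(\<xi>) = \<xi>\<close> and \<open>c\<^sub>j = 1\<close>, so \<open>G(0) = \<xi>\<^sub>1 - \<xi>\<^sub>2\<close>.  Equal travel times thus mean equal depths, and
differentiating the travel time gives \<open>\<rho>\<^sub>1 = \<rho>\<^sub>2\<close> (\<open>coefficient_determined_by_boundary_data\<close>).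

The upper growth bounds for solutions come from the energy \<open>|y'|\<^sup>2 + |k|\<^sup>2 \<rho> |y|\<^sup>2\<close>, whose logarithmic
derivative is at most
\<open>2 |Im k| sqrt \<rho> + |\<rho>'| / \<rho>\<close>; the first term integrates to the travel time.\<close>

section \<open>The initial value problem as a function of the spectral parameter\<close>

text \<open>The equation \<open>y'' + \<kappa> r y = 0\<close> as a first-order system with \<open>z = y'\<close>.  One-sided derivatives at both
ends make boundary values of \<open>y\<close> and \<open>z\<close> available and let the interval be reflected.\<close>

definition solves ::
  "real \<Rightarrow> (real \<Rightarrow> real) \<Rightarrow> complex \<Rightarrow> (real \<Rightarrow> complex) \<Rightarrow> (real \<Rightarrow> complex) \<Rightarrow> bool" where
  "solves b r \<kappa> y z \<longleftrightarrow>
     (\<forall>x\<in>{0..b}. (y has_vector_derivative z x) (at x within {0..b}) \<and>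
        (z has_vector_derivative - (\<kappa> * of_real (r x) * y x)) (at x within {0..b}))"

lemma gronwall:
  fixes e c C :: "real \<Rightarrow> real"
  assumes e: "\<And>x. x \<in> {0..b} \<Longrightarrow> (e has_real_derivative e' x) (at x within {0..b})"
    and C: "\<And>x. x \<in> {0..b} \<Longrightarrow> (C has_real_derivative c x) (at x within {0..b})"
    and le: "\<And>x. x \<in> {0..b} \<Longrightarrow> e' x \<le> c x * e x"
    and st: "0 \<le> s" "s \<le> t" "t \<le> b"
  shows "e t \<le> e s * exp (C t - C s)"
proof -
  let ?g = "\<lambda>x. e x * exp (- C x)"
  have g: "(?g has_real_derivative (e' x - c x * e x) * exp (- C x)) (at x within {0..b})"
    if "x \<in> {0..b}" for x
    using e[OF that] C[OF that] by (auto intro!: derivative_eq_intros simp: algebra_simps)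
  have "?g t \<le> ?g s"
  proof (rule DERIV_nonpos_imp_decreasing_open[OF st(2)])
    fix x assume x: "s < x" "x < t"
    with st have "x \<in> {0<..<b}" "x \<in> {0..b}" by auto
    then have "(?g has_real_derivative (e' x - c x * e x) * exp (- C x)) (at x)"
      using g[of x] at_within_interior[of x "{0..b}"] by (simp add: interior_atLeastAtMost_real)
    moreover have "(e' x - c x * e x) * exp (- C x) \<le> 0"
      using le[OF \<open>x \<in> {0..b}\<close>] by (simp add: mult_nonpos_nonneg)
    ultimately show "\<exists>y. (?g has_real_derivative y) (at x) \<and> y \<le> 0" by blast
  next
    show "continuous_on {s..t} ?g"
      by (rule continuous_on_subset[of "{0..b}"])
        (use st in \<open>auto intro: DERIV_continuous_on[OF g]\<close>)
  qed
  then have "e t * exp (- C t) * exp (C t) \<le> e s * exp (- C s) * exp (C t)"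
    by (intro mult_right_mono) auto
  then show ?thesis by (simp add: mult.assoc flip: exp_add)
qed

lemma norm_power2_has_real_derivative:
  fixes f :: "real \<Rightarrow> complex"
  assumes "(f has_vector_derivative f') (at x within S)"
  shows "((\<lambda>x. (norm (f x))\<^sup>2) has_real_derivative 2 * (f x \<bullet> f')) (at x within S)"
proof -
  have "((\<lambda>x. f x \<bullet> f x) has_derivative (\<lambda>h. f x \<bullet> (h *\<^sub>R f') + (h *\<^sub>R f') \<bullet> f x)) (at x within S)"
    using assms unfolding has_vector_derivative_def
    by (intro has_derivative_inner)
  then show ?thesis
    unfolding has_field_derivative_def power2_norm_eq_inner
    by (rule has_derivative_eq_rhs) (auto simp: inner_commute)
qed

lemma continuous_on_Icc_bounded:
  fixes r :: "real \<Rightarrow> real"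
  assumes "continuous_on {a..b} r"
  obtains M where "\<And>x. x \<in> {a..b} \<Longrightarrow> \<bar>r x\<bar> \<le> M"
proof -
  have "bounded (r ` {a..b})"
    by (rule compact_imp_bounded[OF compact_continuous_image[OF assms compact_Icc]])
  then obtain M where "\<forall>y\<in>r ` {a..b}. norm y \<le> M" unfolding bounded_iff by blast
  then show ?thesis by (intro that[of M]) auto
qed

lemma solves_linear_combination:
  assumes "solves b r \<kappa> y z" "solves b r \<kappa> y' z'"
  shows "solves b r \<kappa> (\<lambda>x. A * y x + B * y' x) (\<lambda>x. A * z x + B * z' x)"
  using assms unfolding solves_def
  by (auto intro!: derivative_eq_intros simp: algebra_simps)

text \<open>Gronwall's inequality for \<open>|y|\<^sup>2 + |z|\<^sup>2\<close>.\<close>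

lemma solves_zero_unique:
  assumes r: "continuous_on {0..b} r" and s: "solves b r \<kappa> y z" and i: "y 0 = 0" "z 0 = 0"
    and x: "x \<in> {0..b}"
  shows "y x = 0 \<and> z x = 0"
proof -
  obtain M where M: "\<And>x. x \<in> {0..b} \<Longrightarrow> \<bar>r x\<bar> \<le> M"
    using continuous_on_Icc_bounded[OF r] by metis
  define c where "c = 1 + norm \<kappa> * M"
  let ?e = "\<lambda>x. (norm (y x))\<^sup>2 + (norm (z x))\<^sup>2"
  let ?e' = "\<lambda>x. 2 * (y x \<bullet> z x) + 2 * (z x \<bullet> - (\<kappa> * of_real (r x) * y x))"
  have "?e x \<le> ?e 0 * exp ((\<lambda>x. c * x) x - (\<lambda>x. c * x) 0)"
  proof (rule gronwall[where c="\<lambda>_. c" and b=b and e'="?e'"])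
    fix t assume t: "t \<in> {0..b}"
    show "(?e has_real_derivative ?e' t) (at t within {0..b})"
      using s t unfolding solves_def
      by (intro DERIV_add norm_power2_has_real_derivative) auto
    have 1: "y t \<bullet> z t \<le> norm (y t) * norm (z t)" by (rule norm_cauchy_schwarz)
    have "z t \<bullet> - (\<kappa> * of_real (r t) * y t) \<le> norm (z t) * norm (- (\<kappa> * of_real (r t) * y t))"
      by (rule norm_cauchy_schwarz)
    also have "\<dots> = (norm \<kappa> * \<bar>r t\<bar>) * (norm (y t) * norm (z t))" by (simp add: norm_mult)
    also have "\<dots> \<le> (norm \<kappa> * M) * (norm (y t) * norm (z t))"
      using M[OF t] by (intro mult_right_mono mult_left_mono) auto
    finally have "?e' t \<le> c * (2 * (norm (y t) * norm (z t)))" using 1 by (simp add: c_def algebra_simps)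
    also have "\<dots> \<le> c * ?e t"
    proof (rule mult_left_mono)
      show "2 * (norm (y t) * norm (z t)) \<le> ?e t" using sum_squares_bound[of "norm (y t)" "norm (z t)"] by simp
      have "0 \<le> M" using M[OF t] by linarith
      then show "0 \<le> c" unfolding c_def by simp
    qed
    finally show "?e' t \<le> c * ?e t" .
    show "((\<lambda>x. c * x) has_real_derivative c) (at t within {0..b})"
      by (auto intro!: derivative_eq_intros)
  qed (use x in auto)
  then show ?thesis using i by (simp add: sum_power2_le_zero_iff)
qed

lemma solves_unique:
  assumes r: "continuous_on {0..b} r" and s: "solves b r \<kappa> y z" "solves b r \<kappa> y' z'"
    and i: "y 0 = y' 0" "z 0 = z' 0" and x: "x \<in> {0..b}"
  shows "y x = y' x" "z x = z' x"
proof -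
  have "solves b r \<kappa> (\<lambda>x. 1 * y x + (-1) * y' x) (\<lambda>x. 1 * z x + (-1) * z' x)"
    by (rule solves_linear_combination[OF s])
  from solves_zero_unique[OF r this _ _ x] i show "y x = y' x" "z x = z' x" by auto
qed

text \<open>A solution known only on the open interval extends to the right endpoint: \<open>y''\<close> stays continuous up to
\<open>b\<close>, so \<open>y\<close> is recovered by integrating twice.\<close>

lemma solves_of_interior:
  assumes b: "0 < b" and r: "continuous_on {0..b} r" and y: "continuous_on {0..b} y"
    and y': "\<And>x. x \<in> {0..<b} \<Longrightarrow> (y has_vector_derivative z x) (at x within {0..b})"
    and z: "continuous_on {0..<b} z"
    and z': "\<And>x. x \<in> {0<..<b} \<Longrightarrow> (z has_vector_derivative - (\<kappa> * of_real (r x) * y x)) (at x)"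
  obtains w where "solves b r \<kappa> y w" "w 0 = z 0"
proof
  let ?q = "\<lambda>t. - (\<kappa> * of_real (r t) * y t)"
  let ?w = "\<lambda>x. z 0 + integral {0..x} ?q"
  let ?Y = "\<lambda>x. y 0 + integral {0..x} ?w"
  have q: "continuous_on {0..b} ?q" using r y by (intro continuous_intros)
  have w': "(?w has_vector_derivative ?q x) (at x within {0..b})" if "x \<in> {0..b}" for x
    by (rule has_vector_derivative_eq_rhs[OF has_vector_derivative_add[OF
          has_vector_derivative_const integral_has_vector_derivative[OF q that]]]) simp
  then have w: "continuous_on {0..b} ?w"
    by (rule continuous_on_vector_derivative)
  have Y': "(?Y has_vector_derivative ?w x) (at x within {0..b})" if "x \<in> {0..b}" for x
    by (rule has_vector_derivative_eq_rhs[OF has_vector_derivative_add[OF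
          has_vector_derivative_const integral_has_vector_derivative[OF w that]]]) simp
  have zw: "z x = ?w x" if x: "x \<in> {0..<b}" for x
  proof -
    have "(?q has_integral (z x - z 0)) {0..x}"
      by (rule fundamental_theorem_of_calculus_interior)
        (use x z' in \<open>auto intro: continuous_on_subset[OF z]\<close>)
    then have "integral {0..x} ?q = z x - z 0" by (rule integral_unique)
    then show ?thesis by simp
  qed
  have yY: "y x = ?Y x" if x: "x \<in> {0..b}" for x
  proof -
    have "(?w has_integral (y x - y 0)) {0..x}"
    proof (rule fundamental_theorem_of_calculus_interior)
      fix t assume t: "t \<in> {0<..<x}"
      then have "(y has_vector_derivative z t) (at t)"
        using y'[of t] x at_within_interior[of t "{0..b}"] by (simp add: interior_atLeastAtMost_real)
      then show "(y has_vector_derivative ?w t) (at t)" using zw[of t] t x by simp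
    qed (use x in \<open>auto intro: continuous_on_subset[OF y]\<close>)
    then have "integral {0..x} ?w = y x - y 0" by (rule integral_unique)
    then show ?thesis by simp
  qed
  have "(y has_vector_derivative ?w x) (at x within {0..b})" if "x \<in> {0..b}" for x
    by (rule has_vector_derivative_transform[OF that yY Y'[OF that]])
  then show "solves b r \<kappa> y ?w" unfolding solves_def using w' by auto
  show "?w 0 = z 0" by simp
qed

text \<open>Picard iteration, sorted by powers of \<open>-\<kappa>\<close>: the \<open>n\<close>-th coefficient is the \<open>n\<close>-fold application of the double
integral with weight \<open>r\<close> to \<open>\<alpha> + \<beta> x\<close>.  Since these coefficients are real and independent of \<open>\<kappa>\<close>,
holomorphy in \<open>\<kappa>\<close>, reality for real \<open>\<kappa>\<close> and, for positive \<open>r\<close> and nonnegative \<open>\<alpha>\<close> and \<open>\<beta>\<close>, the sign for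
negative \<open>\<kappa>\<close> can be read off the series.\<close>

primrec ycoef :: "(real \<Rightarrow> real) \<Rightarrow> real \<Rightarrow> real \<Rightarrow> nat \<Rightarrow> real \<Rightarrow> real" where
  "ycoef r \<alpha> \<beta> 0 = (\<lambda>x. \<alpha> + \<beta> * x)"
| "ycoef r \<alpha> \<beta> (Suc n) =
     (\<lambda>x. integral {0..x} (\<lambda>s. integral {0..s} (\<lambda>t. r t * ycoef r \<alpha> \<beta> n t)))"

definition zcoef :: "(real \<Rightarrow> real) \<Rightarrow> real \<Rightarrow> real \<Rightarrow> nat \<Rightarrow> real \<Rightarrow> real" where
  "zcoef r \<alpha> \<beta> n x = (case n of 0 \<Rightarrow> \<beta> | Suc m \<Rightarrow> integral {0..x} (\<lambda>t. r t * ycoef r \<alpha> \<beta> m t))"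

text \<open>The solution with initial values \<open>y(0) = \<alpha>\<close> and \<open>y'(0) = \<beta>\<close>; its derivative is \<open>zsol\<close>.\<close>

definition ysol :: "(real \<Rightarrow> real) \<Rightarrow> real \<Rightarrow> real \<Rightarrow> complex \<Rightarrow> real \<Rightarrow> complex" where
  "ysol r \<alpha> \<beta> \<kappa> x = (\<Sum>n. of_real (ycoef r \<alpha> \<beta> n x) * (- \<kappa>) ^ n)"

definition zsol :: "(real \<Rightarrow> real) \<Rightarrow> real \<Rightarrow> real \<Rightarrow> complex \<Rightarrow> real \<Rightarrow> complex" where
  "zsol r \<alpha> \<beta> \<kappa> x = (\<Sum>n. of_real (zcoef r \<alpha> \<beta> n x) * (- \<kappa>) ^ n)"

lemma ycoef_cont: "continuous_on {0..b} r \<Longrightarrow> continuous_on {0..b} (ycoef r \<alpha> \<beta> n)"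
proof (induction n)
  case 0 show ?case by (auto intro!: continuous_intros)
next
  case (Suc n)
  then have "continuous_on {0..b} (\<lambda>t. r t * ycoef r \<alpha> \<beta> n t)" by (intro continuous_intros)
  then have "continuous_on {0..b} (\<lambda>s. integral {0..s} (\<lambda>t. r t * ycoef r \<alpha> \<beta> n t))"
    by (intro indefinite_integral_continuous_1 integrable_continuous_real)
  then show ?case
    by (auto intro!: indefinite_integral_continuous_1 integrable_continuous_real)
qed

lemma zcoef_deriv:
  assumes "continuous_on {0..b} r" "x \<in> {0..b}"
  shows "(zcoef r \<alpha> \<beta> (Suc n) has_real_derivative r x * ycoef r \<alpha> \<beta> n x) (at x within {0..b})"
  using integral_has_vector_derivative[of 0 b "\<lambda>t. r t * ycoef r \<alpha> \<beta> n t" x] assms ycoef_cont[OF assms(1)]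
  by (auto simp: zcoef_def[abs_def] has_real_derivative_iff_has_vector_derivative intro!: continuous_intros)

lemma ycoef_deriv:
  assumes "continuous_on {0..b} r" "x \<in> {0..b}"
  shows "(ycoef r \<alpha> \<beta> n has_real_derivative zcoef r \<alpha> \<beta> n x) (at x within {0..b})"
proof (cases n)
  case 0 then show ?thesis by (auto simp: zcoef_def intro!: derivative_eq_intros)
next
  case (Suc m)
  have "continuous_on {0..b} (zcoef r \<alpha> \<beta> n)"
    unfolding Suc by (rule DERIV_continuous_on[OF zcoef_deriv[OF assms(1)]])
  from integral_has_vector_derivative[OF this assms(2)]
  have "((\<lambda>x. integral {0..x} (zcoef r \<alpha> \<beta> n)) has_real_derivative zcoef r \<alpha> \<beta> n x) (at x within {0..b})"
    by (simp add: has_real_derivative_iff_has_vector_derivative)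
  also have "(\<lambda>x. integral {0..x} (zcoef r \<alpha> \<beta> n)) = ycoef r \<alpha> \<beta> n"
    by (simp add: Suc zcoef_def[abs_def])
  finally show ?thesis .
qed

lemma zcoef_cont: "continuous_on {0..b} r \<Longrightarrow> continuous_on {0..b} (zcoef r \<alpha> \<beta> n)"
proof (cases n)
  case 0
  have "zcoef r \<alpha> \<beta> 0 = (\<lambda>_. \<beta>)" by (simp add: zcoef_def fun_eq_iff)
  then show ?thesis using 0 by simp
next
  case (Suc m)
  assume r: "continuous_on {0..b} r"
  show ?thesis unfolding Suc by (rule DERIV_continuous_on[OF zcoef_deriv[OF r]])
qed

lemma ycoef_0 [simp]: "ycoef r \<alpha> \<beta> n 0 = (if n = 0 then \<alpha> else 0)"
  by (cases n) auto

lemma zcoef_0 [simp]: "zcoef r \<alpha> \<beta> n 0 = (if n = 0 then \<beta> else 0)"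
  by (cases n) (auto simp: zcoef_def)

lemma integral_monomial_bound:
  fixes f :: "real \<Rightarrow> real"
  assumes f: "continuous_on {0..x} f" and x: "0 \<le> x"
    and le: "\<And>t. t \<in> {0..x} \<Longrightarrow> \<bar>f t\<bar> \<le> A * t ^ n / fact n"
  shows "\<bar>integral {0..x} f\<bar> \<le> A * x ^ Suc n / fact (Suc n)"
proof -
  have "((\<lambda>t. A * t ^ n / fact n) has_integral
      (\<lambda>t. A * t ^ Suc n / fact (Suc n)) x - (\<lambda>t. A * t ^ Suc n / fact (Suc n)) 0) {0..x}"
  proof (rule fundamental_theorem_of_calculus[OF x])
    fix t :: real
    have "((\<lambda>t. A * t ^ Suc n / fact (Suc n)) has_real_derivative A * t ^ n / fact n) (at t within {0..x})"
    proof (rule DERIV_cong)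
      have "((\<lambda>t. t ^ Suc n) has_real_derivative real (Suc n) * t ^ n) (at t within {0..x})"
        using DERIV_pow[of "Suc n" t "{0..x}"] by simp
      then show "((\<lambda>t. A * t ^ Suc n / fact (Suc n)) has_real_derivative
          A * (real (Suc n) * t ^ n) / fact (Suc n)) (at t within {0..x})"
        by (intro DERIV_cdivide DERIV_cmult)
      show "A * (real (Suc n) * t ^ n) / fact (Suc n) = A * t ^ n / fact n"
        by (simp only: fact_Suc) (simp add: field_simps del: of_nat_Suc)
    qed
    then show "((\<lambda>t. A * t ^ Suc n / fact (Suc n)) has_vector_derivative A * t ^ n / fact n) (at t within {0..x})"
      by (simp add: has_real_derivative_iff_has_vector_derivative)
  qed
  then have i: "((\<lambda>t. A * t ^ n / fact n) has_integral A * x ^ Suc n / fact (Suc n)) {0..x}" by simp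
  have "norm (integral {0..x} f) \<le> integral {0..x} (\<lambda>t. A * t ^ n / fact n)"
    by (rule integral_norm_bound_integral) (use f i le in \<open>auto intro: integrable_continuous_real\<close>)
  then show ?thesis using integral_unique[OF i] by simp
qed

text \<open>The factorial in the denominator, which makes the series entire in \<open>\<kappa>\<close>, comes from the \<open>n\<close> nested
integrations; of the two integrations in each step, one is estimated trivially by the length \<open>b\<close>.\<close>

lemma coef_bounds:
  assumes r: "continuous_on {0..b} r" and b: "0 \<le> b"
  obtains B K where "0 \<le> K" "\<And>n x. x \<in> {0..b} \<Longrightarrow> \<bar>ycoef r \<alpha> \<beta> n x\<bar> \<le> B * K ^ n / fact n"
    "\<And>n x. x \<in> {0..b} \<Longrightarrow> \<bar>zcoef r \<alpha> \<beta> n x\<bar> \<le> B * K ^ n / fact n"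
proof -
  obtain M where M: "\<And>x. x \<in> {0..b} \<Longrightarrow> \<bar>r x\<bar> \<le> M"
    using continuous_on_Icc_bounded[OF r] by metis
  have M0: "0 \<le> M" using M[of 0] b by force
  define K where "K = M * (1 + b)"
  define B where "B = \<bar>\<alpha>\<bar> + \<bar>\<beta>\<bar> * (1 + b)"
  have K0: "0 \<le> K" "0 \<le> B" using M0 b by (auto simp: K_def B_def)
  have y: "\<bar>ycoef r \<alpha> \<beta> n x\<bar> \<le> B * K ^ n * x ^ n / fact n"
    and zS: "\<bar>zcoef r \<alpha> \<beta> (Suc n) x\<bar> \<le> (M * (B * K ^ n)) * x ^ Suc n / fact (Suc n)"
    if "x \<in> {0..b}" for n x
  proof -
    have Z: "\<bar>zcoef r \<alpha> \<beta> (Suc n) x\<bar> \<le> (M * (B * K ^ n)) * x ^ Suc n / fact (Suc n)"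
      if y: "\<And>x. x \<in> {0..b} \<Longrightarrow> \<bar>ycoef r \<alpha> \<beta> n x\<bar> \<le> B * K ^ n * x ^ n / fact n"
        and x: "x \<in> {0..b}" for n x
      unfolding zcoef_def nat.case
    proof (rule integral_monomial_bound)
      show "continuous_on {0..x} (\<lambda>t. r t * ycoef r \<alpha> \<beta> n t)"
        by (rule continuous_on_subset[of "{0..b}"]) (use x r ycoef_cont[OF r] in \<open>auto intro!: continuous_intros\<close>)
      fix t assume "t \<in> {0..x}"
      then have t: "t \<in> {0..b}" using x by auto
      have "\<bar>r t * ycoef r \<alpha> \<beta> n t\<bar> \<le> M * (B * K ^ n * t ^ n / fact n)"
        unfolding abs_mult by (intro mult_mono M y t M0) auto
      then show "\<bar>r t * ycoef r \<alpha> \<beta> n t\<bar> \<le> M * (B * K ^ n) * t ^ n / fact n" by (simp add: mult_ac)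
    qed (use x in auto)
    have Y: "\<bar>ycoef r \<alpha> \<beta> n x\<bar> \<le> B * K ^ n * x ^ n / fact n" if "x \<in> {0..b}" for n x
      using that
    proof (induction n arbitrary: x)
      case 0
      have "\<bar>\<alpha> + \<beta> * x\<bar> \<le> \<bar>\<alpha>\<bar> + \<bar>\<beta>\<bar> * x" using 0 abs_triangle_ineq[of \<alpha> "\<beta> * x"] by (simp add: abs_mult)
      also have "\<dots> \<le> B" unfolding B_def using 0 by (intro add_mono mult_left_mono) auto
      finally show ?case by simp
    next
      case (Suc n)
      have "\<bar>ycoef r \<alpha> \<beta> (Suc n) x\<bar> = \<bar>integral {0..x} (zcoef r \<alpha> \<beta> (Suc n))\<bar>"
        by (simp add: zcoef_def[abs_def])
      also have "\<dots> \<le> integral {0..x} (\<lambda>t. (M * (B * K ^ n)) * x ^ Suc n / fact (Suc n))"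
      proof (subst real_norm_def[symmetric], rule integral_norm_bound_integral)
        fix t assume t: "t \<in> {0..x}"
        have "norm (zcoef r \<alpha> \<beta> (Suc n) t) \<le> (M * (B * K ^ n)) * t ^ Suc n / fact (Suc n)"
          unfolding real_norm_def by (rule Z) (use Suc t in auto)
        also have "\<dots> \<le> (M * (B * K ^ n)) * x ^ Suc n / fact (Suc n)"
          using t M0 K0 by (intro divide_right_mono mult_left_mono power_mono) auto
        finally show "norm (zcoef r \<alpha> \<beta> (Suc n) t) \<le> (M * (B * K ^ n)) * x ^ Suc n / fact (Suc n)" .
      qed (use Suc.prems in \<open>auto intro!: integrable_continuous_real continuous_on_subset[OF zcoef_cont[OF r]]\<close>)
      also have "\<dots> = x * ((M * (B * K ^ n)) * x ^ Suc n / fact (Suc n))" using Suc.prems by simp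
      also have "\<dots> \<le> (1 + b) * ((M * (B * K ^ n)) * x ^ Suc n / fact (Suc n))"
        using Suc.prems M0 K0 by (intro mult_right_mono) auto
      also have "\<dots> = B * K ^ Suc n * x ^ Suc n / fact (Suc n)" by (simp add: K_def mult_ac)
      finally show ?case .
    qed
    show "\<bar>ycoef r \<alpha> \<beta> n x\<bar> \<le> B * K ^ n * x ^ n / fact n" by (rule Y[OF that])
    show "\<bar>zcoef r \<alpha> \<beta> (Suc n) x\<bar> \<le> (M * (B * K ^ n)) * x ^ Suc n / fact (Suc n)"
      by (rule Z[OF Y that])
  qed
  show thesis
  proof (rule that[of "K * b" B])
    fix n x assume x: "x \<in> {0..b}"
    have xb: "x ^ m \<le> b ^ m" for m using x by (intro power_mono) auto
    show "\<bar>ycoef r \<alpha> \<beta> n x\<bar> \<le> B * (K * b) ^ n / fact n"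
      using order_trans[OF y[OF x] divide_right_mono[OF mult_left_mono[OF xb]]] K0
      by (simp add: power_mult_distrib mult.assoc)
    show "\<bar>zcoef r \<alpha> \<beta> n x\<bar> \<le> B * (K * b) ^ n / fact n"
    proof (cases n)
      case 0
      have "\<bar>\<beta>\<bar> * 1 \<le> \<bar>\<beta>\<bar> * (1 + b)" using b by (intro mult_left_mono) auto
      then show ?thesis using 0 by (simp add: zcoef_def B_def)
    next
      case (Suc m)
      have "\<bar>zcoef r \<alpha> \<beta> (Suc m) x\<bar> \<le> (M * (B * K ^ m)) * b ^ Suc m / fact (Suc m)"
        using order_trans[OF zS[OF x] divide_right_mono[OF mult_left_mono[OF xb]]] K0 M0 by simp
      also have "\<dots> \<le> (K * (B * K ^ m)) * b ^ Suc m / fact (Suc m)"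
        using K0 M0 b by (intro divide_right_mono mult_right_mono) (auto simp: K_def algebra_simps)
      finally show ?thesis using Suc by (simp add: power_mult_distrib mult_ac)
    qed
  qed (use K0 b in auto)
qed

lemma has_vector_derivative_series:
  fixes f f' :: "nat \<Rightarrow> real \<Rightarrow> 'a::banach"
  assumes S: "convex S"
    and d: "\<And>n x. x \<in> S \<Longrightarrow> (f n has_vector_derivative f' n x) (at x within S)"
    and m: "\<And>n x. x \<in> S \<Longrightarrow> norm (f' n x) \<le> m n" "summable m"
    and s: "\<And>x. x \<in> S \<Longrightarrow> summable (\<lambda>n. f n x)" and x: "x \<in> S"
  shows "((\<lambda>x. \<Sum>n. f n x) has_vector_derivative (\<Sum>n. f' n x)) (at x within S)"
proof -
  have ul: "uniform_limit S (\<lambda>n x. \<Sum>i<n. f' i x) (\<lambda>x. \<Sum>i. f' i x) sequentially"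
    by (rule Weierstrass_m_test[OF m])
  have "\<exists>g. \<forall>x\<in>S. (\<lambda>n. f n x) sums (g x) \<and> (g has_derivative (\<lambda>h. h *\<^sub>R (\<Sum>i. f' i x))) (at x within S)"
  proof (rule has_derivative_series[OF S _ _ x, where f'="\<lambda>n x h. h *\<^sub>R f' n x"])
    show "(f n has_derivative (\<lambda>h. h *\<^sub>R f' n x)) (at x within S)" if "x \<in> S" for n x
      using d[OF that] by (simp add: has_vector_derivative_def)
    show "\<forall>\<^sub>F n in sequentially. \<forall>x\<in>S. \<forall>h. norm ((\<Sum>i<n. h *\<^sub>R f' i x) - h *\<^sub>R (\<Sum>i. f' i x)) \<le> e * norm h"
      if "e > 0" for e
      using uniform_limitD[OF ul that]
    proof eventually_elim
      case (elim n)
      show ?case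
      proof (intro ballI allI)
        fix x h assume "x \<in> S"
        have "norm ((\<Sum>i<n. h *\<^sub>R f' i x) - h *\<^sub>R (\<Sum>i. f' i x)) = \<bar>h\<bar> * dist (\<Sum>i<n. f' i x) (\<Sum>i. f' i x)"
          by (simp add: dist_norm flip: scaleR_sum_right scaleR_diff_right)
        also have "\<dots> \<le> \<bar>h\<bar> * e" using elim \<open>x \<in> S\<close> by (intro mult_left_mono) (auto intro: less_imp_le)
        finally show "norm ((\<Sum>i<n. h *\<^sub>R f' i x) - h *\<^sub>R (\<Sum>i. f' i x)) \<le> e * norm h"
          by (simp add: mult.commute)
      qed
    qed
    show "(\<lambda>n. f n x) sums (\<Sum>n. f n x)" using s[OF x] by (rule summable_sums)
  qed
  then obtain g where g: "\<And>x. x \<in> S \<Longrightarrow> (\<lambda>n. f n x) sums (g x)"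
    "\<And>x. x \<in> S \<Longrightarrow> (g has_derivative (\<lambda>h. h *\<^sub>R (\<Sum>i. f' i x))) (at x within S)" by blast
  have "(g has_vector_derivative (\<Sum>n. f' n x)) (at x within S)"
    using g(2)[OF x] by (simp add: has_vector_derivative_def)
  then show ?thesis
    by (rule has_vector_derivative_transform[OF x, rotated]) (use g(1) in \<open>simp add: sums_iff\<close>)
qed

lemma exp_coef_summable:
  fixes a :: "nat \<Rightarrow> real"
  assumes "\<And>n. \<bar>a n\<bar> \<le> B * K ^ n / fact n" "0 \<le> K"
  shows "summable (\<lambda>n. of_real (a n) * (\<kappa>::complex) ^ n)"
    and "summable (\<lambda>n. B * K ^ n / fact n * norm \<kappa> ^ n)"
proof -
  have "summable (\<lambda>n. B * ((K * norm \<kappa>) ^ n /\<^sub>R fact n))"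
    by (intro summable_mult summable_exp_generic)
  then show S: "summable (\<lambda>n. B * K ^ n / fact n * norm \<kappa> ^ n)"
    by (simp add: power_mult_distrib field_simps)
  show "summable (\<lambda>n. of_real (a n) * (\<kappa>::complex) ^ n)"
  proof (rule summable_comparison_test'[OF S, of 0])
    fix n
    have "\<bar>a n\<bar> * norm \<kappa> ^ n \<le> B * K ^ n / fact n * norm \<kappa> ^ n"
      by (intro mult_right_mono assms) auto
    then show "norm (of_real (a n) * \<kappa> ^ n) \<le> B * K ^ n / fact n * norm \<kappa> ^ n"
      by (simp add: norm_mult norm_power)
  qed
qed

lemma solves_ysol:
  assumes r: "continuous_on {0..b} r" and b: "0 \<le> b"
  shows "solves b r \<kappa> (ysol r \<alpha> \<beta> \<kappa>) (zsol r \<alpha> \<beta> \<kappa>)"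
proof -
  obtain B K where K: "0 \<le> K" and bd: "\<And>n x. x \<in> {0..b} \<Longrightarrow> \<bar>ycoef r \<alpha> \<beta> n x\<bar> \<le> B * K ^ n / fact n"
    "\<And>n x. x \<in> {0..b} \<Longrightarrow> \<bar>zcoef r \<alpha> \<beta> n x\<bar> \<le> B * K ^ n / fact n"
    using coef_bounds[OF r b] by metis
  obtain M where M: "\<And>x. x \<in> {0..b} \<Longrightarrow> \<bar>r x\<bar> \<le> M"
    using continuous_on_Icc_bounded[OF r] by metis
  let ?m = "\<lambda>n. B * K ^ n / fact n * norm \<kappa> ^ n"
  have sm: "summable ?m" using exp_coef_summable(2)[OF bd(1)[of 0] K, of \<kappa>] b by simp
  have sy: "summable (\<lambda>n. of_real (ycoef r \<alpha> \<beta> n x) * (-\<kappa>) ^ n)"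
    and sz: "summable (\<lambda>n. of_real (zcoef r \<alpha> \<beta> n x) * (-\<kappa>) ^ n)" if "x \<in> {0..b}" for x
    using exp_coef_summable(1)[OF bd(1)[OF that] K] exp_coef_summable(1)[OF bd(2)[OF that] K] by auto
  have rd: "((\<lambda>x. of_real (f x) * (c::complex)) has_vector_derivative of_real f' * c) (at x within S)"
    if "(f has_real_derivative f') (at x within S)" for f f' c x S
    using that by (auto intro!: derivative_eq_intros
        simp: has_real_derivative_iff_has_vector_derivative has_vector_derivative_of_real)
  have y: "(ysol r \<alpha> \<beta> \<kappa> has_vector_derivative zsol r \<alpha> \<beta> \<kappa> x) (at x within {0..b})"
    if x: "x \<in> {0..b}" for x
    unfolding ysol_def[abs_def] zsol_def
  proof (rule has_vector_derivative_series[OF _ _ _ sm _ x])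
    fix n t assume t: "t \<in> {0..b}"
    show "((\<lambda>x. of_real (ycoef r \<alpha> \<beta> n x) * (-\<kappa>) ^ n) has_vector_derivative
       of_real (zcoef r \<alpha> \<beta> n t) * (-\<kappa>) ^ n) (at t within {0..b})"
      by (rule rd[OF ycoef_deriv[OF r t]])
    show "norm (of_real (zcoef r \<alpha> \<beta> n t) * (-\<kappa>) ^ n) \<le> ?m n"
      unfolding norm_mult norm_power norm_minus_cancel norm_of_real
      by (intro mult_right_mono bd(2)[OF t]) auto
  qed (use sy in auto)
  let ?f' = "\<lambda>n x. case n of 0 \<Rightarrow> 0 | Suc m \<Rightarrow> of_real (r x * ycoef r \<alpha> \<beta> m x) * (-\<kappa>) ^ Suc m"
  let ?m' = "\<lambda>n. case n of 0 \<Rightarrow> 0 | Suc m \<Rightarrow> M * norm \<kappa> * ?m m"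
  have z: "(zsol r \<alpha> \<beta> \<kappa> has_vector_derivative (\<Sum>n. ?f' n x)) (at x within {0..b})"
    if x: "x \<in> {0..b}" for x
    unfolding zsol_def[abs_def]
  proof (rule has_vector_derivative_series[OF _ _ _ _ _ x, where m="?m'"])
    fix n t assume t: "t \<in> {0..b}"
    show "((\<lambda>x. of_real (zcoef r \<alpha> \<beta> n x) * (-\<kappa>) ^ n) has_vector_derivative ?f' n t) (at t within {0..b})"
    proof (cases n)
      case 0
      have "zcoef r \<alpha> \<beta> 0 = (\<lambda>_. \<beta>)" by (simp add: zcoef_def fun_eq_iff)
      then show ?thesis using 0 by simp
    next
      case (Suc m)
      show ?thesis unfolding Suc nat.case by (rule rd[OF zcoef_deriv[OF r t]])
    qed
    have "norm (of_real (r t * ycoef r \<alpha> \<beta> m t) * (-\<kappa>) ^ Suc m) \<le> M * norm \<kappa> * ?m m" for m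
    proof -
      have "\<bar>r t\<bar> * \<bar>ycoef r \<alpha> \<beta> m t\<bar> * norm \<kappa> ^ Suc m \<le> M * (B * K ^ m / fact m) * norm \<kappa> ^ Suc m"
        using M[OF t] bd(1)[OF t, of m] by (intro mult_right_mono mult_mono) auto
      then show ?thesis by (simp add: norm_mult norm_power abs_mult mult_ac)
    qed
    then show "norm (?f' n t) \<le> ?m' n" by (cases n) auto
  next
    show "summable ?m'"
      by (subst summable_Suc_iff[symmetric], unfold nat.case) (rule summable_mult[OF sm])
  qed (use sz in auto)
  have "(\<Sum>n. ?f' n x) = - (\<kappa> * of_real (r x) * ysol r \<alpha> \<beta> \<kappa> x)" if x: "x \<in> {0..b}" for x
  proof -
    have "(\<lambda>m. - (\<kappa> * of_real (r x)) * (of_real (ycoef r \<alpha> \<beta> m x) * (-\<kappa>) ^ m))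
       sums (- (\<kappa> * of_real (r x)) * ysol r \<alpha> \<beta> \<kappa> x)"
      unfolding ysol_def by (intro sums_mult summable_sums sy x)
    then have "(\<lambda>m. ?f' (Suc m) x) sums (- (\<kappa> * of_real (r x)) * ysol r \<alpha> \<beta> \<kappa> x - ?f' 0 x)"
      by (simp add: mult_ac)
    from iffD1[OF sums_Suc_iff this] have "(\<lambda>n. ?f' n x) sums (- (\<kappa> * of_real (r x)) * ysol r \<alpha> \<beta> \<kappa> x)"
      by simp
    then show ?thesis by (simp add: sums_iff)
  qed
  with y z show ?thesis unfolding solves_def by auto
qed

lemma ysol_0: "ysol r \<alpha> \<beta> \<kappa> 0 = of_real \<alpha>" and zsol_0: "zsol r \<alpha> \<beta> \<kappa> 0 = of_real \<beta>"
proof -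
  have "(\<lambda>n. of_real (if n = 0 then c else 0) * (-\<kappa>) ^ n) = (\<lambda>n. if n = 0 then of_real c else 0)" for c
    by auto
  then show "ysol r \<alpha> \<beta> \<kappa> 0 = of_real \<alpha>" "zsol r \<alpha> \<beta> \<kappa> 0 = of_real \<beta>"
    unfolding ysol_def zsol_def ycoef_0 zcoef_0
    using sums_unique[OF sums_single[of 0 "\<lambda>_. complex_of_real \<alpha>"]]
      sums_unique[OF sums_single[of 0 "\<lambda>_. complex_of_real \<beta>"]] by simp_all
qed

lemma solution_holomorphic:
  assumes r: "continuous_on {0..b} r" and x: "x \<in> {0..b}"
  shows "(\<lambda>\<kappa>. ysol r \<alpha> \<beta> \<kappa> x) holomorphic_on S" "(\<lambda>\<kappa>. zsol r \<alpha> \<beta> \<kappa> x) holomorphic_on S"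
proof -
  have b: "0 \<le> b" using x by auto
  obtain B K where K: "0 \<le> K" and bd: "\<And>n x. x \<in> {0..b} \<Longrightarrow> \<bar>ycoef r \<alpha> \<beta> n x\<bar> \<le> B * K ^ n / fact n"
    "\<And>n x. x \<in> {0..b} \<Longrightarrow> \<bar>zcoef r \<alpha> \<beta> n x\<bar> \<le> B * K ^ n / fact n"
    using coef_bounds[OF r b] by metis
  have *: "(\<lambda>\<kappa>. \<Sum>n. of_real (a n) * (- \<kappa>) ^ n) holomorphic_on S"
    if a: "\<And>n. \<bar>a n\<bar> \<le> B * K ^ n / fact n" for a :: "nat \<Rightarrow> real"
  proof -
    let ?F = "\<lambda>w. \<Sum>n. complex_of_real (a n) * w ^ n"
    have "?F field_differentiable (at w)" for w
      unfolding field_differentiable_def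
      using termdiffs_strong_converges_everywhere[OF exp_coef_summable(1)[OF a K]] by blast
    then have "?F holomorphic_on UNIV" by (simp add: holomorphic_on_def)
    then have "?F \<circ> uminus holomorphic_on S"
      by (intro holomorphic_on_compose_gen[of _ _ _ UNIV] holomorphic_intros) auto
    then show ?thesis by (simp add: o_def)
  qed
  show "(\<lambda>\<kappa>. ysol r \<alpha> \<beta> \<kappa> x) holomorphic_on S" "(\<lambda>\<kappa>. zsol r \<alpha> \<beta> \<kappa> x) holomorphic_on S"
    unfolding ysol_def zsol_def using *[OF bd(1)[OF x]] *[OF bd(2)[OF x]] by auto
qed

section \<open>Energy estimates and the travel time\<close>

text \<open>The constant \<open>M\<close> bounds the logarithmic derivative of the coefficient; in the growth estimates it contributes
a factor \<open>exp(M b)\<close> that does not depend on the spectral parameter.\<close>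

definition regular_coeff :: "real \<Rightarrow> real \<Rightarrow> (real \<Rightarrow> real) \<Rightarrow> bool" where
  "regular_coeff b M r \<longleftrightarrow> 0 < b \<and> 0 \<le> M \<and>
     (\<forall>x\<in>{0..b}. 0 < r x \<and>
        (\<exists>r'. (r has_real_derivative r') (at x within {0..b}) \<and> \<bar>r'\<bar> \<le> M * r x))"

text \<open>The time a wave with local speed \<open>1 / sqrt r\<close> takes from 0 to \<open>x\<close>.\<close>

definition travel :: "(real \<Rightarrow> real) \<Rightarrow> real \<Rightarrow> real" where
  "travel r x = integral {0..x} (\<lambda>t. sqrt (r t))"

lemma regular_coeffD:
  assumes "regular_coeff b M r"
  shows "0 < b" "0 \<le> M" "x \<in> {0..b} \<Longrightarrow> 0 < r x" "continuous_on {0..b} r"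
proof -
  show "0 < b" "0 \<le> M" "x \<in> {0..b} \<Longrightarrow> 0 < r x" using assms by (auto simp: regular_coeff_def)
  obtain r' where "\<And>x. x \<in> {0..b} \<Longrightarrow> (r has_real_derivative r' x) (at x within {0..b})"
    using assms unfolding regular_coeff_def by metis
  then show "continuous_on {0..b} r" by (rule DERIV_continuous_on)
qed

lemma travel_deriv:
  assumes "regular_coeff b M r" "x \<in> {0..b}"
  shows "(travel r has_real_derivative sqrt (r x)) (at x within {0..b})"
  unfolding travel_def[abs_def] has_real_derivative_iff_has_vector_derivative
  by (rule integral_has_vector_derivative)
    (use regular_coeffD(4)[OF assms(1)] assms(2) in \<open>auto intro!: continuous_intros\<close>)

lemma travel_0 [simp]: "travel r 0 = 0" by (simp add: travel_def)

lemma travel_nonneg: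
  assumes "regular_coeff b M r" "x \<in> {0..b}"
  shows "0 \<le> travel r x"
  unfolding travel_def
proof (rule integral_nonneg)
  show "(\<lambda>t. sqrt (r t)) integrable_on {0..x}"
    by (rule integrable_continuous_real, rule continuous_on_subset[of "{0..b}"])
      (use assms regular_coeffD(4)[OF assms(1)] in \<open>auto intro!: continuous_intros\<close>)
  show "0 \<le> sqrt (r t)" if "t \<in> {0..x}" for t
    using regular_coeffD(3)[OF assms(1), of t] that assms(2) by (intro real_sqrt_ge_zero) auto
qed

text \<open>Differentiating the energy produces \<open>2 r Re (conj(y') (|k|\<^sup>2 - k\<^sup>2) y)\<close>, and \<open>|k|\<^sup>2 - k\<^sup>2 = -2 i k Im k\<close>.  This is why
\<open>|Im k|\<close> and not \<open>|k|\<close> governs the growth of solutions, with the sharp rate \<open>sqrt r\<close>.\<close>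

lemma energy_derivative_le:
  fixes y z k :: complex and r r' M :: real
  assumes r: "0 < r" "\<bar>r'\<bar> \<le> M * r"
  shows "2 * (z \<bullet> - (k\<^sup>2 * of_real r * y))
      + (norm k)\<^sup>2 * (r' * (norm y)\<^sup>2 + r * (2 * (y \<bullet> z)))
    \<le> (2 * \<bar>Im k\<bar> * sqrt r + M) * ((norm z)\<^sup>2 + (norm k)\<^sup>2 * (r * (norm y)\<^sup>2))"
proof -
  define N where "N = (norm z)\<^sup>2 + (norm k)\<^sup>2 * (r * (norm y)\<^sup>2)"
  have sq: "of_real ((norm k)\<^sup>2) - k\<^sup>2 = - (2 * \<i> * of_real (Im k) * k)"
  proof -
    have "cnj k - k = - (2 * \<i> * of_real (Im k))" by (simp add: complex_eq_iff)
    moreover have "of_real ((norm k)\<^sup>2) - k\<^sup>2 = (cnj k - k) * k"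
      by (simp only: complex_norm_square) (simp add: power2_eq_square algebra_simps)
    ultimately show ?thesis by simp
  qed
  have "2 * (z \<bullet> - (k\<^sup>2 * of_real r * y)) + (norm k)\<^sup>2 * (r * (2 * (y \<bullet> z)))
      = 2 * r * (z \<bullet> ((of_real ((norm k)\<^sup>2) - k\<^sup>2) * y))"
    by (simp add: inner_complex_def algebra_simps)
  also have "\<dots> \<le> 2 * r * (norm z * norm ((of_real ((norm k)\<^sup>2) - k\<^sup>2) * y))"
    using r by (intro mult_left_mono norm_cauchy_schwarz) auto
  also have "\<dots> = 2 * \<bar>Im k\<bar> * sqrt r * (2 * norm z * (norm k * sqrt r * norm y))"
    unfolding sq using r(1) by (simp add: norm_mult mult_ac)
  also have "\<dots> \<le> 2 * \<bar>Im k\<bar> * sqrt r * N"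
  proof (rule mult_left_mono)
    show "2 * norm z * (norm k * sqrt r * norm y) \<le> N"
      using sum_squares_bound[of "norm z" "norm k * sqrt r * norm y"] r(1)
      by (simp add: N_def power_mult_distrib mult_ac)
  qed (use r in auto)
  finally have 1: "2 * (z \<bullet> - (k\<^sup>2 * of_real r * y)) + (norm k)\<^sup>2 * (r * (2 * (y \<bullet> z))) \<le> 2 * \<bar>Im k\<bar> * sqrt r * N" .
  have M: "0 \<le> M * r" using r(2) by linarith
  then have M0: "0 \<le> M" using r(1) by (simp add: zero_le_mult_iff)
  have "(norm k)\<^sup>2 * (r' * (norm y)\<^sup>2) \<le> (norm k)\<^sup>2 * (M * r * (norm y)\<^sup>2)"
    using r(2) by (intro mult_left_mono mult_right_mono) auto
  also have "\<dots> \<le> M * N" unfolding N_def using M0 by (simp add: algebra_simps)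
  finally have 2: "(norm k)\<^sup>2 * (r' * (norm y)\<^sup>2) \<le> M * N" .
  from 1 2 show ?thesis unfolding N_def by (simp add: algebra_simps)
qed

lemma energy_bound:
  assumes r: "regular_coeff b M r" and s: "solves b r (k\<^sup>2) y z" and x: "x \<in> {0..b}"
  shows "(norm (z x))\<^sup>2 + (norm k)\<^sup>2 * (r x * (norm (y x))\<^sup>2)
    \<le> ((norm (z 0))\<^sup>2 + (norm k)\<^sup>2 * (r 0 * (norm (y 0))\<^sup>2)) * exp (2 * \<bar>Im k\<bar> * travel r x + M * x)"
proof -
  obtain r' where r': "\<And>x. x \<in> {0..b} \<Longrightarrow> (r has_real_derivative r' x) (at x within {0..b})"
    "\<And>x. x \<in> {0..b} \<Longrightarrow> \<bar>r' x\<bar> \<le> M * r x"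
    using r unfolding regular_coeff_def by metis
  let ?e = "\<lambda>x. (norm (z x))\<^sup>2 + (norm k)\<^sup>2 * (r x * (norm (y x))\<^sup>2)"
  let ?C = "\<lambda>x. 2 * \<bar>Im k\<bar> * travel r x + M * x"
  have "?e x \<le> ?e 0 * exp (?C x - ?C 0)"
  proof (rule gronwall[where b=b and c="\<lambda>x. 2 * \<bar>Im k\<bar> * sqrt (r x) + M" and
        e'="\<lambda>x. 2 * (z x \<bullet> - (k\<^sup>2 * of_real (r x) * y x))
          + (norm k)\<^sup>2 * (r' x * (norm (y x))\<^sup>2 + r x * (2 * (y x \<bullet> z x)))"])
    fix t assume t: "t \<in> {0..b}"
    have "((\<lambda>x. (norm (z x))\<^sup>2) has_real_derivative 2 * (z t \<bullet> - (k\<^sup>2 * of_real (r t) * y t))) (at t within {0..b})"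
      "((\<lambda>x. (norm (y x))\<^sup>2) has_real_derivative 2 * (y t \<bullet> z t)) (at t within {0..b})"
      by (rule norm_power2_has_real_derivative, use s t in \<open>simp add: solves_def\<close>)+
    note d = this r'(1)[OF t]
    show "(?e has_real_derivative 2 * (z t \<bullet> - (k\<^sup>2 * of_real (r t) * y t))
          + (norm k)\<^sup>2 * (r' t * (norm (y t))\<^sup>2 + r t * (2 * (y t \<bullet> z t)))) (at t within {0..b})"
      by (rule DERIV_cong, rule DERIV_add[OF d(1) DERIV_cmult[OF DERIV_mult[OF d(3) d(2)]]]) (simp add: algebra_simps)
    show "(?C has_real_derivative 2 * \<bar>Im k\<bar> * sqrt (r t) + M) (at t within {0..b})"
      by (rule DERIV_cong, rule DERIV_add[OF DERIV_cmult[OF travel_deriv[OF r t]] DERIV_cmult[OF DERIV_ident]]) simp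
    show "2 * (z t \<bullet> - (k\<^sup>2 * of_real (r t) * y t)) + (norm k)\<^sup>2 * (r' t * (norm (y t))\<^sup>2 + r t * (2 * (y t \<bullet> z t)))
       \<le> (2 * \<bar>Im k\<bar> * sqrt (r t) + M) * ?e t"
      by (rule energy_derivative_le) (use regular_coeffD(3)[OF r t] r'(2)[OF t] in auto)
  qed (use x in auto)
  then show ?thesis by simp
qed

text \<open>The square root of the energy bound, with a constant that is uniform in the spectral parameter.\<close>

lemma solution_growth:
  assumes r: "regular_coeff b M r"
  obtains C where "0 < C"
    "\<And>k y z x. solves b r (k\<^sup>2) y z \<Longrightarrow> x \<in> {0..b} \<Longrightarrow>
       norm (z x) \<le> C * (norm (z 0) + norm k * norm (y 0)) * exp (\<bar>Im k\<bar> * travel r x)"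
    "\<And>k y z x. solves b r (k\<^sup>2) y z \<Longrightarrow> x \<in> {0..b} \<Longrightarrow>
       norm k * norm (y x) \<le> C * (norm (z 0) + norm k * norm (y 0)) * exp (\<bar>Im k\<bar> * travel r x)"
proof -
  have b: "0 < b" and M: "0 \<le> M" using regular_coeffD[OF r] by auto
  obtain m where m: "m \<in> {0..b}" "\<And>x. x \<in> {0..b} \<Longrightarrow> r m \<le> r x"
    using continuous_attains_inf[OF compact_Icc _ regular_coeffD(4)[OF r]] b by auto
  have rm: "0 < r m" by (rule regular_coeffD(3)[OF r m(1)])
  define c where "c = min 1 (sqrt (r m))"
  define d where "d = max 1 (sqrt (r 0))"
  define C where "C = d * exp (M * b) / c"
  have c: "0 < c" "c \<le> 1" and d: "1 \<le> d" using rm by (auto simp: c_def d_def)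
  \<comment> \<open>the bound \<open>c\<close> from below for \<open>sqrt r\<close> removes the weight in front of \<open>|y|\<^sup>2\<close>\<close>
  have main: "norm (z x) \<le> d * exp (M * b) * (norm (z 0) + norm k * norm (y 0)) * exp (\<bar>Im k\<bar> * travel r x)"
     "norm k * norm (y x) * c \<le> d * exp (M * b) * (norm (z 0) + norm k * norm (y 0)) * exp (\<bar>Im k\<bar> * travel r x)"
    if s: "solves b r (k\<^sup>2) y z" and x: "x \<in> {0..b}" for k y z x
  proof -
    let ?n = "norm (z 0) + norm k * norm (y 0)" and ?R = "\<bar>Im k\<bar> * travel r x + M * b"
    let ?W = "d * ?n * exp ?R"
    have r0: "0 < r 0" using regular_coeffD(3)[OF r, of 0] b by simp
    have "(norm (z 0))\<^sup>2 + (norm k)\<^sup>2 * (r 0 * (norm (y 0))\<^sup>2) \<le> d\<^sup>2 * ?n\<^sup>2"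
    proof -
      have d2: "1 \<le> d\<^sup>2" "r 0 \<le> d\<^sup>2"
        using d power_mono[of 1 d 2] power_mono[of "sqrt (r 0)" d 2] r0 by (auto simp: d_def)
      have "(norm (z 0))\<^sup>2 + (norm k)\<^sup>2 * (r 0 * (norm (y 0))\<^sup>2) = 1 * (norm (z 0))\<^sup>2 + r 0 * (norm k * norm (y 0))\<^sup>2"
        by (simp add: power_mult_distrib)
      also have "\<dots> \<le> d\<^sup>2 * (norm (z 0))\<^sup>2 + d\<^sup>2 * (norm k * norm (y 0))\<^sup>2"
        using d2 by (intro add_mono mult_right_mono) auto
      also have "\<dots> \<le> d\<^sup>2 * ?n\<^sup>2" by (simp add: power2_sum algebra_simps)
      finally show ?thesis .
    qed
    moreover have "2 * \<bar>Im k\<bar> * travel r x + M * x \<le> 2 * ?R"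
    proof -
      have "M * x \<le> M * b" "0 \<le> M * b" using x M b by (auto intro!: mult_left_mono)
      then show ?thesis by simp
    qed
    ultimately have "(norm (z x))\<^sup>2 + (norm k)\<^sup>2 * (r x * (norm (y x))\<^sup>2) \<le> d\<^sup>2 * ?n\<^sup>2 * exp (2 * ?R)"
      using r0 by (intro order_trans[OF energy_bound[OF r s x]] mult_mono) auto
    also have "\<dots> = ?W\<^sup>2" by (simp add: power_mult_distrib flip: exp_double)
    finally have E: "(norm (z x))\<^sup>2 + (norm k)\<^sup>2 * (r x * (norm (y x))\<^sup>2) \<le> ?W\<^sup>2" .
    have rx: "0 < r x" by (rule regular_coeffD(3)[OF r x])
    have W: "0 \<le> ?W" using d by simp
    have Weq: "?W = d * exp (M * b) * ?n * exp (\<bar>Im k\<bar> * travel r x)" by (simp add: exp_add)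
    have "(norm (z x))\<^sup>2 \<le> ?W\<^sup>2" using E rx by (smt (verit) mult_nonneg_nonneg zero_le_power2)
    then have "norm (z x) \<le> ?W" using W by (rule power2_le_imp_le)
    then show "norm (z x) \<le> d * exp (M * b) * ?n * exp (\<bar>Im k\<bar> * travel r x)" unfolding Weq .
    have "c\<^sup>2 \<le> r m" using c power_mono[of c "sqrt (r m)" 2] rm by (simp add: c_def)
    also have "\<dots> \<le> r x" by (rule m(2)[OF x])
    finally have "(norm k)\<^sup>2 * (c\<^sup>2 * (norm (y x))\<^sup>2) \<le> (norm k)\<^sup>2 * (r x * (norm (y x))\<^sup>2)"
      by (intro mult_left_mono mult_right_mono) auto
    then have "(norm k * norm (y x) * c)\<^sup>2 \<le> ?W\<^sup>2"
      using E by (simp add: power_mult_distrib mult_ac) (smt (verit) zero_le_power2)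
    then have "norm k * norm (y x) * c \<le> ?W" using W by (rule power2_le_imp_le)
    then show "norm k * norm (y x) * c \<le> d * exp (M * b) * ?n * exp (\<bar>Im k\<bar> * travel r x)" unfolding Weq .
  qed
  show thesis
  proof (rule that[of C])
    show "0 < C" using c d by (simp add: C_def)
    fix k y z x assume s: "solves b r (k\<^sup>2) y z" and x: "x \<in> {0..b}"
    let ?T = "(norm (z 0) + norm k * norm (y 0)) * exp (\<bar>Im k\<bar> * travel r x)"
    have CC: "C * (norm (z 0) + norm k * norm (y 0)) * exp (\<bar>Im k\<bar> * travel r x) = (d * exp (M * b)) * ?T / c"
      by (simp add: C_def)
    have "norm (z x) \<le> (d * exp (M * b)) * ?T" using main(1)[OF s x] by (simp add: mult_ac)
    also have "\<dots> \<le> (d * exp (M * b)) * ?T / c"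
    proof -
      have "0 \<le> (d * exp (M * b)) * ?T" using d by simp
      from mult_left_le[OF c(2) this] show ?thesis using c(1) by (simp only: pos_le_divide_eq)
    qed
    finally show "norm (z x) \<le> C * (norm (z 0) + norm k * norm (y 0)) * exp (\<bar>Im k\<bar> * travel r x)" unfolding CC .
    show "norm k * norm (y x) \<le> C * (norm (z 0) + norm k * norm (y 0)) * exp (\<bar>Im k\<bar> * travel r x)"
      unfolding CC using main(2)[OF s x] c by (simp add: field_simps)
  qed
qed

lemma ycoef_nonneg:
  assumes r: "regular_coeff b M r" and ab: "0 \<le> \<alpha>" "0 \<le> \<beta>" and x: "x \<in> {0..b}"
  shows "0 \<le> ycoef r \<alpha> \<beta> n x" "0 \<le> zcoef r \<alpha> \<beta> n x"
proof -
  note c = regular_coeffD(4)[OF r]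
  have Z: "0 \<le> zcoef r \<alpha> \<beta> (Suc n) x" if x: "x \<in> {0..b}" and y: "\<And>x. x \<in> {0..b} \<Longrightarrow> 0 \<le> ycoef r \<alpha> \<beta> n x" for n x
    unfolding zcoef_def nat.case
  proof (rule integral_nonneg)
    show "(\<lambda>t. r t * ycoef r \<alpha> \<beta> n t) integrable_on {0..x}"
      by (rule integrable_continuous_real, rule continuous_on_subset[of "{0..b}"])
        (use x c ycoef_cont[OF c] in \<open>auto intro!: continuous_intros\<close>)
    show "0 \<le> r t * ycoef r \<alpha> \<beta> n t" if "t \<in> {0..x}" for t
      using y[of t] regular_coeffD(3)[OF r, of t] that x by auto
  qed
  have Y: "0 \<le> ycoef r \<alpha> \<beta> n x" if "x \<in> {0..b}" for n x using that
  proof (induction n arbitrary: x)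
    case 0 then show ?case using ab by auto
  next
    case (Suc n)
    have e: "ycoef r \<alpha> \<beta> (Suc n) = (\<lambda>x. integral {0..x} (zcoef r \<alpha> \<beta> (Suc n)))"
      by (simp add: zcoef_def[abs_def])
    show ?case unfolding e
    proof (rule integral_nonneg)
      show "zcoef r \<alpha> \<beta> (Suc n) integrable_on {0..x}"
        by (rule integrable_continuous_real, rule continuous_on_subset[OF zcoef_cont[OF c]])
          (use Suc.prems in auto)
      show "0 \<le> zcoef r \<alpha> \<beta> (Suc n) t" if "t \<in> {0..x}" for t
        by (rule Z) (use Suc that in auto)
    qed
  qed
  show "0 \<le> ycoef r \<alpha> \<beta> n x" by (rule Y[OF x])
  show "0 \<le> zcoef r \<alpha> \<beta> n x" using Z[OF x Y] ab by (cases n) (auto simp: zcoef_def[of _ _ _ 0])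
qed

lemma solution_real:
  assumes r: "continuous_on {0..b} r" and x: "x \<in> {0..b}"
  shows "ysol r \<alpha> \<beta> (of_real c) x = of_real (\<Sum>n. ycoef r \<alpha> \<beta> n x * (- c) ^ n)" (is ?Y)
    and "zsol r \<alpha> \<beta> (of_real c) x = of_real (\<Sum>n. zcoef r \<alpha> \<beta> n x * (- c) ^ n)" (is ?Z)
    and "summable (\<lambda>n. ycoef r \<alpha> \<beta> n x * (- c) ^ n)" (is ?SY)
    and "summable (\<lambda>n. zcoef r \<alpha> \<beta> n x * (- c) ^ n)" (is ?SZ)
proof -
  have b: "0 \<le> b" using x by auto
  obtain B K where K: "0 \<le> K" and bd: "\<And>n x. x \<in> {0..b} \<Longrightarrow> \<bar>ycoef r \<alpha> \<beta> n x\<bar> \<le> B * K ^ n / fact n"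
    "\<And>n x. x \<in> {0..b} \<Longrightarrow> \<bar>zcoef r \<alpha> \<beta> n x\<bar> \<le> B * K ^ n / fact n"
    using coef_bounds[OF r b] by metis
  have *: "summable (\<lambda>n. a n * (- c) ^ n)"
    "(\<Sum>n. of_real (a n) * (- of_real c) ^ n) = complex_of_real (\<Sum>n. a n * (- c) ^ n)"
    if a: "\<And>n. \<bar>a n\<bar> \<le> B * K ^ n / fact n" for a :: "nat \<Rightarrow> real"
  proof -
    have e: "(\<lambda>n. complex_of_real (a n * (- c) ^ n)) = (\<lambda>n. of_real (a n) * (- of_real c) ^ n)"
      by simp
    have "summable (\<lambda>n. complex_of_real (a n * (- c) ^ n))"
      unfolding e using exp_coef_summable(1)[OF a K, of "- of_real c"] by simp
    then show S: "summable (\<lambda>n. a n * (- c) ^ n)" by (simp only: summable_of_real_iff)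
    show "(\<Sum>n. of_real (a n) * (- of_real c) ^ n) = complex_of_real (\<Sum>n. a n * (- c) ^ n)"
      using suminf_of_real[OF S, where 'a=complex] unfolding e by simp
  qed
  show ?SY by (rule *(1)[OF bd(1)[OF x]])
  show ?SZ by (rule *(1)[OF bd(2)[OF x]])
  show ?Y unfolding ysol_def by (rule *(2)[OF bd(1)[OF x]])
  show ?Z unfolding zsol_def by (rule *(2)[OF bd(2)[OF x]])
qed

text \<open>For \<open>\<kappa> = - K\<^sup>2\<close> the solution that vanishes at 0 is nonnegative and nondecreasing, and \<open>u = y' + K sqrt(r) y\<close> satisfies
\<open>u' \<ge> (K sqrt(r) - M) u\<close>.  Hence, seen from \<open>b\<close>, it decays at least like \<open>exp(-K t)\<close> in the travel time \<open>t\<close>,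
when measured against \<open>u(b)\<close>.\<close>

lemma positive_solution_growth:
  assumes r: "regular_coeff b M r" and K: "0 < K" and x: "x \<in> {0..b}"
  defines "\<phi> \<equiv> \<lambda>t. Re (ysol r 0 1 (- of_real (K\<^sup>2)) t)" and "\<psi> \<equiv> \<lambda>t. Re (zsol r 0 1 (- of_real (K\<^sup>2)) t)"
  shows "K * sqrt (r x) * norm (ysol r 0 1 (- of_real (K\<^sup>2)) x)
      \<le> exp (M * b) * exp (- K * (travel r b - travel r x)) * (\<psi> b + K * sqrt (r b) * \<phi> b)"
    and "0 < \<psi> b + K * sqrt (r b) * \<phi> b"
proof -
  note c = regular_coeffD(4)[OF r] and b = regular_coeffD(1)[OF r] and M = regular_coeffD(2)[OF r]
  let ?y = "ysol r 0 1 (- of_real (K\<^sup>2))" and ?z = "zsol r 0 1 (- of_real (K\<^sup>2))"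
  have cc: "- complex_of_real (K\<^sup>2) = of_real (- K\<^sup>2)" by simp
  have s: "solves b r (- of_real (K\<^sup>2)) ?y ?z" by (rule solves_ysol[OF c]) (use b in simp)
  have real: "?y t = of_real (\<phi> t)" "?z t = of_real (\<psi> t)" if t: "t \<in> {0..b}" for t
    unfolding \<phi>_def \<psi>_def cc solution_real(1,2)[OF c t] by simp_all
  have nn: "0 \<le> \<phi> t" "0 \<le> \<psi> t" if t: "t \<in> {0..b}" for t
    unfolding \<phi>_def \<psi>_def cc solution_real(1,2)[OF c t] Re_complex_of_real minus_minus
    using ycoef_nonneg[OF r _ _ t, of 0 1] solution_real(3,4)[OF c t, of 0 1 "- K\<^sup>2"]
    by (auto intro!: suminf_nonneg)
  have \<phi>': "(\<phi> has_real_derivative \<psi> t) (at t within {0..b})" if t: "t \<in> {0..b}" for t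
    unfolding \<phi>_def \<psi>_def has_real_derivative_iff_has_vector_derivative
    by (rule bounded_linear.has_vector_derivative[OF bounded_linear_Re]) (use s t in \<open>simp add: solves_def\<close>)
  have \<psi>': "(\<psi> has_real_derivative K\<^sup>2 * r t * \<phi> t) (at t within {0..b})" if t: "t \<in> {0..b}" for t
  proof -
    have "((\<lambda>t. Re (?z t)) has_vector_derivative Re (- ((- of_real (K\<^sup>2)) * of_real (r t) * ?y t))) (at t within {0..b})"
      by (rule bounded_linear.has_vector_derivative[OF bounded_linear_Re]) (use s t in \<open>simp add: solves_def\<close>)
    then show ?thesis unfolding real(1)[OF t] \<psi>_def has_real_derivative_iff_has_vector_derivative
      by (simp flip: of_real_power of_real_mult)
  qed
  obtain r' where r': "\<And>x. x \<in> {0..b} \<Longrightarrow> (r has_real_derivative r' x) (at x within {0..b})"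
    "\<And>x. x \<in> {0..b} \<Longrightarrow> \<bar>r' x\<bar> \<le> M * r x"
    using r unfolding regular_coeff_def by metis
  define u where "u t = \<psi> t + K * sqrt (r t) * \<phi> t" for t
  have u': "(u has_real_derivative K\<^sup>2 * r t * \<phi> t + (K * sqrt (r t) * \<psi> t + K * (r' t / (2 * sqrt (r t))) * \<phi> t)) (at t within {0..b})"
    if t: "t \<in> {0..b}" for t
  proof -
    have rt: "0 < r t" by (rule regular_coeffD(3)[OF r t])
    have "((\<lambda>t. sqrt (r t)) has_real_derivative r' t / (2 * sqrt (r t))) (at t within {0..b})"
      using DERIV_chain2[OF DERIV_real_sqrt[OF rt] r'(1)[OF t]] by (simp add: field_simps)
    from DERIV_add[OF \<psi>'[OF t] DERIV_mult[OF DERIV_cmult[OF this, of K] \<phi>'[OF t]]]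
    show ?thesis unfolding u_def[abs_def] by (rule DERIV_cong) simp
  qed
  have le: "(K * sqrt (r t) - M) * u t \<le> K\<^sup>2 * r t * \<phi> t + (K * sqrt (r t) * \<psi> t + K * (r' t / (2 * sqrt (r t))) * \<phi> t)"
    if t: "t \<in> {0..b}" for t
  proof -
    have rt: "0 < r t" by (rule regular_coeffD(3)[OF r t])
    define q where "q = sqrt (r t)"
    have q: "0 < q" "r t = q\<^sup>2" using rt by (auto simp: q_def)
    have "- (M * q) \<le> r' t / (2 * q)"
    proof -
      have "- (M * q\<^sup>2) \<le> r' t" using r'(2)[OF t] q by auto
      moreover have "0 \<le> M * q\<^sup>2" using M by simp
      ultimately have "- (M * q) * (2 * q) \<le> r' t" by (simp add: power2_eq_square)
      then show ?thesis using q(1) by (simp add: pos_le_divide_eq)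
    qed
    then have "K * (- (M * q)) * \<phi> t \<le> K * (r' t / (2 * q)) * \<phi> t"
      using K nn(1)[OF t] by (intro mult_right_mono mult_left_mono) auto
    moreover have "0 \<le> M * \<psi> t" using M nn(2)[OF t] by simp
    ultimately show ?thesis unfolding u_def q_def[symmetric] unfolding q(2)
      by (simp add: algebra_simps power2_eq_square)
  qed
  \<comment> \<open>Gronwall's inequality for \<open>- u\<close> turns the lower differential inequality into a lower growth bound\<close>
  have gr: "u a * exp (K * (travel r b - travel r a) - M * (b - a)) \<le> u b" if a: "a \<in> {0..b}" for a
  proof -
  have "- u b \<le> - u a * exp ((K * travel r b - M * b) - (K * travel r a - M * a))"
  proof (rule gronwall[where e="\<lambda>t. - u t" and C="\<lambda>t. K * travel r t - M * t" and b=b])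
    fix t assume t: "t \<in> {0..b}"
    show "((\<lambda>t. - u t) has_real_derivative - (K\<^sup>2 * r t * \<phi> t + (K * sqrt (r t) * \<psi> t + K * (r' t / (2 * sqrt (r t))) * \<phi> t))) (at t within {0..b})"
      by (rule DERIV_minus[OF u'[OF t]])
    show "((\<lambda>t. K * travel r t - M * t) has_real_derivative K * sqrt (r t) - M) (at t within {0..b})"
      by (rule DERIV_cong, rule DERIV_diff[OF DERIV_cmult[OF travel_deriv[OF r t]] DERIV_cmult[OF DERIV_ident]]) simp
    show "- (K\<^sup>2 * r t * \<phi> t + (K * sqrt (r t) * \<psi> t + K * (r' t / (2 * sqrt (r t))) * \<phi> t)) \<le> (K * sqrt (r t) - M) * - u t"
      using le[OF t] by simp
  qed (use a in auto)
  then show ?thesis by (simp add: algebra_simps)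
  qed
  note g = gr[OF x]
  have ux: "0 \<le> u x" unfolding u_def using nn[OF x] regular_coeffD(3)[OF r x] K by simp
  have "u x = u x * exp (K * (travel r b - travel r x) - M * (b - x)) * exp (M * (b - x) - K * (travel r b - travel r x))"
    by (simp add: mult.assoc flip: exp_add)
  also have "\<dots> \<le> u b * exp (M * (b - x) - K * (travel r b - travel r x))"
    using g by (intro mult_right_mono) auto
  also have "\<dots> \<le> u b * exp (M * b - K * (travel r b - travel r x))"
  proof (rule mult_left_mono)
    have "0 \<le> u x * exp (K * (travel r b - travel r x) - M * (b - x))" using ux by simp
    then show "0 \<le> u b" using g by linarith
  qed (use x M in \<open>auto simp: algebra_simps\<close>)
  also have "\<dots> = exp (M * b) * exp (- K * (travel r b - travel r x)) * u b" by (simp add: mult_ac flip: exp_add)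
  finally have "u x \<le> exp (M * b) * exp (- K * (travel r b - travel r x)) * u b" .
  moreover have "K * sqrt (r x) * norm (?y x) \<le> u x"
    unfolding real(1)[OF x] u_def using nn[OF x] by simp
  ultimately show "K * sqrt (r x) * norm (?y x) \<le> exp (M * b) * exp (- K * (travel r b - travel r x)) * (\<psi> b + K * sqrt (r b) * \<phi> b)"
    unfolding u_def by linarith
  have "0 \<in> {0..b}" using b by simp
  moreover have "u 0 = 1" unfolding u_def \<phi>_def \<psi>_def by (simp add: ysol_0 zsol_0)
  ultimately have "exp (K * (travel r b - travel r 0) - M * (b - 0)) \<le> u b"
    using gr[of 0] by simp
  then have "0 < u b" by (rule less_le_trans[OF exp_gt_zero])
  then show "0 < \<psi> b + K * sqrt (r b) * \<phi> b" unfolding u_def .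
qed

section \<open>Hadamard factorization for growth of order one half\<close>

lemma entire_factor_zero:
  assumes "f holomorphic_on UNIV" "f a = 0"
  obtains g where "g holomorphic_on UNIV" "\<And>w. f w = (w - a) * g w"
proof
  show "(\<lambda>z. if z = a then deriv f a else (f z - f a) / (z - a)) holomorphic_on UNIV"
    by (rule pole_lemma_open[OF assms(1)]) auto
  show "f w = (w - a) * (if w = a then deriv f a else (f w - f a) / (w - a))" for w
    using assms(2) by auto
qed

lemma entire_eventually_nonzero:
  assumes "f holomorphic_on UNIV" "f w \<noteq> 0"
  shows "eventually (\<lambda>z. f z \<noteq> 0) (at a)"
  using non_zero_neighbour_alt[of f UNIV a w] assms by (auto elim: eventually_mono)

lemma entire_zorder_eq_0_iff:
  assumes "f holomorphic_on UNIV" "f w \<noteq> 0"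
  shows "zorder f a = 0 \<longleftrightarrow> f a \<noteq> 0"
  using assms entire_eventually_nonzero[OF assms, of a]
  by (intro zorder_eq_0_iff eventually_frequently) (auto simp: analytic_at intro: holomorphic_on_subset)

lemma entire_zorder_mult:
  assumes "f holomorphic_on UNIV" "g holomorphic_on UNIV" "f w * g w \<noteq> 0"
  shows "zorder (\<lambda>z. f z * g z) a = zorder f a + zorder g a"
proof (rule zorder_times_analytic)
  show "\<forall>\<^sub>F z in at a. f z * g z \<noteq> 0"
    using entire_eventually_nonzero[of "\<lambda>z. f z * g z"] assms by (auto intro!: holomorphic_intros)
qed (use assms in \<open>auto simp: analytic_at intro: holomorphic_on_subset\<close>)

lemma zorder_one_minus_divide:
  assumes "(m::complex) \<noteq> 0"
  shows "zorder (\<lambda>w. 1 - w / m) a = (if a = m then 1 else 0)"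
proof (cases "a = m")
  case True
  have "zorder (\<lambda>w. 1 - w / m) a = 1"
    by (rule zorder_eqI[of UNIV _ "\<lambda>_. - 1 / m"]) (use assms True in \<open>auto simp: field_simps\<close>)
  then show ?thesis using True by simp
next
  case False
  have "zorder (\<lambda>w. 1 - w / m) a = 0"
    by (rule zorder_eq_0I) (use assms False in \<open>auto intro!: analytic_intros\<close>)
  then show ?thesis using False by simp
qed

text \<open>Dividing an entire function by the linear factors of finitely many zeros, no more often than their
multiplicities permit.  The quotient keeps the remaining multiplicity at every point, which tells where it can
still vanish.\<close>

lemma entire_divide_zeros:
  fixes \<mu> :: "'i \<Rightarrow> complex"
  assumes f: "f holomorphic_on UNIV" "f w0 \<noteq> 0" and S: "finite S"
    and nz: "\<And>i. i \<in> S \<Longrightarrow> \<mu> i \<noteq> 0"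
    and cnt: "\<And>a. int (card {i\<in>S. \<mu> i = a}) \<le> zorder f a"
  shows "\<exists>Q. Q holomorphic_on UNIV \<and> (\<forall>w. f w = Q w * (\<Prod>i\<in>S. 1 - w / \<mu> i)) \<and>
           (\<forall>a. zorder f a = zorder Q a + int (card {i\<in>S. \<mu> i = a}))"
  using S nz cnt
proof (induction S rule: finite_induct)
  case empty
  show ?case by (rule exI[of _ f]) (use f in auto)
next
  case (insert j S)
  have sub: "int (card {i\<in>S. \<mu> i = a}) \<le> zorder f a" for a
  proof -
    have "card {i\<in>S. \<mu> i = a} \<le> card {i\<in>insert j S. \<mu> i = a}"
      using insert.hyps by (intro card_mono) auto
    then show ?thesis using insert.prems(2)[of a] by linarith
  qed
  obtain Q where Q: "Q holomorphic_on UNIV" "\<And>w. f w = Q w * (\<Prod>i\<in>S. 1 - w / \<mu> i)"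
    "\<And>a. zorder f a = zorder Q a + int (card {i\<in>S. \<mu> i = a})"
    using insert.IH[OF _ sub] insert.prems(1) by auto
  have Qnz: "Q w0 \<noteq> 0" using f(2) Q(2)[of w0] by auto
  have mj: "\<mu> j \<noteq> 0" using insert.prems(1) by auto
  have cj: "card {i\<in>insert j S. \<mu> i = a} = card {i\<in>S. \<mu> i = a} + (if a = \<mu> j then 1 else 0)" for a
  proof -
    have "{i\<in>insert j S. \<mu> i = a} = (if a = \<mu> j then insert j {i\<in>S. \<mu> i = a} else {i\<in>S. \<mu> i = a})"
      by auto
    then show ?thesis using insert.hyps by auto
  qed
  have "zorder Q (\<mu> j) \<noteq> 0" using insert.prems(2)[of "\<mu> j"] Q(3)[of "\<mu> j"] cj[of "\<mu> j"] by simp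
  then have "Q (\<mu> j) = 0" using entire_zorder_eq_0_iff[OF Q(1) Qnz] by blast
  then obtain g where g: "g holomorphic_on UNIV" "\<And>w. Q w = (w - \<mu> j) * g w"
    using entire_factor_zero[OF Q(1)] by blast
  define h where "h w = - \<mu> j * g w" for w
  have h: "h holomorphic_on UNIV" unfolding h_def by (intro holomorphic_intros g(1))
  have Qh: "Q w = (1 - w / \<mu> j) * h w" for w
    unfolding g(2) h_def using mj by (simp add: field_simps)
  have zQ: "zorder Q a = (if a = \<mu> j then 1 else 0) + zorder h a" for a
  proof -
    have "zorder (\<lambda>w. (1 - w / \<mu> j) * h w) a = zorder (\<lambda>w. 1 - w / \<mu> j) a + zorder h a"
      by (rule entire_zorder_mult[of _ _ w0]) (use h Qnz Qh mj in \<open>auto intro!: holomorphic_intros\<close>)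
    then show ?thesis using zorder_one_minus_divide[OF mj] by (simp flip: Qh)
  qed
  show ?case
  proof (intro exI[of _ h] conjI allI)
    show "f w = h w * (\<Prod>i\<in>insert j S. 1 - w / \<mu> i)" for w
      using Q(2)[of w] Qh[of w] insert.hyps by simp
    show "zorder f a = zorder h a + int (card {i\<in>insert j S. \<mu> i = a})" for a
      using Q(3)[of a] zQ[of a] cj[of a] by simp
  qed (rule h)
qed

text \<open>Splitting off the zero at a single point \<open>a\<close> globally; away from \<open>a\<close> all multiplicities survive.\<close>

lemma entire_factor_power:
  assumes f: "F holomorphic_on UNIV" "F w0 \<noteq> 0"
  shows "0 \<le> zorder F a \<and> (\<exists>g. g holomorphic_on UNIV \<and> g a \<noteq> 0 \<and> (\<forall>w. F w = (w - a) ^ nat (zorder F a) * g w)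
    \<and> (\<forall>c. c \<noteq> a \<longrightarrow> zorder g c = zorder F c))"
proof -
  have pos: "0 \<le> zorder G a" if "G holomorphic_on UNIV" "G w0 \<noteq> 0" for G
  proof -
    have "\<exists>w\<in>UNIV. G w \<noteq> 0" using that by blast
    from zorder_exist_zero[OF that(1) open_UNIV connected_UNIV UNIV_I this, of a]
    show ?thesis by (auto split: if_splits)
  qed
  have "\<exists>g. g holomorphic_on UNIV \<and> g a \<noteq> 0 \<and> (\<forall>w. F w = (w - a) ^ n * g w)
    \<and> (\<forall>c. c \<noteq> a \<longrightarrow> zorder g c = zorder F c)"
    if "nat (zorder F a) = n" "F holomorphic_on UNIV" "F w0 \<noteq> 0" for n F
    using that
  proof (induction n arbitrary: F)
    case 0
    then have "zorder F a = 0" using pos[of F] by auto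
    then have "F a \<noteq> 0" using entire_zorder_eq_0_iff 0 by blast
    then show ?case using 0 by (intro exI[of _ F]) auto
  next
    case (Suc n)
    then have "zorder F a \<noteq> 0" by auto
    then have "F a = 0" using entire_zorder_eq_0_iff Suc.prems by blast
    then obtain h where h: "h holomorphic_on UNIV" "\<And>w. F w = (w - a) * h w"
      using entire_factor_zero[OF Suc.prems(2)] by blast
    have hz: "h w0 \<noteq> 0" using Suc.prems(3) h(2) by auto
    have z: "zorder F c = (if c = a then 1 else 0) + zorder h c" for c
    proof -
      have "zorder (\<lambda>w. (w - a) * h w) c = zorder (\<lambda>w. w - a) c + zorder h c"
        by (rule entire_zorder_mult[of _ _ w0]) (use h Suc.prems in \<open>auto intro!: holomorphic_intros\<close>)
      moreover have "zorder (\<lambda>w. w - a) c = (if c = a then 1 else 0)"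
      proof (cases "c = a")
        case True
        then show ?thesis using zorder_eqI[of UNIV a "\<lambda>_. 1" "\<lambda>w. w - a" 1] by simp
      next
        case False
        have "zorder (\<lambda>w. w - a) c = 0"
          by (rule zorder_eq_0I) (use False in \<open>auto intro!: analytic_intros\<close>)
        then show ?thesis using False by simp
      qed
      ultimately show ?thesis by (simp flip: h(2))
    qed
    have "nat (zorder h a) = n" using z[of a] Suc.prems(1) by simp
    from Suc.IH[OF this h(1) hz] obtain g where g: "g holomorphic_on UNIV" "g a \<noteq> 0"
      "\<And>w. h w = (w - a) ^ n * g w" "\<And>c. c \<noteq> a \<Longrightarrow> zorder g c = zorder h c" by blast
    show ?case
    proof (intro exI[of _ g] conjI allI impI)
      show "F w = (w - a) ^ Suc n * g w" for w using h(2)[of w] g(3)[of w] by simp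
      show "zorder g c = zorder F c" if "c \<noteq> a" for c using z[of c] g(4)[OF that] that by simp
    qed (rule g)+
  qed
  from this[OF refl f] pos[OF f] show ?thesis by blast
qed

lemma maximum_modulus_disc:
  assumes "g holomorphic_on UNIV" "\<And>w. norm w = R \<Longrightarrow> norm (g w) \<le> B" "norm w \<le> R"
  shows "norm (g w) \<le> B"
proof (rule maximum_modulus_frontier[of g "cball 0 R" B w])
  show "continuous_on (closure (cball 0 R)) g"
    using assms(1) by (blast intro: holomorphic_on_imp_continuous_on holomorphic_on_subset)
qed (use assms in \<open>auto intro: holomorphic_on_subset\<close>)

lemma norm_exp_minus_1_le: "norm (exp z - 1) \<le> exp (norm z) - 1" for z :: complex
proof -
  let ?t = "\<lambda>n. inverse (fact (Suc n)) *\<^sub>R (z ^ Suc n)"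
  have n: "norm (?t n) = inverse (fact (Suc n)) *\<^sub>R (norm z ^ Suc n)" for n
    by (simp add: norm_mult norm_power)
  have "summable (\<lambda>n. inverse (fact n) *\<^sub>R (norm z ^ n))" by (rule summable_exp_generic)
  then have s: "summable (\<lambda>n. norm (?t n))" unfolding n by (subst summable_Suc_iff)
  have "norm (exp z - 1) = norm (\<Sum>n. ?t n)" by (subst exp_first_term) simp
  also have "\<dots> \<le> (\<Sum>n. norm (?t n))" by (rule summable_norm[OF s])
  also have "\<dots> = exp (norm z) - 1" unfolding n by (subst exp_first_term) simp
  finally show ?thesis .
qed

text \<open>The inequality of Borel and Caratheodory, in exponential form.  Where \<open>Q\<close> has no zeros, \<open>Q = Q(0) exp k\<close>
with \<open>k(0) = 0\<close> and \<open>Re k \<le> A\<close>.  A Moebius map takes this half-plane into the unit disc, so Schwarz's lemma turns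
the one-sided bound into a bound for \<open>|k|\<close>.\<close>

lemma nonvanishing_near_constant:
  fixes Q :: "complex \<Rightarrow> complex"
  assumes Q: "Q holomorphic_on UNIV" and nz: "\<And>w. norm w < R \<Longrightarrow> Q w \<noteq> 0"
    and bd: "\<And>w. norm w < R \<Longrightarrow> norm (Q w) \<le> norm (Q 0) * exp A"
    and A: "0 < A" and R: "0 < R" and w: "norm w \<le> R / 2"
  shows "norm (Q w - Q 0) \<le> norm (Q 0) * (exp (8 * A * norm w / R) - 1)"
proof -
  obtain h where h: "h holomorphic_on ball 0 R" "\<And>z. z \<in> ball 0 R \<Longrightarrow> Q z = exp (h z)"
    using contractible_imp_holomorphic_log[of Q "ball 0 R"] nz Q
    by (auto intro: holomorphic_on_subset convex_imp_contractible)
  define k where "k z = h z - h 0" for z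
  have k0: "k 0 = 0" by (simp add: k_def)
  have kQ: "Q z = Q 0 * exp (k z)" if "norm z < R" for z
    using h(2)[of z] h(2)[of 0] that R by (simp add: k_def exp_diff)
  have Q0: "Q 0 \<noteq> 0" using nz R by simp
  have Rek: "Re (k z) \<le> A" if "norm z < R" for z
    using bd[OF that] Q0 unfolding kQ[OF that] by (simp add: norm_mult)
  \<comment> \<open>maps the half-plane \<open>Re k < 2 A\<close> into the unit disc; the factor 2 makes the inclusion strict\<close>
  define \<phi> where "\<phi> z = k (of_real R * z) / (4 * of_real A - k (of_real R * z))" for z
  have inR: "norm (of_real R * z) < R" if "norm z < 1" for z :: complex
    using that R by (simp add: norm_mult)
  have den: "4 * of_real A - k (of_real R * z) \<noteq> 0" if "norm z < 1" for z
  proof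
    assume "4 * of_real A - k (of_real R * z) = 0"
    then have "Re (k (of_real R * z)) = 4 * A" by (auto simp: complex_eq_iff)
    then show False using Rek[OF inR[OF that]] A by simp
  qed
  have s: "norm (\<phi> z) \<le> norm z" if "norm z < 1" for z
  proof (rule Schwarz_Lemma(1)[of \<phi>])
    have "(\<lambda>z. h (of_real R * z)) holomorphic_on ball 0 1"
    proof (rule holomorphic_on_compose_gen[of "\<lambda>z. of_real R * z" _ h "ball 0 R", unfolded o_def])
      show "(\<lambda>z. complex_of_real R * z) ` ball 0 1 \<subseteq> ball 0 R" using inR by auto
    qed (use h in \<open>auto intro!: holomorphic_intros\<close>)
    then show "\<phi> holomorphic_on ball 0 1"
      unfolding \<phi>_def k_def using den unfolding k_def by (intro holomorphic_intros) auto
    show "\<phi> 0 = 0" by (simp add: \<phi>_def k0)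
    show "norm (\<phi> z) < 1" if z: "norm z < 1" for z
    proof -
      let ?k = "k (of_real R * z)"
      have "(norm ?k)\<^sup>2 < (norm (4 * of_real A - ?k))\<^sup>2"
      proof -
        have "Re ?k < 2 * A" using Rek[OF inR[OF z]] A by linarith
        then have "A * Re ?k < A * (2 * A)" using A by simp
        then show ?thesis unfolding cmod_power2 by (simp add: power2_eq_square algebra_simps)
      qed
      then have "norm ?k < norm (4 * of_real A - ?k)" by (rule power2_less_imp_less) simp
      then show ?thesis using den[OF z] by (simp add: \<phi>_def norm_divide)
    qed
  qed (rule that)
  define z where "z = w / of_real R"
  have z: "norm z \<le> 1 / 2" "w = of_real R * z" using w R by (auto simp: z_def norm_divide field_simps)
  then have z1: "norm z < 1" by simp
  have kw: "k w * (1 + \<phi> z) = 4 * of_real A * \<phi> z"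
    using den[OF z1] unfolding \<phi>_def z(2)[symmetric] by (simp add: field_simps)
  have "1 / 2 \<le> norm (1 + \<phi> z)"
    using norm_triangle_ineq2[of 1 "- \<phi> z"] s[OF z1] z(1) by simp
  then have "norm (k w) * (1 / 2) \<le> norm (k w) * norm (1 + \<phi> z)" by (intro mult_left_mono) auto
  also have "\<dots> = 4 * A * norm (\<phi> z)" using kw A by (metis (no_types) abs_of_pos norm_mult norm_numeral norm_of_real)
  also have "\<dots> \<le> 4 * A * norm z" using s[OF z1] A by simp
  finally have "norm (k w) \<le> 8 * A * norm z" by simp
  also have "\<dots> = 8 * A * norm w / R" using R by (simp add: z_def norm_divide)
  finally have kn: "norm (k w) \<le> 8 * A * norm w / R" .
  have "norm w < R" using w R by simp
  then have "norm (Q w - Q 0) = norm (Q 0) * norm (exp (k w) - 1)"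
    by (simp add: kQ norm_mult[symmetric] algebra_simps)
  also have "\<dots> \<le> norm (Q 0) * (exp (8 * A * norm w / R) - 1)"
  proof (intro mult_left_mono)
    have "norm (exp (k w) - 1) \<le> exp (norm (k w)) - 1" by (rule norm_exp_minus_1_le)
    also have "\<dots> \<le> exp (8 * A * norm w / R) - 1" using kn by simp
    finally show "norm (exp (k w) - 1) \<le> exp (8 * A * norm w / R) - 1" .
  qed auto
  finally show ?thesis .
qed

text \<open>An entire function of growth order one half, together with a family \<open>\<mu>\<close> that lists every zero as often as its
multiplicity says.  The index set is arbitrary so that the same argument serves the case of finitely many
zeros, where it shows that \<open>f\<close> is a polynomial, and the enumeration of infinitely many.\<close>

locale entire_half_order =
  fixes f :: "complex \<Rightarrow> complex" and C c :: real and I :: "'i set" and \<mu> :: "'i \<Rightarrow> complex"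
  assumes holo: "f holomorphic_on UNIV" and f0: "f 0 \<noteq> 0" and c0: "0 \<le> c"
    and growth: "\<And>w. norm (f w) \<le> C * exp (c * sqrt (norm w))"
    and fib: "\<And>a. finite {i\<in>I. \<mu> i = a}"
    and cnt: "\<And>a. int (card {i\<in>I. \<mu> i = a}) = zorder f a"
begin

lemma C_pos: "0 < C"
  using growth[of 0] f0 by (simp add: order_less_le_trans[of 0 "norm (f 0)"])

lemma zero_iff: "f a = 0 \<longleftrightarrow> (\<exists>i\<in>I. \<mu> i = a)"
proof -
  have "f a = 0 \<longleftrightarrow> zorder f a \<noteq> 0" using entire_zorder_eq_0_iff[OF holo f0] by blast
  also have "\<dots> \<longleftrightarrow> {i\<in>I. \<mu> i = a} \<noteq> {}" using cnt[of a] fib[of a] card_eq_0_iff by (metis of_nat_0_eq_iff)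
  finally show ?thesis by blast
qed

lemma mu_nz: "i \<in> I \<Longrightarrow> \<mu> i \<noteq> 0"
  using zero_iff f0 by metis

lemma finite_disc: "finite {i\<in>I. norm (\<mu> i) \<le> R}"
proof -
  have "finite {z \<in> cball 0 R. f z = 0}"
  proof (cases "f constant_on UNIV")
    case True
    then have "{z \<in> cball 0 R. f z = 0} = {}" using f0 by (force simp: constant_on_def)
    then show ?thesis by (simp only: finite.emptyI)
  next
    case False
    then show ?thesis by (intro holomorphic_compact_finite_zeros[of f UNIV] holo) auto
  qed
  then have "finite (\<Union>a\<in>{z \<in> cball 0 R. f z = 0}. {i\<in>I. \<mu> i = a})" using fib by blast
  then show ?thesis
    by (rule finite_subset[rotated]) (use zero_iff in auto)
qed

definition part :: "real \<Rightarrow> complex \<Rightarrow> complex" where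
  "part R w = (\<Prod>i\<in>{i\<in>I. norm (\<mu> i) \<le> R}. 1 - w / \<mu> i)"

lemma quotient:
  obtains Q where "Q holomorphic_on UNIV" "\<And>w. f w = Q w * part R w"
    "\<And>w. norm w \<le> R \<Longrightarrow> Q w \<noteq> 0"
proof -
  let ?S = "{i\<in>I. norm (\<mu> i) \<le> R}"
  have "\<exists>Q. Q holomorphic_on UNIV \<and> (\<forall>w. f w = Q w * (\<Prod>i\<in>?S. 1 - w / \<mu> i)) \<and>
           (\<forall>a. zorder f a = zorder Q a + int (card {i\<in>?S. \<mu> i = a}))"
  proof (rule entire_divide_zeros[OF holo f0 finite_disc])
    show "int (card {i\<in>?S. \<mu> i = a}) \<le> zorder f a" for a
      unfolding cnt[symmetric] of_nat_le_iff by (rule card_mono[OF fib]) auto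
  qed (use mu_nz in auto)
  then obtain Q where Q: "Q holomorphic_on UNIV" "\<And>w. f w = Q w * part R w"
    "\<And>a. zorder f a = zorder Q a + int (card {i\<in>?S. \<mu> i = a})" unfolding part_def by blast
  have Q0: "Q 0 \<noteq> 0" using Q(2)[of 0] f0 by auto
  show thesis
  proof (rule that[OF Q(1,2)])
    fix w :: complex assume w: "norm w \<le> R"
    have "{i\<in>?S. \<mu> i = w} = {i\<in>I. \<mu> i = w}" using w by auto
    then have "zorder Q w = 0" using Q(3)[of w] cnt[of w] by simp
    then show "Q w \<noteq> 0" using entire_zorder_eq_0_iff[OF Q(1) Q0] by blast
  qed
qed

lemma part_0 [simp]: "part R 0 = 1" by (simp add: part_def)

text \<open>On a circle well outside the zeros that are divided out every linear factor is at least \<open>s\<close> in absolute value.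
Used with \<open>s = 3\<close> to count zeros and with \<open>s = 1\<close> to bound quotients.\<close>

lemma part_ge:
  assumes w: "norm w = (s + 1) * R" and R: "0 < R" and s: "0 \<le> s"
  shows "s ^ card {i\<in>I. norm (\<mu> i) \<le> R} \<le> norm (part R w)"
proof -
  have "s ^ card {i\<in>I. norm (\<mu> i) \<le> R} = (\<Prod>i\<in>{i\<in>I. norm (\<mu> i) \<le> R}. s)" by simp
  also have "\<dots> \<le> (\<Prod>i\<in>{i\<in>I. norm (\<mu> i) \<le> R}. norm (1 - w / \<mu> i))"
  proof (rule prod_mono, safe)
    fix i assume i: "i \<in> I" "norm (\<mu> i) \<le> R"
    then have m: "0 < norm (\<mu> i)" using mu_nz by simp
    have "s + 1 \<le> norm (w / \<mu> i)"
      using i(2) m s by (simp add: norm_divide w pos_le_divide_eq mult_left_mono)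
    then show "s \<le> norm (1 - w / \<mu> i)"
      using norm_triangle_ineq2[of "w / \<mu> i" 1] by (simp add: norm_minus_commute)
  qed (rule s)
  finally show ?thesis by (simp add: part_def prod_norm)
qed

text \<open>Jensen's bound: dividing \<open>f\<close> by the factors of its zeros in the disc of radius \<open>R\<close> gains \<open>3\<^sup>N\<close> on the circle of
radius \<open>4 R\<close>, and the maximum principle compares this with \<open>f(0)\<close>.\<close>

lemma counting:
  assumes R: "0 < R"
  shows "real (card {i\<in>I. norm (\<mu> i) \<le> R}) \<le> ln (C / norm (f 0)) + 2 * c * sqrt R"
proof -
  let ?N = "card {i\<in>I. norm (\<mu> i) \<le> R}"
  obtain Q where Q: "Q holomorphic_on UNIV" "\<And>w. f w = Q w * part R w" by (rule quotient[of R]) blast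
  have "norm (Q 0) \<le> C * exp (c * (2 * sqrt R)) / 3 ^ ?N"
  proof (rule maximum_modulus_disc[OF Q(1)])
    fix w :: complex assume w: "norm w = 4 * R"
    have "norm (Q w) * 3 ^ ?N \<le> norm (Q w) * norm (part R w)"
      by (intro mult_left_mono part_ge) (use w R in auto)
    also have "\<dots> \<le> C * exp (c * sqrt (norm w))" using growth[of w] Q(2)[of w] by (simp add: norm_mult)
    also have "sqrt (norm w) = 2 * sqrt R" unfolding w by (simp add: real_sqrt_mult)
    finally show "norm (Q w) \<le> C * exp (c * (2 * sqrt R)) / 3 ^ ?N" by (simp add: field_simps)
  qed (use R in auto)
  then have "norm (f 0) \<le> C * exp (c * (2 * sqrt R)) / 3 ^ ?N" using Q(2)[of 0] by simp
  then have "3 ^ ?N \<le> C / norm (f 0) * exp (c * (2 * sqrt R))" using f0 by (simp add: field_simps)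
  then have "ln (3 ^ ?N) \<le> ln (C / norm (f 0) * exp (c * (2 * sqrt R)))"
    using C_pos f0 by (subst ln_le_cancel_iff) auto
  also have "\<dots> = ln (C / norm (f 0)) + 2 * c * sqrt R" using C_pos f0 by (subst ln_mult_pos) auto
  finally have "?N * ln 3 \<le> ln (C / norm (f 0)) + 2 * c * sqrt R" by (simp add: ln_realpow)
  moreover have "real ?N * 1 \<le> ?N * ln 3" using ln3_gt_1 by (intro mult_left_mono) auto
  ultimately show ?thesis by linarith
qed

text \<open>The counting bound summed over the shells \<open>4\<^sup>j < |\<mu>| \<le> 4\<^sup>j\<^sup>+\<^sup>1\<close>: each contributes at most a constant times
\<open>2\<^sup>j / 4\<^sup>j\<close>.\<close>

lemma inverse_sum_bounded:
  obtains B where "\<And>T. finite T \<Longrightarrow> T \<subseteq> I \<Longrightarrow> (\<Sum>i\<in>T. 1 / norm (\<mu> i)) \<le> B"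
proof -
  define A where "A = \<bar>ln (C / norm (f 0))\<bar> + 2 * c"
  have A0: "0 \<le> A" using c0 by (simp add: A_def)
  have N: "real (card {i\<in>I. norm (\<mu> i) \<le> R}) \<le> A * sqrt R" if "1 \<le> R" for R
  proof -
    have "ln (C / norm (f 0)) \<le> \<bar>ln (C / norm (f 0))\<bar> * sqrt R"
      using mult_left_mono[of 1 "sqrt R" "\<bar>ln (C / norm (f 0))\<bar>"] that by (simp add: abs_le_iff)
    then show ?thesis using counting[of R] that by (simp add: A_def algebra_simps)
  qed
  have ind: "(\<Sum>i\<in>T. 1 / norm (\<mu> i)) \<le> (\<Sum>j<J. 2 * A * (1/2) ^ j)"
    if "finite T" "T \<subseteq> I" "\<And>i. i \<in> T \<Longrightarrow> 1 < norm (\<mu> i) \<and> norm (\<mu> i) \<le> 4 ^ J" for T J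
    using that
  proof (induction J arbitrary: T)
    case 0
    then have "T = {}" by force
    then show ?case by simp
  next
    case (Suc J)
    define T1 where "T1 = {i\<in>T. norm (\<mu> i) \<le> 4 ^ J}"
    define T2 where "T2 = {i\<in>T. \<not> norm (\<mu> i) \<le> 4 ^ J}"
    have fin: "finite T1" "finite T2" using Suc.prems by (auto simp: T1_def T2_def)
    have "(\<Sum>i\<in>T. 1 / norm (\<mu> i)) = (\<Sum>i\<in>T1. 1 / norm (\<mu> i)) + (\<Sum>i\<in>T2. 1 / norm (\<mu> i))"
      by (subst sum.union_disjoint[symmetric]) (use fin in \<open>auto simp: T1_def T2_def intro!: sum.cong\<close>)
    moreover have "(\<Sum>i\<in>T1. 1 / norm (\<mu> i)) \<le> (\<Sum>j<J. 2 * A * (1/2) ^ j)"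
      by (rule Suc.IH) (use Suc.prems fin in \<open>auto simp: T1_def\<close>)
    moreover have "(\<Sum>i\<in>T2. 1 / norm (\<mu> i)) \<le> 2 * A * (1/2) ^ J"
    proof -
      have "(\<Sum>i\<in>T2. 1 / norm (\<mu> i)) \<le> (\<Sum>i\<in>T2. 1 / 4 ^ J)"
        by (intro sum_mono divide_left_mono) (auto simp: T2_def intro!: mult_pos_pos elim: order_less_trans[rotated])
      also have "\<dots> = card T2 / 4 ^ J" by simp
      also have "\<dots> \<le> A * sqrt (4 ^ Suc J) / 4 ^ J"
      proof (rule divide_right_mono)
        have "card T2 \<le> card {i\<in>I. norm (\<mu> i) \<le> 4 ^ Suc J}"
          using Suc.prems by (intro card_mono finite_disc) (auto simp: T2_def)
        then show "real (card T2) \<le> A * sqrt (4 ^ Suc J)" using N[of "4 ^ Suc J"] one_le_power[of "4::real" "Suc J"] by linarith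
      qed simp
      also have "sqrt (4 ^ Suc J) = 2 * (2::real) ^ J" by (simp add: real_sqrt_mult real_sqrt_power)
      also have "A * (2 * 2 ^ J) / 4 ^ J = 2 * A * (2 ^ J / 4 ^ J)" by simp
      also have "(2::real) ^ J / 4 ^ J = (1/2) ^ J" by (simp flip: power_divide)
      finally show ?thesis .
    qed
    ultimately show ?case by simp
  qed
  show thesis
  proof (rule that[of "(\<Sum>i\<in>{i\<in>I. norm (\<mu> i) \<le> 1}. 1 / norm (\<mu> i)) + 4 * A"])
    fix T assume T: "finite T" "T \<subseteq> I"
    define T1 where "T1 = {i\<in>T. norm (\<mu> i) \<le> 1}"
    define T2 where "T2 = {i\<in>T. \<not> norm (\<mu> i) \<le> 1}"
    have fin: "finite T1" "finite T2" using T by (auto simp: T1_def T2_def)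
    have "(\<Sum>i\<in>T. 1 / norm (\<mu> i)) = (\<Sum>i\<in>T1. 1 / norm (\<mu> i)) + (\<Sum>i\<in>T2. 1 / norm (\<mu> i))"
      by (subst sum.union_disjoint[symmetric]) (use fin in \<open>auto simp: T1_def T2_def intro!: sum.cong\<close>)
    moreover have "(\<Sum>i\<in>T1. 1 / norm (\<mu> i)) \<le> (\<Sum>i\<in>{i\<in>I. norm (\<mu> i) \<le> 1}. 1 / norm (\<mu> i))"
      by (rule sum_mono2[OF finite_disc]) (use T in \<open>auto simp: T1_def\<close>)
    moreover have "(\<Sum>i\<in>T2. 1 / norm (\<mu> i)) \<le> 4 * A"
    proof -
      obtain J where J: "\<And>i. i \<in> T2 \<Longrightarrow> norm (\<mu> i) \<le> 4 ^ J"
      proof -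
        obtain J where "Max (insert 0 ((norm \<circ> \<mu>) ` T2)) < 4 ^ J" using real_arch_pow[of 4] by auto
        then show ?thesis using fin by (intro that[of J]) (auto dest!: less_imp_le)
      qed
      have "(\<Sum>i\<in>T2. 1 / norm (\<mu> i)) \<le> (\<Sum>j<J. 2 * A * (1/2) ^ j)"
        by (rule ind) (use T fin J in \<open>auto simp: T2_def\<close>)
      also have "\<dots> = 2 * A * (\<Sum>j<J. (1/2) ^ j)" by (simp add: sum_distrib_left)
      also have "\<dots> \<le> 2 * A * 2"
        using A0 by (intro mult_left_mono) (auto simp: sum_gp_strict)
      finally show ?thesis by simp
    qed
    ultimately show "(\<Sum>i\<in>T. 1 / norm (\<mu> i)) \<le> (\<Sum>i\<in>{i\<in>I. norm (\<mu> i) \<le> 1}. 1 / norm (\<mu> i)) + 4 * A" by linarith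
  qed
qed

text \<open>The heart of the factorization.  The quotient by the zeros up to radius \<open>R\<close> has no zeros in that disc and is
bounded by \<open>exp(O(sqrt R))\<close> there.  By Borel and Caratheodory its deviation from \<open>f(0)\<close> at a fixed point is
controlled by \<open>sqrt R / R\<close>, which tends to 0; no exponential factor can remain.\<close>

lemma quotient_limit:
  obtains Q where "\<And>R w. f w = Q R w * part R w" "\<And>w. ((\<lambda>R. Q R w) \<longlongrightarrow> f 0) at_top"
proof -
  have "\<exists>Q. Q holomorphic_on UNIV \<and> (\<forall>w. f w = Q w * part R w) \<and> (\<forall>w. norm w \<le> R \<longrightarrow> Q w \<noteq> 0)" for R
    by (rule quotient[of R]) blast
  then obtain Q where Q: "\<And>R. Q R holomorphic_on UNIV" "\<And>R w. f w = Q R w * part R w"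
    "\<And>R w. norm w \<le> R \<Longrightarrow> Q R w \<noteq> 0" by metis
  have Q0: "Q R 0 = f 0" for R using Q(2)[of 0 R] by simp
  define A where "A R = 1 + \<bar>ln (C / norm (f 0))\<bar> + c * sqrt (2 * R)" for R
  have est: "norm (Q R w - f 0) \<le> norm (f 0) * (exp (8 * A R * norm w / R) - 1)"
    if R: "0 < R" "norm w \<le> R / 2" for R w
  proof -
    have "norm (Q R w - Q R 0) \<le> norm (Q R 0) * (exp (8 * A R * norm w / R) - 1)"
    proof (rule nonvanishing_near_constant[OF Q(1) _ _ _ R])
      fix v :: complex assume v: "norm v < R"
      show "Q R v \<noteq> 0" using Q(3)[of v R] v by simp
      have "norm (Q R v) \<le> C * exp (c * sqrt (2 * R))"
      proof (rule maximum_modulus_disc[OF Q(1)])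
        fix u :: complex assume u: "norm u = 2 * R"
        have "norm (Q R u) * 1 \<le> norm (Q R u) * norm (part R u)"
          using part_ge[of u 1 R] u R by (intro mult_left_mono) auto
        also have "\<dots> \<le> C * exp (c * sqrt (norm u))" using growth[of u] Q(2)[of u R] by (simp add: norm_mult)
        finally show "norm (Q R u) \<le> C * exp (c * sqrt (2 * R))" by (simp add: u)
      qed (use v R in auto)
      also have "\<dots> = norm (f 0) * exp (ln (C / norm (f 0)) + c * sqrt (2 * R))"
        using C_pos f0 by (simp add: exp_add)
      also have "\<dots> \<le> norm (f 0) * exp (A R)" by (intro mult_left_mono) (auto simp: A_def)
      finally show "norm (Q R v) \<le> norm (Q R 0) * exp (A R)" unfolding Q0 .
    next
      have "0 \<le> c * sqrt (2 * R)" using c0 R by simp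
      then show "0 < A R" unfolding A_def by linarith
    qed
    then show ?thesis unfolding Q0 .
  qed
  show thesis
  proof (rule that[OF Q(2)])
    fix w :: complex
    have "((\<lambda>R. norm (f 0) * (exp (8 * A R * norm w / R) - 1)) \<longlongrightarrow> norm (f 0) * (exp 0 - 1)) at_top"
    proof (intro tendsto_intros)
      have "((\<lambda>R. A R / R) \<longlongrightarrow> 0) at_top"
        unfolding A_def by real_asymp
      from tendsto_mult_left[OF this, of "8 * norm w"]
      show "((\<lambda>R. 8 * A R * norm w / R) \<longlongrightarrow> 0) at_top" by (simp add: mult_ac)
    qed
    then have lim: "((\<lambda>R. norm (f 0) * (exp (8 * A R * norm w / R) - 1)) \<longlongrightarrow> 0) at_top" by simp
    have ev: "eventually (\<lambda>R. norm (Q R w - f 0) \<le> norm (f 0) * (exp (8 * A R * norm w / R) - 1)) at_top"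
      using eventually_gt_at_top[of 0] eventually_ge_at_top[of "2 * norm w"]
      by eventually_elim (rule est, auto)
    have "((\<lambda>R. Q R w - f 0) \<longlongrightarrow> 0) at_top"
      by (rule Lim_null_comparison[OF ev lim])
    then show "((\<lambda>R. Q R w) \<longlongrightarrow> f 0) at_top" by (simp add: LIM_zero_iff)
  qed
qed

lemma product_of_part_limit:
  assumes "((\<lambda>R. part R w) \<longlongrightarrow> P) at_top"
  shows "f w = f 0 * P"
proof -
  obtain Q where Q: "\<And>R w. f w = Q R w * part R w" "\<And>w. ((\<lambda>R. Q R w) \<longlongrightarrow> f 0) at_top"
    by (rule quotient_limit) blast
  have "((\<lambda>R. Q R w * part R w) \<longlongrightarrow> f 0 * P) at_top" by (intro tendsto_mult Q assms)
  then have "((\<lambda>R::real. f w) \<longlongrightarrow> f 0 * P) at_top" by (simp flip: Q(1))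
  then show ?thesis by (simp add: tendsto_const_iff)
qed

lemma finite_product:
  assumes I: "finite I"
  shows "f w = f 0 * (\<Prod>i\<in>I. 1 - w / \<mu> i)"
proof (rule product_of_part_limit, rule tendsto_eventually)
  have "eventually (\<lambda>R. \<forall>i\<in>I. norm (\<mu> i) \<le> R) at_top"
    using I by (intro eventually_ball_finite) (auto intro: eventually_ge_at_top)
  then show "eventually (\<lambda>R. part R w = (\<Prod>i\<in>I. 1 - w / \<mu> i)) at_top"
    by eventually_elim (auto simp: part_def intro!: prod.cong)
qed

end

text \<open>The products over growing discs and the products over initial segments of the enumeration have the same
limit, because both differ from a long initial segment only by factors whose deviations from 1 have a small
sum.\<close>

lemma (in entire_half_order) infinite_product:
  fixes \<nu> :: "nat \<Rightarrow> complex"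
  assumes \<nu>: "bij_betw e (UNIV::nat set) I" and m: "\<And>n. \<nu> n = \<mu> (e n)"
  shows "f w = f 0 * (\<Prod>n. 1 - w / \<nu> n)"
proof (rule product_of_part_limit)
  obtain B where B: "\<And>T. finite T \<Longrightarrow> T \<subseteq> I \<Longrightarrow> (\<Sum>i\<in>T. 1 / norm (\<mu> i)) \<le> B"
    by (rule inverse_sum_bounded) blast
  have inj: "inj e" and img: "range e = I" using \<nu> by (auto simp: bij_betw_def)
  have "summable (\<lambda>n. 1 / norm (\<nu> n))"
  proof (rule bounded_imp_summable[of _ B])
    fix n
    have "(\<Sum>k\<le>n. 1 / norm (\<nu> k)) = (\<Sum>i\<in>e ` {..n}. 1 / norm (\<mu> i))"
      by (subst sum.reindex) (auto intro: inj_on_subset[OF inj] simp: m)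
    also have "\<dots> \<le> B" by (rule B) (use img in auto)
    finally show "(\<Sum>k\<le>n. 1 / norm (\<nu> k)) \<le> B" .
  qed auto
  from summable_mult[OF this, of "norm w"]
  have sm: "summable (\<lambda>n. norm (- w / \<nu> n))" by (simp add: norm_divide)
  define a where "a n = - w / \<nu> n" for n
  define P where "P = (\<Prod>n. 1 + a n)"
  have "convergent_prod (\<lambda>n. 1 + a n)"
    by (intro abs_convergent_prod_imp_convergent_prod summable_imp_abs_convergent_prod)
      (use sm in \<open>simp add: a_def\<close>)
  then have "(\<lambda>n. \<Prod>i\<le>n. 1 + a i) \<longlonglongrightarrow> P" unfolding P_def by (rule convergent_prod_LIMSEQ)
  then have pm: "(\<lambda>m. \<Prod>i<m. 1 + a i) \<longlonglongrightarrow> P"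
    by (subst filterlim_sequentially_Suc[symmetric]) (simp add: lessThan_Suc_atMost)
  define \<delta> where "\<delta> m = exp (\<Sum>n. norm (a (n + m))) - 1" for m
  have sa: "summable (\<lambda>n. norm (a n))" using sm by (simp add: a_def)
  have "(\<lambda>m. \<Sum>n. norm (a (n + m))) \<longlonglongrightarrow> 0" using suminf_exist_split2[OF sa] .
  then have "\<delta> \<longlonglongrightarrow> exp 0 - 1" unfolding \<delta>_def by (intro tendsto_intros)
  then have "(\<lambda>m. norm (\<Prod>i<m. 1 + a i) * \<delta> m + norm ((\<Prod>i<m. 1 + a i) - P)) \<longlonglongrightarrow> norm P * (exp 0 - 1) + norm (P - P)"
    by (intro tendsto_intros pm)
  then have lim: "(\<lambda>m. norm (\<Prod>i<m. 1 + a i) * \<delta> m + norm ((\<Prod>i<m. 1 + a i) - P)) \<longlonglongrightarrow> 0" by simp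
  have partE: "part R w = (\<Prod>n\<in>{n. norm (\<nu> n) \<le> R}. 1 + a n)" for R
  proof -
    have "{i\<in>I. norm (\<mu> i) \<le> R} = e ` {n. norm (\<nu> n) \<le> R}" using img by (auto simp: m)
    then show ?thesis unfolding part_def
      by (simp add: prod.reindex[OF inj_on_subset[OF inj]] a_def m)
  qed
  have finE: "finite {n. norm (\<nu> n) \<le> R}" for R
  proof (rule finite_imageD[of e])
    show "finite (e ` {n. norm (\<nu> n) \<le> R})"
      by (rule finite_subset[OF _ finite_disc[of R]]) (use img in \<open>auto simp: m\<close>)
  qed (rule inj_on_subset[OF inj], simp)
  have "((\<lambda>R. part R w) \<longlongrightarrow> P) at_top"
    unfolding tendsto_iff
  proof (intro allI impI)
    fix \<epsilon> :: real assume "0 < \<epsilon>"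
    from order_tendstoD(2)[OF lim this] obtain m0
      where m0: "norm (\<Prod>i<m0. 1 + a i) * \<delta> m0 + norm ((\<Prod>i<m0. 1 + a i) - P) < \<epsilon>"
      by (auto simp: eventually_sequentially)
    have "eventually (\<lambda>R. \<forall>n\<in>{..<m0}. norm (\<nu> n) \<le> R) at_top"
      by (intro eventually_ball_finite) (auto intro: eventually_ge_at_top)
    then show "eventually (\<lambda>R. dist (part R w) P < \<epsilon>) at_top"
    proof eventually_elim
      case (elim R)
      let ?T = "{n. norm (\<nu> n) \<le> R} - {..<m0}" and ?p = "\<Prod>i<m0. 1 + a i"
      have split: "part R w = ?p * (\<Prod>n\<in>?T. 1 + a n)"
      proof -
        have "{n. norm (\<nu> n) \<le> R} = {..<m0} \<union> ?T" using elim by auto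
        then have "part R w = (\<Prod>n\<in>{..<m0} \<union> ?T. 1 + a n)" unfolding partE by simp
        also have "\<dots> = ?p * (\<Prod>n\<in>?T. 1 + a n)" by (rule prod.union_disjoint) (use finE in auto)
        finally show ?thesis .
      qed
      have "norm ((\<Prod>n\<in>?T. 1 + a n) - 1) \<le> (\<Prod>n\<in>?T. 1 + norm (a n)) - 1"
        by (rule norm_prod_minus1_le_prod_minus1)
      also have "(\<Prod>n\<in>?T. 1 + norm (a n)) \<le> (\<Prod>n\<in>?T. exp (norm (a n)))"
        by (intro prod_mono) auto
      also have "\<dots> = exp (\<Sum>n\<in>?T. norm (a n))" using finE by (simp add: exp_sum)
      also have "(\<Sum>n\<in>?T. norm (a n)) = (\<Sum>n\<in>(\<lambda>n. n - m0) ` ?T. norm (a (n + m0)))"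
        by (subst sum.reindex) (auto simp: inj_on_def)
      also have "\<dots> \<le> (\<Sum>n. norm (a (n + m0)))"
        by (rule sum_le_suminf) (use finE summable_ignore_initial_segment[OF sa] in auto)
      finally have t: "norm ((\<Prod>n\<in>?T. 1 + a n) - 1) \<le> \<delta> m0" by (simp add: \<delta>_def)
      have "part R w - P = ?p * ((\<Prod>n\<in>?T. 1 + a n) - 1) + (?p - P)" unfolding split by (simp add: algebra_simps)
      then have "norm (part R w - P) \<le> norm ?p * norm ((\<Prod>n\<in>?T. 1 + a n) - 1) + norm (?p - P)"
        by (metis norm_mult norm_triangle_ineq)
      also have "\<dots> \<le> norm ?p * \<delta> m0 + norm (?p - P)" using t by (intro add_right_mono mult_left_mono) auto
      also have "\<dots> < \<epsilon>" by (rule m0)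
      finally show ?case by (simp add: dist_norm)
    qed
  qed
  then show "((\<lambda>R. part R w) \<longlongrightarrow> (\<Prod>n. 1 - w / \<nu> n)) at_top" by (simp add: P_def a_def)
qed

lemma growth_divide_power:
  assumes F: "\<And>w. norm (F w) \<le> C * exp (c * sqrt (norm w))" and c: "0 \<le> c"
    and f: "f holomorphic_on UNIV" "\<And>w. F w = w ^ d * f w"
  shows "norm (f w) \<le> C * exp c * exp (c * sqrt (norm w))"
proof -
  have C: "0 \<le> C" using order_trans[OF norm_ge_zero F[of 0]] by simp
  have out: "norm (f w) \<le> C * exp (c * sqrt (norm w))" if "1 \<le> norm w" for w
  proof -
    have "1 * norm (f w) \<le> norm w ^ d * norm (f w)" using that by (intro mult_right_mono) auto
    also have "\<dots> = norm (F w)" by (simp add: f(2) norm_mult norm_power)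
    finally show ?thesis using F[of w] by simp
  qed
  show ?thesis
  proof (cases "1 \<le> norm w")
    case True
    have "C * exp (c * sqrt (norm w)) * 1 \<le> C * exp (c * sqrt (norm w)) * exp c"
      using C c by (intro mult_left_mono) auto
    then show ?thesis using out[OF True] by (simp add: mult_ac)
  next
    case False
    have "norm (f w) \<le> C * exp c"
    proof (rule maximum_modulus_disc[OF f(1), of 1])
      show "norm (f v) \<le> C * exp c" if "norm v = 1" for v using out[of v] that by simp
    qed (use False in simp)
    also have "C * exp c = C * exp c * 1" by simp
    also have "\<dots> \<le> C * exp c * exp (c * sqrt (norm w))"
      using C c by (intro mult_left_mono) auto
    finally show ?thesis by simp
  qed
qed

text \<open>The cofactor \<open>f\<close> is exposed because its value at 0, the lowest Taylor coefficient of
\<open>F\<close>, inherits reality from \<open>F\<close>.\<close>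

lemma hadamard_half_order:
  fixes \<mu> :: "nat \<Rightarrow> complex"
  assumes F: "F holomorphic_on UNIV" "F w0 \<noteq> 0" and c: "0 \<le> c"
    and growth: "\<And>w. norm (F w) \<le> C * exp (c * sqrt (norm w))"
    and \<mu>: "\<And>n. \<mu> n \<noteq> 0" "\<And>n. F (\<mu> n) = 0"
    and cnt: "\<And>a. a \<noteq> 0 \<Longrightarrow> F a = 0 \<Longrightarrow> finite {n. \<mu> n = a} \<and> card {n. \<mu> n = a} = nat (zorder F a)"
  obtains f where "f holomorphic_on UNIV" "\<And>w. F w = w ^ nat (zorder F 0) * f w"
    "\<And>w. F w = f 0 * (w ^ nat (zorder F 0) * (\<Prod>n. 1 - w / \<mu> n))"
proof -
  let ?d = "nat (zorder F 0)"
  obtain f where f: "f holomorphic_on UNIV" "f 0 \<noteq> 0" "\<And>w. F w = (w - 0) ^ ?d * f w"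
    "\<And>a. a \<noteq> 0 \<Longrightarrow> zorder f a = zorder F a"
    using entire_factor_power[OF F, of 0] by blast
  have pos: "0 \<le> zorder F a" for a using entire_factor_power[OF F, of a] by blast
  have cnt': "finite {n. \<mu> n = a} \<and> int (card {n. \<mu> n = a}) = zorder f a" for a
  proof (cases "a \<noteq> 0 \<and> F a = 0")
    case True
    then show ?thesis using cnt[of a] f(4)[of a] pos[of a] by simp
  next
    case False
    then have "{n. \<mu> n = a} = {}" using \<mu> by auto
    moreover have "f a \<noteq> 0" using False f(2) f(3)[of a] by auto
    then have "zorder f a = 0" using entire_zorder_eq_0_iff[OF f(1,2)] by blast
    ultimately show ?thesis by simp
  qed
  interpret entire_half_order f "C * exp c" c UNIV \<mu>
    by unfold_locales (use f c cnt' growth_divide_power[OF growth c f(1), of ?d] in auto)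
  have fw: "f w = f 0 * (\<Prod>n. 1 - w / \<mu> n)" for w
    by (rule infinite_product[of id]) auto
  show thesis
  proof (rule that[OF f(1)])
    fix w
    show "F w = w ^ ?d * f w" using f(3)[of w] by simp
    also have "f w = f 0 * (\<Prod>n. 1 - w / \<mu> n)" by (rule fw)
    finally show "F w = f 0 * (w ^ ?d * (\<Prod>n. 1 - w / \<mu> n))" by (simp only: mult_ac)
  qed
qed

text \<open>Labelling repeated zeros turns the zeros with multiplicity into an ordinary set; being infinite and countable, it
is in bijection with the natural numbers, which provides the enumeration.\<close>

definition zeros_with_multiplicity :: "(complex \<Rightarrow> complex) \<Rightarrow> (complex \<times> nat) set" where
  "zeros_with_multiplicity F = (SIGMA a:{a. a \<noteq> 0 \<and> F a = 0}. {..<nat (zorder F a)})"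

lemma zeros_with_multiplicity_fibre:
  "{i \<in> zeros_with_multiplicity F. fst i = a} = (if a \<noteq> 0 \<and> F a = 0 then Pair a ` {..<nat (zorder F a)} else {})"
  by (auto simp: zeros_with_multiplicity_def)

text \<open>With finitely many zeros \<open>F\<close> would be a nonzero polynomial, which stays away from 0 far out on the axis.\<close>

lemma infinitely_many_zeros:
  assumes F: "F holomorphic_on UNIV" "F w0 \<noteq> 0" and c: "0 \<le> c"
    and growth: "\<And>w. norm (F w) \<le> C * exp (c * sqrt (norm w))"
    and lim: "((\<lambda>x::real. F (of_real x)) \<longlongrightarrow> 0) at_top"
  shows "infinite (zeros_with_multiplicity F)"
proof
  let ?I = "zeros_with_multiplicity F"
  assume fin: "finite ?I"
  let ?d = "nat (zorder F 0)"
  obtain f where f: "f holomorphic_on UNIV" "f 0 \<noteq> 0" "\<And>w. F w = (w - 0) ^ ?d * f w"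
    "\<And>a. a \<noteq> 0 \<Longrightarrow> zorder f a = zorder F a"
    using entire_factor_power[OF F, of 0] by blast
  have pos: "0 \<le> zorder F a" for a using entire_factor_power[OF F, of a] by blast
  have cnt': "int (card {i\<in>?I. fst i = a}) = zorder f a" for a
  proof (cases "a \<noteq> 0 \<and> F a = 0")
    case True
    then show ?thesis unfolding zeros_with_multiplicity_fibre
      using f(4)[of a] pos[of a] by (simp add: card_image inj_on_def)
  next
    case False
    moreover have "f a \<noteq> 0" using False f(2) f(3)[of a] by auto
    then have "zorder f a = 0" using entire_zorder_eq_0_iff[OF f(1,2)] by blast
    ultimately show ?thesis unfolding zeros_with_multiplicity_fibre by auto
  qed
  interpret entire_half_order f "C * exp c" c ?I fst
    by unfold_locales (use f c cnt' fin growth_divide_power[OF growth c f(1), of ?d] in auto)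
  have ev: "eventually (\<lambda>x::real. norm (f 0) \<le> norm (F (of_real x))) at_top"
  proof -
    have "eventually (\<lambda>x::real. \<forall>i\<in>?I. 2 * norm (fst i) \<le> x) at_top"
      using fin by (intro eventually_ball_finite) (auto intro: eventually_ge_at_top)
    then show ?thesis using eventually_ge_at_top[of 1]
    proof eventually_elim
      case (elim x)
      have "1 \<le> (\<Prod>i\<in>?I. norm (1 - of_real x / fst i))"
      proof (rule prod_ge_1)
        fix i assume i: "i \<in> ?I"
        then have m: "0 < norm (fst i)" using mu_nz by simp
        have "2 \<le> norm (of_real x / fst i)" using elim i m by (simp add: norm_divide pos_le_divide_eq)
        then show "1 \<le> norm (1 - of_real x / fst i)"
          using norm_triangle_ineq2[of "of_real x / fst i" 1] by (simp add: norm_minus_commute)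
      qed
      moreover have "1 \<le> x ^ ?d" using elim by simp
      ultimately have "norm (f 0) * (1 * 1) \<le> norm (f 0) * (x ^ ?d * (\<Prod>i\<in>?I. norm (1 - of_real x / fst i)))"
        by (intro mult_left_mono mult_mono) auto
      also have "\<dots> = norm (F (of_real x))"
        using finite_product[OF fin, of "of_real x"] elim
        by (simp add: f(3) norm_mult norm_power prod_norm mult_ac)
      finally show ?case by simp
    qed
  qed
  have "((\<lambda>x::real. norm (F (of_real x))) \<longlongrightarrow> norm (0::complex)) at_top" by (intro tendsto_norm lim)
  then have "norm (f 0) \<le> norm (0::complex)"
    by (rule tendsto_lowerbound[OF _ ev]) simp
  then show False using f(2) by simp
qed

lemma enumeration_of_zeros:
  assumes F: "F holomorphic_on UNIV" "F w0 \<noteq> 0" and inf: "infinite (zeros_with_multiplicity F)"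
  obtains \<mu> :: "nat \<Rightarrow> complex" where "\<And>n. \<mu> n \<noteq> 0 \<and> F (\<mu> n) = 0"
    "\<And>a. a \<noteq> 0 \<Longrightarrow> F a = 0 \<Longrightarrow> finite {n. \<mu> n = a} \<and> card {n. \<mu> n = a} = nat (zorder F a)"
proof -
  let ?I = "zeros_with_multiplicity F"
  have nc: "\<not> F constant_on UNIV"
  proof
    assume "F constant_on UNIV"
    then have "F a \<noteq> 0" for a using F(2) by (metis UNIV_I constant_on_def)
    then have "?I = {}" by (auto simp: zeros_with_multiplicity_def)
    then show False using inf by simp
  qed
  have "countable {z\<in>UNIV. F z = 0}"
    by (rule holomorphic_countable_zeros[OF F(1) _ _ _ nc]) (use fsigma.intros[of "\<lambda>_. UNIV"] in auto)
  then have "countable {a. a \<noteq> 0 \<and> F a = 0}" by (rule countable_subset[rotated]) auto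
  then have "countable ?I" unfolding zeros_with_multiplicity_def by (intro countable_SIGMA) auto
  then have bij: "bij_betw (from_nat_into ?I) UNIV ?I" using inf by (rule bij_betw_from_nat_into)
  define e where "e = from_nat_into ?I"
  have e: "inj e" "range e = ?I" using bij by (auto simp: e_def bij_betw_def)
  show thesis
  proof (rule that[of "\<lambda>n. fst (e n)"])
    fix n
    have "e n \<in> ?I" using e(2) by blast
    then show "fst (e n) \<noteq> 0 \<and> F (fst (e n)) = 0" by (auto simp: zeros_with_multiplicity_def)
  next
    fix a assume a: "a \<noteq> 0" "F a = 0"
    have im: "e ` {n. fst (e n) = a} = Pair a ` {..<nat (zorder F a)}"
    proof -
      have "e ` {n. fst (e n) = a} = {i\<in>range e. fst i = a}" by auto
      then have "e ` {n. fst (e n) = a} = {i\<in>?I. fst i = a}" by (simp only: e(2))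
      then show ?thesis unfolding zeros_with_multiplicity_fibre using a by simp
    qed
    have inj: "inj_on e {n. fst (e n) = a}" by (rule inj_on_subset[OF e(1)]) simp
    have "finite (e ` {n. fst (e n) = a})" unfolding im by simp
    then have "finite {n. fst (e n) = a}" using inj by (rule finite_imageD)
    moreover have "card {n. fst (e n) = a} = nat (zorder F a)"
      unfolding card_image[OF inj, symmetric] im by (simp add: card_image inj_on_def)
    ultimately show "finite {n. fst (e n) = a} \<and> card {n. fst (e n) = a} = nat (zorder F a)" by blast
  qed
qed

section \<open>Theorems of Phragmen-Lindelof and Liouville type\<close>

lemma holomorphic_on_locally:
  assumes "\<And>a. \<exists>U. open U \<and> a \<in> U \<and> h holomorphic_on U"
  shows "h holomorphic_on UNIV"
  unfolding holomorphic_on_def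
proof
  fix a :: complex
  obtain U where U: "open U" "a \<in> U" "h holomorphic_on U" using assms by blast
  then show "h field_differentiable (at a within UNIV)"
    using holomorphic_on_imp_differentiable_at by auto
qed

text \<open>Near a common zero both functions are divided by the same linear factor; the denominator is then nonzero
because its zero was simple.\<close>

lemma entire_divide_simple_zeros:
  assumes N: "N holomorphic_on UNIV" and s: "s holomorphic_on UNIV"
    and z: "\<And>a. s a = 0 \<Longrightarrow> deriv s a \<noteq> 0 \<and> N a = 0"
  obtains h where "h holomorphic_on UNIV" "\<And>w. N w = h w * s w"
proof
  let ?h = "\<lambda>w. if s w = 0 then deriv N w / deriv s w else N w / s w"
  show "?h holomorphic_on UNIV"
  proof (rule holomorphic_on_locally)
    fix a
    show "\<exists>U. open U \<and> a \<in> U \<and> ?h holomorphic_on U"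
    proof (cases "s a = 0")
      case False
      have "open {w. s w \<noteq> 0}"
        using continuous_open_preimage[OF holomorphic_on_imp_continuous_on[OF s] open_UNIV, of "- {0}"]
        by (simp add: vimage_def open_Compl)
      moreover have "?h holomorphic_on {w. s w \<noteq> 0}"
        by (rule holomorphic_transform[of "\<lambda>w. N w / s w"])
          (auto intro!: holomorphic_intros intro: holomorphic_on_subset[OF N] holomorphic_on_subset[OF s])
      ultimately show ?thesis using False by blast
    next
      case True
      define N1 where "N1 w = (if w = a then deriv N a else (N w - N a) / (w - a))" for w
      define s1 where "s1 w = (if w = a then deriv s a else (s w - s a) / (w - a))" for w
      have hol: "N1 holomorphic_on UNIV" "s1 holomorphic_on UNIV"
        unfolding N1_def s1_def using pole_lemma_open[OF N, of a] pole_lemma_open[OF s, of a] by auto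
      have "open {w. s1 w \<noteq> 0}"
        using continuous_open_preimage[OF holomorphic_on_imp_continuous_on[OF hol(2)] open_UNIV, of "- {0}"]
        by (simp add: vimage_def open_Compl)
      moreover have "?h holomorphic_on {w. s1 w \<noteq> 0}"
      proof (rule holomorphic_transform[of "\<lambda>w. N1 w / s1 w"])
        show "(\<lambda>w. N1 w / s1 w) holomorphic_on {w. s1 w \<noteq> 0}"
          by (auto intro!: holomorphic_intros intro: holomorphic_on_subset[OF hol(1)] holomorphic_on_subset[OF hol(2)])
        fix w assume "w \<in> {w. s1 w \<noteq> 0}"
        then show "N1 w / s1 w = ?h w" using z[OF True] True by (auto simp: N1_def s1_def split: if_splits)
      qed
      moreover have "s1 a \<noteq> 0" using z[OF True] by (simp add: s1_def)
      ultimately show ?thesis by blast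
    qed
  qed
  show "N w = ?h w * s w" for w using z[of w] by auto
qed

text \<open>In the right half-plane the power \<open>3/4\<close> keeps arguments within \<open>3 \<pi> / 8\<close>, so its real part is comparable to its
absolute value.\<close>

lemma Re_powr_lower:
  assumes "1 \<le> Re v"
  shows "norm v powr (3/4) * cos (3 * pi / 8) \<le> Re (v powr (3/4))"
proof -
  have v: "v \<noteq> 0" using assms by auto
  have arg: "\<bar>Arg v\<bar> < pi / 2" using Re_Ln_pos_lt[OF v] assms Arg_eq_Im_Ln[OF v] by simp
  have "v powr (3/4) = exp (3/4 * Ln v)" using v by (simp add: powr_def)
  also have "Re \<dots> = exp (3/4 * ln (norm v)) * cos (3/4 * Arg v)"
    using v by (simp add: Re_exp Arg_eq_Im_Ln)
  finally have e: "Re (v powr (3/4)) = norm v powr (3/4) * cos (3/4 * Arg v)"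
    using v by (simp add: powr_def)
  have "cos (3 * pi / 8) \<le> cos \<bar>3/4 * Arg v\<bar>"
    by (rule cos_monotone_0_pi_le) (use arg pi_gt_zero in \<open>auto simp: abs_mult\<close>)
  then have "cos (3 * pi / 8) \<le> cos (3/4 * Arg v)" by (simp only: cos_abs_real)
  then show ?thesis unfolding e by (intro mult_left_mono) auto
qed

text \<open>The growth \<open>exp(c sqrt |z|)\<close> is beaten by \<open>exp(- e |z| powr (3/4))\<close>; with this convergence factor the maximum
principle applies on large half-discs, and \<open>e\<close> is sent to 0 afterwards.\<close>

lemma phragmen_lindelof_upper:
  assumes f: "f holomorphic_on UNIV" and growth: "\<And>w. norm (f w) \<le> C * exp (c * sqrt (norm w))"
    and bd: "\<And>x::real. norm (f (of_real x)) \<le> B" and B: "0 < B" and w: "0 \<le> Im w"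
  shows "norm (f w) \<le> B"
proof -
  \<comment> \<open>the shift by 1 keeps the argument of the power away from 0 on the closed half-plane\<close>
  define p where "p z = (1 - \<i> * z) powr (3/4)" for z
  have Rep: "norm z powr (3/4) * cos (3 * pi / 8) \<le> Re (p z)" if "0 \<le> Im z" for z
  proof -
    have "(norm z)\<^sup>2 \<le> (norm (1 - \<i> * z))\<^sup>2"
      unfolding cmod_power2 using that by (simp add: power2_eq_square algebra_simps)
    then have n: "norm z \<le> norm (1 - \<i> * z)" by (rule power2_le_imp_le) simp
    have "norm z powr (3/4) * cos (3 * pi / 8) \<le> norm (1 - \<i> * z) powr (3/4) * cos (3 * pi / 8)"
      using n by (intro mult_right_mono powr_mono2 cos_ge_zero) auto
    also have "\<dots> \<le> Re (p z)" unfolding p_def by (rule Re_powr_lower) (use that in simp)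
    finally show ?thesis .
  qed
  have cpos: "0 < cos (3 * pi / 8)" by (rule cos_gt_zero) auto
  have main: "norm (f w) \<le> B * exp (e * Re (p w))" if e: "0 < e" for e
  proof -
    define g where "g z = f z * exp (- (of_real e * p z))" for z
    have ng: "norm (g z) = norm (f z) * exp (- (e * Re (p z)))" for z
      by (simp add: g_def norm_mult)
    have "((\<lambda>R. C * exp (c * sqrt R - e * (R powr (3/4) * cos (3 * pi / 8)))) \<longlongrightarrow> C * 0) at_top"
    proof (intro tendsto_intros)
      have "filterlim (\<lambda>R::real. c * sqrt R - e * (R powr (3/4) * q)) at_bot at_top" if "q > 0" for q
        using that e by real_asymp
      then show "((\<lambda>R. exp (c * sqrt R - e * (R powr (3/4) * cos (3 * pi / 8)))) \<longlongrightarrow> 0) at_top"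
        using cpos by (intro filterlim_compose[OF exp_at_bot]) auto
    qed
    then have "eventually (\<lambda>R. C * exp (c * sqrt R - e * (R powr (3/4) * cos (3 * pi / 8))) < B) at_top"
      using B by (intro order_tendstoD(2)) auto
    then have "eventually (\<lambda>R. C * exp (c * sqrt R - e * (R powr (3/4) * cos (3 * pi / 8))) < B \<and> norm w \<le> R) at_top"
      using eventually_ge_at_top[of "norm w"] by eventually_elim auto
    then obtain R where R: "C * exp (c * sqrt R - e * (R powr (3/4) * cos (3 * pi / 8))) < B" "norm w \<le> R"
      using eventually_happens[of _ "at_top :: real filter"] by auto
    define S where "S = {z. 0 \<le> Im z} \<inter> cball 0 R"
    have clS: "closed S" unfolding S_def by (intro closed_Int closed_halfspace_Im_ge closed_cball)
    have holg: "g holomorphic_on {z. -1 < Im z}"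
      unfolding g_def p_def
    proof (intro holomorphic_intros)
      show "f holomorphic_on {z. -1 < Im z}" using f by (rule holomorphic_on_subset) auto
    qed (auto simp: complex_nonpos_Reals_iff)
    have C0: "0 \<le> C" using order_trans[OF norm_ge_zero growth[of 0]] by simp
    have "norm (g w) \<le> B"
    proof (rule maximum_modulus_frontier[of g S])
      show "g holomorphic_on interior S"
        by (rule holomorphic_on_subset[OF holg]) (use interior_subset[of S] in \<open>auto simp: S_def\<close>)
      have "g holomorphic_on S" by (rule holomorphic_on_subset[OF holg]) (auto simp: S_def)
      then show "continuous_on (closure S) g" using clS by (simp add: holomorphic_on_imp_continuous_on)
      show "bounded S" unfolding S_def by (rule bounded_subset[OF bounded_cball]) auto
      show "w \<in> S" using w R by (auto simp: S_def)
      fix z assume "z \<in> frontier S"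
      then have zS: "z \<in> S" and zi: "z \<notin> interior S" using clS by (auto simp: frontier_def)
      have "{z. 0 < Im z} \<inter> ball 0 R \<subseteq> interior S"
        by (rule interior_maximal) (auto simp: S_def intro!: open_Int open_halfspace_Im_gt)
      then have alt: "Im z = 0 \<or> norm z = R" using zS zi by (force simp: S_def)
      have Imz: "0 \<le> Im z" using zS by (auto simp: S_def)
      have Rep0: "0 \<le> Re (p z)" using Rep[OF Imz] cpos by (smt (verit) mult_nonneg_nonneg powr_ge_zero)
      show "norm (g z) \<le> B"
      proof (cases "Im z = 0")
        case True
        then have "z = of_real (Re z)" by (simp add: complex_eq_iff)
        then have "norm (f z) \<le> B" using bd by metis
        moreover have "exp (- (e * Re (p z))) \<le> 1" using e Rep0 by simp
        ultimately have "norm (f z) * exp (- (e * Re (p z))) \<le> B * 1" by (intro mult_mono) (use B in auto)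
        then show ?thesis by (simp add: ng)
      next
        case False
        then have zR: "norm z = R" using alt by simp
        have "norm (g z) \<le> C * exp (c * sqrt R) * exp (- (e * (R powr (3/4) * cos (3 * pi / 8))))"
          unfolding ng using growth[of z] Rep[OF Imz] e C0 by (intro mult_mono) (auto simp: zR)
        also have "\<dots> = C * exp (c * sqrt R - e * (R powr (3/4) * cos (3 * pi / 8)))" by (simp add: exp_diff exp_minus field_simps)
        finally show ?thesis using R(1) by simp
      qed
    qed
    then show ?thesis by (simp add: ng exp_minus field_simps)
  qed
  have "((\<lambda>e. B * exp (e * Re (p w))) \<longlongrightarrow> B * exp (0 * Re (p w))) (at_right 0)"
    by (intro tendsto_intros)
  then have "norm (f w) \<le> B * exp (0 * Re (p w))"
    by (rule tendsto_lowerbound) (auto intro!: eventually_at_rightI[of 0 1] main)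
  then show ?thesis by simp
qed

lemma phragmen_lindelof:
  assumes f: "f holomorphic_on UNIV" and growth: "\<And>w. norm (f w) \<le> C * exp (c * sqrt (norm w))"
    and bd: "\<And>x::real. norm (f (of_real x)) \<le> B" and B: "0 < B"
  shows "norm (f w) \<le> B"
proof (cases "0 \<le> Im w")
  case True
  then show ?thesis using phragmen_lindelof_upper[OF f growth bd B] by simp
next
  case False
  have "norm ((\<lambda>w. f (- w)) (- w)) \<le> B"
  proof (rule phragmen_lindelof_upper[of "\<lambda>w. f (- w)" C c B "- w", OF _ _ _ B])
    show "(\<lambda>w. f (- w)) holomorphic_on UNIV"
      using holomorphic_on_compose_gen[OF holomorphic_on_minus[OF holomorphic_on_ident] f] by (simp add: o_def)
    show "norm (f (- w)) \<le> C * exp (c * sqrt (norm w))" for w using growth[of "- w"] by simp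
    show "norm (f (- complex_of_real x)) \<le> B" for x :: real using bd[of "- x"] by simp
  qed (use False in simp)
  then show ?thesis by simp
qed

text \<open>Phragmen-Lindelof in both half-planes makes \<open>f\<close> bounded, Liouville makes it constant, and the limit identifies the
constant.\<close>

lemma entire_half_order_bounded_real_vanishes:
  assumes f: "f holomorphic_on UNIV" and growth: "\<And>w. norm (f w) \<le> C * exp (c * sqrt (norm w))"
    and bd: "\<And>x::real. norm (f (of_real x)) \<le> B"
    and lim: "((\<lambda>x::real. f (of_real x)) \<longlongrightarrow> 0) at_bot"
  shows "f w = 0"
proof -
  have B0: "0 \<le> B" using order_trans[OF norm_ge_zero bd[of 0]] .
  have "norm (f w) \<le> B + 1" for w
    by (rule phragmen_lindelof[OF f growth]) (use bd B0 in \<open>auto intro: add_increasing2\<close>)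
  then have "bounded (range f)" by (auto simp: bounded_iff)
  then have "f constant_on UNIV" by (rule Liouville_theorem[OF f])
  then obtain k where k: "\<And>w. f w = k" by (auto simp: constant_on_def)
  then have "((\<lambda>x::real. k) \<longlongrightarrow> 0) at_bot" using lim by simp
  then have "k = 0" by (simp add: tendsto_const_iff)
  then show ?thesis using k by simp
qed

lemma norm_sin_squared: "(norm (sin z))\<^sup>2 = (sin (Re z))\<^sup>2 + (sinh (Im z))\<^sup>2"
proof -
  have "(norm (sin z))\<^sup>2 = (sin (Re z) * cosh (Im z))\<^sup>2 + (cos (Re z) * sinh (Im z))\<^sup>2"
    unfolding cmod_power2 by (simp add: Re_sin Im_sin cosh_def sinh_def)
  also have "\<dots> = (sin (Re z))\<^sup>2 * (1 + (sinh (Im z))\<^sup>2) + (1 - (sin (Re z))\<^sup>2) * (sinh (Im z))\<^sup>2"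
    by (simp add: power_mult_distrib cosh_square_eq cos_squared_eq)
  also have "\<dots> = (sin (Re z))\<^sup>2 + (sinh (Im z))\<^sup>2" by (simp add: algebra_simps)
  finally show ?thesis .
qed

lemma abs_sinh_le_norm_sin: "\<bar>sinh (Im z)\<bar> \<le> norm (sin z)"
  by (rule power2_le_imp_le) (auto simp: norm_sin_squared)

lemma exp_le_norm_sin_Re:
  assumes "(sin (Re z))\<^sup>2 = 1"
  shows "exp \<bar>Im z\<bar> \<le> 4 * norm (sin z)"
proof -
  have "(cosh (Im z))\<^sup>2 \<le> (norm (sin z))\<^sup>2"
    unfolding norm_sin_squared assms cosh_square_eq by simp
  then have "cosh (Im z) \<le> norm (sin z)" by (rule power2_le_imp_le) simp
  moreover have "exp \<bar>Im z\<bar> \<le> 2 * cosh (Im z)"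
    by (auto simp: cosh_def abs_if)
  ultimately show ?thesis by (smt (verit) cosh_real_nonneg)
qed

lemma exp_le_norm_sin_Im:
  assumes "1 \<le> \<bar>Im z\<bar>"
  shows "exp \<bar>Im z\<bar> \<le> 4 * norm (sin z)"
proof -
  let ?y = "\<bar>Im z\<bar>"
  have "exp (- ?y) \<le> 1" by simp
  moreover have "2 \<le> exp ?y" using exp_ge_add_one_self[of ?y] assms by linarith
  moreover have "p \<le> 4 * ((p - q) / 2)" if "q \<le> 1" "2 \<le> p" for p q :: real
    using that by (simp add: field_simps)
  ultimately have "exp ?y \<le> 4 * sinh ?y" unfolding sinh_field_def by blast
  also have "sinh ?y = \<bar>sinh (Im z)\<bar>" by (simp add: sinh_real_abs)
  finally show ?thesis using abs_sinh_le_norm_sin[of z] by linarith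
qed

text \<open>A form of the sampling theorem: up to a multiple of \<open>sin(kb) / k\<close>, such a function is determined by its values at
the nonzero multiples of \<open>\<pi> / b\<close>.  The quotient of \<open>k g(k)\<close> by the sine is bounded on the sides of large rectangles
that avoid the zeros of the sine, so Liouville's theorem applies.\<close>

lemma sine_type_interpolation:
  assumes b: "0 < b" and g: "g holomorphic_on UNIV"
    and growth: "\<And>k. norm (k * g k) \<le> C * exp (b * \<bar>Im k\<bar>)"
    and zero: "\<And>n::int. n \<noteq> 0 \<Longrightarrow> g (of_real (of_int n * pi / b)) = 0"
  obtains c where "\<And>k. k * g k = c * sin (k * of_real b)" "g 0 = c * of_real b"
proof -
  have hN: "(\<lambda>k. k * g k) holomorphic_on UNIV" by (intro holomorphic_intros g)
  have hs: "(\<lambda>k. sin (k * complex_of_real b)) holomorphic_on UNIV" by (intro holomorphic_intros)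
  obtain h where h: "h holomorphic_on UNIV" "\<And>k. k * g k = h k * sin (k * of_real b)"
  proof (rule entire_divide_simple_zeros[OF hN hs])
    fix a :: complex assume a: "sin (a * of_real b) = 0"
    have d: "deriv (\<lambda>k. sin (k * of_real b)) a = of_real b * cos (a * of_real b)"
      by (rule DERIV_imp_deriv) (auto intro!: derivative_eq_intros)
    have "cos (a * of_real b) \<noteq> 0" using a sin_cos_squared_add[of "a * of_real b"] by auto
    moreover obtain n :: int where n: "a * of_real b = of_real (of_int n * pi)"
      using a unfolding sin_eq_0 by auto
    then have "a = of_real (of_int n * pi / b)" using b by (simp add: field_simps)
    then have "a * g a = 0" using zero[of n] by (cases "n = 0") auto
    ultimately show "deriv (\<lambda>k. sin (k * of_real b)) a \<noteq> 0 \<and> a * g a = 0" using d b by simp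
  qed blast
  have C0: "0 \<le> C" using order_trans[OF norm_ge_zero growth[of 0]] by simp
  have hb: "norm (h k) \<le> 4 * C" if "exp (b * \<bar>Im k\<bar>) \<le> 4 * norm (sin (k * of_real b))" for k
  proof -
    let ?s = "norm (sin (k * of_real b))"
    have s: "0 < ?s" using that exp_gt_zero[of "b * \<bar>Im k\<bar>"] by linarith
    have "norm (h k) * ?s \<le> C * exp (b * \<bar>Im k\<bar>)" using growth[of k] h(2)[of k] by (simp add: norm_mult)
    also have "\<dots> \<le> C * (4 * ?s)" using that C0 by (intro mult_left_mono) auto
    finally show ?thesis using s by simp
  qed
  have bounded: "norm (h w) \<le> 4 * C" for w
  proof -
    obtain n :: nat where n: "\<bar>Re w\<bar> * b < n" "\<bar>Im w\<bar> * b < n" "1 < n"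
    proof -
      obtain n :: nat where "max 1 (max (\<bar>Re w\<bar> * b) (\<bar>Im w\<bar> * b)) < n" using reals_Archimedean2 by blast
      then show thesis by (intro that[of n]) auto
    qed
    \<comment> \<open>the vertical sides run half-way between two zeros of the sine, where \<open>|sin| = cosh\<close>\<close>
    define X where "X = (of_nat n + 1/2) * pi / b"
    define Y where "Y = of_nat n / b"
    have "real n < (of_nat n + 1/2) * pi"
    proof -
      have "real n * 1 \<le> real n * pi" using pi_gt3 by (intro mult_left_mono) auto
      moreover have "(of_nat n + 1/2) * pi = real n * pi + pi / 2" by (simp add: algebra_simps)
      ultimately show ?thesis using pi_gt_zero by linarith
    qed
    then have wX: "\<bar>Re w\<bar> < X" "\<bar>Im w\<bar> < Y" using n b by (auto simp: X_def Y_def pos_less_divide_eq)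
    let ?S = "cbox (Complex (-X) (-Y)) (Complex X Y)"
    show ?thesis
    proof (rule maximum_modulus_frontier[of h ?S])
      show "h holomorphic_on interior ?S" "continuous_on (closure ?S) h"
        using h(1) by (auto intro: holomorphic_on_subset holomorphic_on_imp_continuous_on)
      show "w \<in> ?S" using wX by (auto simp: in_cbox_complex_iff)
      fix z assume "z \<in> frontier ?S"
      then have "z \<in> ?S" "z \<notin> box (Complex (-X) (-Y)) (Complex X Y)" by (auto simp: frontier_cbox)
      then have "\<bar>Re z\<bar> = X \<or> \<bar>Im z\<bar> = Y" by (auto simp: in_cbox_complex_iff in_box_complex_iff)
      then show "norm (h z) \<le> 4 * C"
      proof
        assume X: "\<bar>Re z\<bar> = X"
        have abs_sin: "(sin \<bar>q\<bar>)\<^sup>2 = (sin q)\<^sup>2" for q :: real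
          by (cases "0 \<le> q") simp_all
        have "\<bar>Re (z * of_real b)\<bar> = (of_nat n + 1/2) * pi" using X b by (simp add: abs_mult X_def)
        then have "(sin (Re (z * of_real b)))\<^sup>2 = (sin ((of_nat n + 1/2) * pi))\<^sup>2"
          using abs_sin[of "Re (z * of_real b)"] by simp
        also have "sin ((of_nat n + 1/2) * pi) = cos (of_nat n * pi)"
          by (simp add: algebra_simps sin_add)
        also have "(cos (of_nat n * pi))\<^sup>2 = (1::real)" by (simp add: power_mult[symmetric] mult.commute)
        finally have "exp \<bar>Im (z * of_real b)\<bar> \<le> 4 * norm (sin (z * of_real b))" by (rule exp_le_norm_sin_Re)
        then show ?thesis using b by (intro hb) (simp add: abs_mult mult.commute)
      next
        assume Y: "\<bar>Im z\<bar> = Y"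
        have "\<bar>Im (z * of_real b)\<bar> = of_nat n" using Y b by (simp add: abs_mult Y_def)
        then have "exp \<bar>Im (z * of_real b)\<bar> \<le> 4 * norm (sin (z * of_real b))"
          using n by (intro exp_le_norm_sin_Im) auto
        then show ?thesis using b by (intro hb) (simp add: abs_mult mult.commute)
      qed
    qed auto
  qed
  then have "bounded (range h)" by (auto simp: bounded_iff)
  then have "h constant_on UNIV" by (rule Liouville_theorem[OF h(1)])
  then obtain c where c: "\<And>k. h k = c" by (auto simp: constant_on_def)
  have e: "k * g k = c * sin (k * of_real b)" for k using h(2)[of k] c by simp
  have "g field_differentiable (at 0)" using g by (simp add: holomorphic_on_def)
  then obtain g' where "(g has_field_derivative g') (at 0)" by (auto simp: field_differentiable_def)
  then have "((\<lambda>k. k * g k) has_field_derivative g 0) (at 0)"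
    by (auto intro!: derivative_eq_intros)
  moreover have "((\<lambda>k. k * g k) has_field_derivative c * of_real b) (at 0)"
    unfolding e by (auto intro!: derivative_eq_intros)
  ultimately have "g 0 = c * of_real b" by (rule DERIV_unique)
  with e show thesis by (rule that)
qed

text \<open>A type strictly below \<open>b\<close> cannot match the growth of the sine on the imaginary axis.\<close>

lemma sine_type_small_growth:
  assumes e: "\<And>k. k * g k = c * sin (k * of_real b)"
    and growth: "\<And>k. norm (k * g k) \<le> C * exp (a * \<bar>Im k\<bar>)" and ab: "a < b" and b: "0 < b"
  shows "c = 0"
proof -
  have upper: "norm c * exp ((b - a) * y) \<le> 4 * C" if y: "1 / b \<le> y" for y
  proof -
    let ?k = "\<i> * of_real y"
    have y0: "0 < y" using y b by (meson divide_pos_pos less_le_trans zero_less_one)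
    have "exp \<bar>Im (?k * of_real b)\<bar> \<le> 4 * norm (sin (?k * of_real b))"
      by (rule exp_le_norm_sin_Im) (use y b in \<open>simp add: pos_divide_le_eq\<close>)
    then have "norm c * exp (y * b) \<le> norm c * (4 * norm (sin (?k * of_real b)))"
      using y0 b by (intro mult_left_mono) auto
    also have "\<dots> = 4 * norm (?k * g ?k)" unfolding e[of ?k] by (simp add: norm_mult)
    also have "\<dots> \<le> 4 * (C * exp (a * y))" using growth[of ?k] y0 by simp
    finally have "norm c * exp (y * b) * exp (- (a * y)) \<le> 4 * (C * exp (a * y)) * exp (- (a * y))"
      by (rule mult_right_mono) simp
    then show ?thesis by (simp add: mult.assoc flip: exp_add) (simp add: algebra_simps)
  qed
  have ev: "eventually (\<lambda>y. norm c * exp ((b - a) * y) \<le> 4 * C) at_top"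
    using eventually_ge_at_top[of "1 / b"] by eventually_elim (rule upper)
  have lim: "filterlim (\<lambda>y. exp ((b - a) * y)) at_top at_top"
    using ab by real_asymp
  show ?thesis
  proof (rule ccontr)
    assume "c \<noteq> 0"
    then have "filterlim (\<lambda>y. norm c * exp ((b - a) * y)) at_top at_top"
      using lim by (intro filterlim_tendsto_pos_mult_at_top[OF tendsto_const]) auto
    then have "eventually (\<lambda>y. 4 * C < norm c * exp ((b - a) * y)) at_top"
      by (simp add: filterlim_at_top_dense)
    with ev have "eventually (\<lambda>y::real. False) at_top" by eventually_elim auto
    then show False by simp
  qed
qed

section \<open>Recovering the coefficient from boundary data\<close>

lemma ysol_zero_parameter: "ysol r \<alpha> \<beta> 0 x = of_real (\<alpha> + \<beta> * x)"
  unfolding ysol_def using powser_sums_zero[of "\<lambda>n. complex_of_real (ycoef r \<alpha> \<beta> n x)"]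
  by (simp add: sums_iff)

lemma zsol_zero_parameter: "zsol r \<alpha> \<beta> 0 x = of_real \<beta>"
  unfolding zsol_def using powser_sums_zero[of "\<lambda>n. complex_of_real (zcoef r \<alpha> \<beta> n x)"]
  by (simp add: sums_iff zcoef_def)

lemma normalised_solution_growth:
  assumes r: "regular_coeff b M r"
  obtains C where "0 < C"
    "\<And>k x. x \<in> {0..b} \<Longrightarrow> norm k * norm (ysol r 0 1 (k\<^sup>2) x) \<le> C * exp (\<bar>Im k\<bar> * travel r x)"
    "\<And>k x. x \<in> {0..b} \<Longrightarrow> norm (zsol r 0 1 (k\<^sup>2) x) \<le> C * exp (\<bar>Im k\<bar> * travel r x)"
    "\<And>k x. x \<in> {0..b} \<Longrightarrow> k \<noteq> 0 \<Longrightarrow> norm (ysol r 1 0 (k\<^sup>2) x) \<le> C * exp (\<bar>Im k\<bar> * travel r x)"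
proof -
  have b: "0 \<le> b" and c: "continuous_on {0..b} r" using regular_coeffD[OF r] by auto
  obtain C where C: "0 < C"
    "\<And>k y z x. solves b r (k\<^sup>2) y z \<Longrightarrow> x \<in> {0..b} \<Longrightarrow>
       norm (z x) \<le> C * (norm (z 0) + norm k * norm (y 0)) * exp (\<bar>Im k\<bar> * travel r x)"
    "\<And>k y z x. solves b r (k\<^sup>2) y z \<Longrightarrow> x \<in> {0..b} \<Longrightarrow>
       norm k * norm (y x) \<le> C * (norm (z 0) + norm k * norm (y 0)) * exp (\<bar>Im k\<bar> * travel r x)"
    by (rule solution_growth[OF r]) blast
  show thesis
  proof (rule that[OF C(1)])
    fix k x assume x: "x \<in> {0..b}"
    show "norm k * norm (ysol r 0 1 (k\<^sup>2) x) \<le> C * exp (\<bar>Im k\<bar> * travel r x)"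
      "norm (zsol r 0 1 (k\<^sup>2) x) \<le> C * exp (\<bar>Im k\<bar> * travel r x)"
      using C(2,3)[OF solves_ysol[OF c b, of "k\<^sup>2" 0 1] x] by (simp_all add: ysol_0 zsol_0)
    assume k: "k \<noteq> 0"
    have "norm k * norm (ysol r 1 0 (k\<^sup>2) x) \<le> norm k * (C * exp (\<bar>Im k\<bar> * travel r x))"
      using C(3)[OF solves_ysol[OF c b, of "k\<^sup>2" 1 0] x] by (simp add: ysol_0 zsol_0 mult_ac)
    then show "norm (ysol r 1 0 (k\<^sup>2) x) \<le> C * exp (\<bar>Im k\<bar> * travel r x)" using k by simp
  qed
qed

text \<open>Passing from \<open>k\<close> to \<open>\<kappa> = k\<^sup>2\<close> halves the order; the maximum principle covers the unit disc.\<close>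

lemma half_order_growth:
  assumes f: "f holomorphic_on UNIV" and \<tau>: "0 \<le> \<tau>" and C: "0 \<le> C"
    and bd: "\<And>k. 1 \<le> norm k \<Longrightarrow> norm (f (k\<^sup>2)) \<le> C * exp (\<tau> * norm k)"
  shows "norm (f w) \<le> C * exp \<tau> * exp (\<tau> * sqrt (norm w))"
proof -
  have out: "norm (f w) \<le> C * exp (\<tau> * sqrt (norm w))" if "1 \<le> norm w" for w
  proof -
    have "1 \<le> norm (csqrt w)" using that by simp
    from bd[OF this] show ?thesis by simp
  qed
  show ?thesis
  proof (cases "1 \<le> norm w")
    case True
    have "C * exp (\<tau> * sqrt (norm w)) * 1 \<le> C * exp (\<tau> * sqrt (norm w)) * exp \<tau>"
      using C \<tau> by (intro mult_left_mono) auto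
    then show ?thesis using out[OF True] by (simp add: mult_ac)
  next
    case False
    have "norm (f w) \<le> C * exp \<tau>"
    proof (rule maximum_modulus_disc[OF f, of 1])
      show "norm (f v) \<le> C * exp \<tau>" if "norm v = 1" for v using out[of v] that by simp
    qed (use False in simp)
    also have "C * exp \<tau> = C * exp \<tau> * 1" by simp
    also have "\<dots> \<le> C * exp \<tau> * exp (\<tau> * sqrt (norm w))"
      using C \<tau> by (intro mult_left_mono) auto
    finally show ?thesis by simp
  qed
qed

lemma solves_reflect:
  assumes s: "solves b r \<kappa> y z"
  shows "solves b (\<lambda>x. r (b - x)) \<kappa> (\<lambda>x. y (b - x)) (\<lambda>x. - z (b - x))"
proof -
  have ch: "((\<lambda>x. f (b - x)) has_vector_derivative - f') (at x within {0..b})"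
    if "(f has_vector_derivative f') (at (b - x) within {0..b})" for f :: "real \<Rightarrow> complex" and f' x
  proof -
    have "((\<lambda>x. b - x) has_vector_derivative - 1) (at x within {0..b})"
      by (auto intro!: derivative_eq_intros)
    moreover have "(\<lambda>x. b - x) ` {0..b} = {0..b}" by simp
    ultimately show ?thesis
      using vector_diff_chain_within[of "\<lambda>x. b - x" "-1" x "{0..b}" f f'] that by (simp add: o_def)
  qed
  show ?thesis unfolding solves_def
  proof (intro ballI conjI)
    fix x assume x: "x \<in> {0..b}"
    then have "b - x \<in> {0..b}" by auto
    then have s': "(y has_vector_derivative z (b - x)) (at (b - x) within {0..b})"
      "(z has_vector_derivative - (\<kappa> * of_real (r (b - x)) * y (b - x))) (at (b - x) within {0..b})"
      using s unfolding solves_def by auto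
    show "((\<lambda>x. y (b - x)) has_vector_derivative - z (b - x)) (at x within {0..b})"
      by (rule ch[OF s'(1)])
    show "((\<lambda>x. - z (b - x)) has_vector_derivative - (\<kappa> * of_real (r (b - x)) * y (b - x))) (at x within {0..b})"
      using has_vector_derivative_minus[OF ch[OF s'(2)]] by simp
  qed
qed

lemma regular_coeff_reflect:
  assumes r: "regular_coeff b M r"
  shows "regular_coeff b M (\<lambda>x. r (b - x))"
  unfolding regular_coeff_def
proof (intro conjI ballI)
  fix x assume x: "x \<in> {0..b}"
  then have x': "b - x \<in> {0..b}" by auto
  show "0 < r (b - x)" by (rule regular_coeffD(3)[OF r x'])
  obtain r' where r': "(r has_real_derivative r') (at (b - x) within {0..b})" "\<bar>r'\<bar> \<le> M * r (b - x)"
    using r x' unfolding regular_coeff_def by blast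
  have "((\<lambda>x. b - x) has_real_derivative - 1) (at x within {0..b})"
    by (auto intro!: derivative_eq_intros)
  moreover have "(\<lambda>x. b - x) ` {0..b} = {0..b}" by simp
  ultimately have "(r \<circ> (\<lambda>x. b - x) has_real_derivative r' * - 1) (at x within {0..b})"
    using r'(1) by (intro DERIV_image_chain) simp_all
  then show "\<exists>r''. ((\<lambda>x. r (b - x)) has_real_derivative r'') (at x within {0..b}) \<and> \<bar>r''\<bar> \<le> M * r (b - x)"
    using r'(2) by (intro exI[of _ "r' * - 1"]) (auto simp: o_def)
qed (use regular_coeffD[OF r] in auto)

lemma travel_reflect:
  assumes r: "regular_coeff b M r" and x: "x \<in> {0..b}"
  shows "travel (\<lambda>x. r (b - x)) x = travel r b - travel r (b - x)"
proof -
  let ?h = "\<lambda>x. travel (\<lambda>x. r (b - x)) x + travel r (b - x)"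
  have "(?h has_real_derivative 0) (at x within {0..b})" if x: "x \<in> {0..b}" for x
  proof -
    have x': "b - x \<in> {0..b}" using x by auto
    have "((\<lambda>x. b - x) has_real_derivative - 1) (at x within {0..b})"
      by (auto intro!: derivative_eq_intros)
    moreover have "(\<lambda>x. b - x) ` {0..b} = {0..b}" by simp
    ultimately have "(travel r \<circ> (\<lambda>x. b - x) has_real_derivative sqrt (r (b - x)) * - 1) (at x within {0..b})"
      using travel_deriv[OF r x'] by (intro DERIV_image_chain) simp_all
    from DERIV_add[OF travel_deriv[OF regular_coeff_reflect[OF r] x] this]
    show ?thesis by (simp add: o_def)
  qed
  then obtain c where c: "\<And>x. x \<in> {0..b} \<Longrightarrow> ?h x = c"
    using has_field_derivative_zero_constant[of "{0..b}" ?h] by auto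
  have "?h x = ?h 0" using c[OF x] c[of 0] x by auto
  then show ?thesis by simp
qed

text \<open>The core of the uniqueness proof: the function \<open>G\<close> described at the beginning vanishes identically, and its
value at \<open>\<kappa> = 0\<close> is the difference of the two depths.\<close>

lemma equal_travel_imp_equal_depth:
  assumes r1: "regular_coeff b M1 \<rho>1" and r2: "regular_coeff b M2 \<rho>2"
    and end1: "\<rho>1 b = 1" "\<rho>2 b = 1"
    and same: "\<And>K. 0 < K \<Longrightarrow> ysol \<rho>1 0 1 (- of_real (K\<^sup>2)) b = ysol \<rho>2 0 1 (- of_real (K\<^sup>2)) b"
      "\<And>K. 0 < K \<Longrightarrow> zsol \<rho>1 0 1 (- of_real (K\<^sup>2)) b = zsol \<rho>2 0 1 (- of_real (K\<^sup>2)) b"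
    and \<xi>: "\<xi>1 \<in> {0..b}" "\<xi>2 \<in> {0..b}"
      "travel (\<lambda>x. \<rho>1 (b - x)) \<xi>1 = travel (\<lambda>x. \<rho>2 (b - x)) \<xi>2"
  shows "\<xi>1 = \<xi>2"
proof -
  define q1 where "q1 x = \<rho>1 (b - x)" for x
  define q2 where "q2 x = \<rho>2 (b - x)" for x
  have q: "regular_coeff b M1 q1" "regular_coeff b M2 q2"
    unfolding q1_def q2_def by (rule regular_coeff_reflect[OF r1], rule regular_coeff_reflect[OF r2])
  have b: "0 < b" by (rule regular_coeffD(1)[OF r1])
  define t where "t = travel q1 \<xi>1"
  have t: "travel q1 \<xi>1 = t" "travel q2 \<xi>2 = t" using \<xi>(3) by (auto simp: t_def q1_def[abs_def] q2_def[abs_def])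
  have t0: "0 \<le> t" using travel_nonneg[OF q(1) \<xi>(1)] t by simp
  define s1 where "s1 \<kappa> = ysol q1 0 1 \<kappa> \<xi>1" for \<kappa>
  define c1 where "c1 \<kappa> = ysol q1 1 0 \<kappa> \<xi>1" for \<kappa>
  define s2 where "s2 \<kappa> = ysol q2 0 1 \<kappa> \<xi>2" for \<kappa>
  define c2 where "c2 \<kappa> = ysol q2 1 0 \<kappa> \<xi>2" for \<kappa>
  define G where "G \<kappa> = s1 \<kappa> * c2 \<kappa> - c1 \<kappa> * s2 \<kappa>" for \<kappa>
  have holG: "G holomorphic_on UNIV"
    unfolding G_def s1_def c1_def s2_def c2_def
    by (intro holomorphic_intros solution_holomorphic[OF regular_coeffD(4)[OF q(1)] \<xi>(1)] solution_holomorphic[OF regular_coeffD(4)[OF q(2)] \<xi>(2)])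
  obtain C1 where C1: "0 < C1"
    "\<And>k. norm k * norm (s1 (k\<^sup>2)) \<le> C1 * exp (\<bar>Im k\<bar> * t)"
    "\<And>k. k \<noteq> 0 \<Longrightarrow> norm (c1 (k\<^sup>2)) \<le> C1 * exp (\<bar>Im k\<bar> * t)"
    using normalised_solution_growth[OF q(1)] \<xi>(1) unfolding s1_def c1_def t(1)[symmetric] by metis
  obtain C2 where C2: "0 < C2"
    "\<And>k. norm k * norm (s2 (k\<^sup>2)) \<le> C2 * exp (\<bar>Im k\<bar> * t)"
    "\<And>k. k \<noteq> 0 \<Longrightarrow> norm (c2 (k\<^sup>2)) \<le> C2 * exp (\<bar>Im k\<bar> * t)"
    using normalised_solution_growth[OF q(2)] \<xi>(2) unfolding s2_def c2_def t(2)[symmetric] by metis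
  have Gk: "norm (G (k\<^sup>2)) \<le> 2 * C1 * C2 * exp (\<bar>Im k\<bar> * t) * exp (\<bar>Im k\<bar> * t)" if k: "1 \<le> norm k" for k
  proof -
    have k0: "k \<noteq> 0" using k by auto
    have s: "norm (s1 (k\<^sup>2)) \<le> C1 * exp (\<bar>Im k\<bar> * t)" "norm (s2 (k\<^sup>2)) \<le> C2 * exp (\<bar>Im k\<bar> * t)"
      using order_trans[OF mult_right_mono[OF k] C1(2)[of k]] order_trans[OF mult_right_mono[OF k] C2(2)[of k]] by simp_all
    have "norm (G (k\<^sup>2)) \<le> norm (s1 (k\<^sup>2)) * norm (c2 (k\<^sup>2)) + norm (c1 (k\<^sup>2)) * norm (s2 (k\<^sup>2))"
      unfolding G_def by (metis norm_mult norm_triangle_ineq4)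
    also have "\<dots> \<le> (C1 * exp (\<bar>Im k\<bar> * t)) * (C2 * exp (\<bar>Im k\<bar> * t)) + (C1 * exp (\<bar>Im k\<bar> * t)) * (C2 * exp (\<bar>Im k\<bar> * t))"
      by (intro add_mono mult_mono s C1(3)[OF k0] C2(3)[OF k0]) (use C1(1) C2(1) in auto)
    finally show ?thesis by (simp add: mult_ac)
  qed
  have growth: "norm (G w) \<le> 2 * C1 * C2 * exp (2 * t) * exp (2 * t * sqrt (norm w))" for w
  proof (rule half_order_growth[OF holG])
    fix k :: complex assume k: "1 \<le> norm k"
    have "exp (\<bar>Im k\<bar> * t) * exp (\<bar>Im k\<bar> * t) \<le> exp (2 * t * norm k)"
    proof -
      have "\<bar>Im k\<bar> * t \<le> norm k * t" using abs_Im_le_cmod t0 by (intro mult_right_mono) auto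
      then show ?thesis by (simp flip: exp_add) (simp add: algebra_simps)
    qed
    then have "2 * C1 * C2 * (exp (\<bar>Im k\<bar> * t) * exp (\<bar>Im k\<bar> * t)) \<le> 2 * C1 * C2 * exp (2 * t * norm k)"
      using C1(1) C2(1) by (intro mult_left_mono) auto
    then show "norm (G (k\<^sup>2)) \<le> 2 * C1 * C2 * exp (2 * t * norm k)"
      using Gk[OF k] by (simp only: mult.assoc)
  qed (use t0 C1 C2 in auto)
  define D1 where "D1 = exp (M1 * b) / sqrt (\<rho>1 (b - \<xi>1))"
  define D2 where "D2 = exp (M2 * b) / sqrt (\<rho>2 (b - \<xi>2))"
  have \<xi>': "b - \<xi>1 \<in> {0..b}" "b - \<xi>2 \<in> {0..b}" using \<xi> by auto
  have rp: "0 < \<rho>1 (b - \<xi>1)" "0 < \<rho>2 (b - \<xi>2)"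
    using regular_coeffD(3)[OF r1 \<xi>'(1)] regular_coeffD(3)[OF r2 \<xi>'(2)] by simp_all
  have D: "0 < D1" "0 < D2" using rp by (simp_all add: D1_def D2_def)
  have Gneg: "norm (G (- of_real (K\<^sup>2))) \<le> 2 * (C1 * D2 + C2 * D1) / K" if K: "0 < K" for K
  proof -
    let ?\<kappa> = "- complex_of_real (K\<^sup>2)"
    define P where "P = ysol \<rho>1 0 1 ?\<kappa> b"
    define Q where "Q = zsol \<rho>1 0 1 ?\<kappa> b"
    define u where "u = Re Q + K * Re P"
    define f1 where "f1 = ysol \<rho>1 0 1 ?\<kappa> (b - \<xi>1)"
    define f2 where "f2 = ysol \<rho>2 0 1 ?\<kappa> (b - \<xi>2)"
    have P2: "P = ysol \<rho>2 0 1 ?\<kappa> b" "Q = zsol \<rho>2 0 1 ?\<kappa> b" using same K by (auto simp: P_def Q_def)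
    have cont: "continuous_on {0..b} \<rho>1" "continuous_on {0..b} \<rho>2" "continuous_on {0..b} q1" "continuous_on {0..b} q2"
      using regular_coeffD(4) r1 r2 q by auto
    have comb: "ysol \<rho> 0 1 w (b - \<xi>) = P * ysol q 1 0 w \<xi> + (- Q) * ysol q 0 1 w \<xi>"
      if c: "continuous_on {0..b} \<rho>" "continuous_on {0..b} q" "\<And>x. q x = \<rho> (b - x)"
        and PQ: "ysol \<rho> 0 1 w b = P" "zsol \<rho> 0 1 w b = Q" and \<xi>: "\<xi> \<in> {0..b}" for \<rho> q \<xi> w
    proof -
      have "solves b (\<lambda>x. \<rho> (b - x)) w (\<lambda>x. ysol \<rho> 0 1 w (b - x)) (\<lambda>x. - zsol \<rho> 0 1 w (b - x))"
        by (rule solves_reflect[OF solves_ysol[OF c(1)]]) (use b in simp)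
      then have S1: "solves b q w (\<lambda>x. ysol \<rho> 0 1 w (b - x)) (\<lambda>x. - zsol \<rho> 0 1 w (b - x))"
        by (simp flip: c(3))
      have S2: "solves b q w (\<lambda>x. P * ysol q 1 0 w x + (- Q) * ysol q 0 1 w x)
          (\<lambda>x. P * zsol q 1 0 w x + (- Q) * zsol q 0 1 w x)"
        by (rule solves_linear_combination; rule solves_ysol[OF c(2)]) (use b in simp_all)
      show ?thesis
        by (rule solves_unique(1)[OF c(2) S1 S2 _ _ \<xi>]) (simp_all add: ysol_0 zsol_0 PQ)
    qed
    \<comment> \<open>reflection reverses the sign of the derivative, so \<open>\<phi>\<^sub>j\<close> has data \<open>(P, - Q)\<close> at depth 0\<close>
    have f1: "f1 = P * c1 ?\<kappa> - Q * s1 ?\<kappa>"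
      using comb[OF cont(1,3) q1_def P_def[symmetric] Q_def[symmetric] \<xi>(1)] by (simp add: f1_def c1_def s1_def)
    have f2: "f2 = P * c2 ?\<kappa> - Q * s2 ?\<kappa>"
      using comb[OF cont(2,4) q2_def P2[symmetric] \<xi>(2)] by (simp add: f2_def c2_def s2_def)
    \<comment> \<open>the combination \<open>c\<^sub>j + K s\<^sub>j\<close> produces on the left the quantity \<open>u(b)\<close> against which the decay of \<open>\<phi>\<^sub>j\<close> is measured\<close>
    have key: "(Q + of_real K * P) * G ?\<kappa>
        = (c1 ?\<kappa> + of_real K * s1 ?\<kappa>) * f2 - (c2 ?\<kappa> + of_real K * s2 ?\<kappa>) * f1"
      unfolding f1 f2 G_def by (simp add: algebra_simps)
    have tr: "travel \<rho>1 b - travel \<rho>1 (b - \<xi>1) = t" "travel \<rho>2 b - travel \<rho>2 (b - \<xi>2) = t"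
      using travel_reflect[OF r1 \<xi>(1)] travel_reflect[OF r2 \<xi>(2)] t
      by (simp_all add: q1_def[abs_def] q2_def[abs_def])
    have fb1: "K * sqrt (\<rho>1 (b - \<xi>1)) * norm f1 \<le> exp (M1 * b) * exp (- K * t) * u" and u0: "0 < u"
      using positive_solution_growth[OF r1 K \<xi>'(1)] unfolding tr end1 f1_def u_def P_def Q_def by simp_all
    have fb2: "K * sqrt (\<rho>2 (b - \<xi>2)) * norm f2 \<le> exp (M2 * b) * exp (- K * t) * u"
      using positive_solution_growth(1)[OF r2 K \<xi>'(2)] unfolding tr end1 f2_def u_def P2 by simp
    have n1: "norm f1 \<le> D1 * exp (- K * t) * u / K" and n2: "norm f2 \<le> D2 * exp (- K * t) * u / K"
      using fb1 fb2 K rp by (simp_all add: D1_def D2_def field_simps)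
    have kk: "?\<kappa> = (\<i> * of_real K)\<^sup>2" by (simp add: power_mult_distrib)
    have e1: "norm (c1 ?\<kappa> + of_real K * s1 ?\<kappa>) \<le> 2 * C1 * exp (K * t)"
      using norm_triangle_ineq[of "c1 ?\<kappa>" "of_real K * s1 ?\<kappa>"] C1(2,3)[of "\<i> * of_real K"] K
      unfolding kk[symmetric] by (simp add: norm_mult)
    have e2: "norm (c2 ?\<kappa> + of_real K * s2 ?\<kappa>) \<le> 2 * C2 * exp (K * t)"
      using norm_triangle_ineq[of "c2 ?\<kappa>" "of_real K * s2 ?\<kappa>"] C2(2,3)[of "\<i> * of_real K"] K
      unfolding kk[symmetric] by (simp add: norm_mult)
    have "u * norm (G ?\<kappa>) \<le> norm (Q + of_real K * P) * norm (G ?\<kappa>)"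
      using abs_Re_le_cmod[of "Q + of_real K * P"] by (intro mult_right_mono) (auto simp: u_def)
    also have "\<dots> \<le> norm (c1 ?\<kappa> + of_real K * s1 ?\<kappa>) * norm f2 + norm (c2 ?\<kappa> + of_real K * s2 ?\<kappa>) * norm f1"
      unfolding norm_mult[symmetric] key by (rule norm_triangle_ineq4)
    also have "\<dots> \<le> (2 * C1 * exp (K * t)) * (D2 * exp (- K * t) * u / K) + (2 * C2 * exp (K * t)) * (D1 * exp (- K * t) * u / K)"
      by (intro add_mono mult_mono e1 e2 n1 n2) (use C1(1) C2(1) in auto)
    also have "\<dots> = u * (2 * (C1 * D2 + C2 * D1) / K)"
      using K by (simp add: exp_minus field_simps)
    finally show ?thesis using u0 by (rule mult_left_le_imp_le)
  qed
  have "G w = 0" for w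
  proof (rule entire_half_order_bounded_real_vanishes[OF holG growth])
    define B where "B = 2 * C1 * C2 + 2 * (C1 * D2 + C2 * D1) + 2 * C1 * C2 * exp (2 * t) * exp (2 * t)"
    have nn: "0 \<le> 2 * C1 * C2" "0 \<le> 2 * (C1 * D2 + C2 * D1)" "0 \<le> 2 * C1 * C2 * exp (2 * t) * exp (2 * t)"
      using C1(1) C2(1) D by auto
    fix x :: real
    consider "1 \<le> x" | "x \<le> -1" | "\<bar>x\<bar> \<le> 1" by linarith
    then show "norm (G (of_real x)) \<le> B"
    proof cases
      case 1
      then have "of_real x = (complex_of_real (sqrt x))\<^sup>2" by (simp flip: of_real_power)
      moreover have "norm (G ((complex_of_real (sqrt x))\<^sup>2)) \<le> 2 * C1 * C2"
        using Gk[of "of_real (sqrt x)"] 1 by simp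
      ultimately have "norm (G (of_real x)) \<le> 2 * C1 * C2" by simp
      then show ?thesis unfolding B_def using nn by linarith
    next
      case 2
      define K where "K = sqrt (- x)"
      have K: "1 \<le> K" "of_real x = - complex_of_real (K\<^sup>2)" using 2 by (auto simp: K_def)
      have "norm (G (of_real x)) \<le> 2 * (C1 * D2 + C2 * D1) / K" unfolding K(2) by (rule Gneg) (use K in simp)
      also have "\<dots> \<le> 2 * (C1 * D2 + C2 * D1) / 1" by (rule divide_left_mono) (use K nn in auto)
      finally show ?thesis unfolding B_def using nn by linarith
    next
      case 3
      have "norm (G (of_real x)) \<le> 2 * C1 * C2 * exp (2 * t) * exp (2 * t * sqrt (norm (complex_of_real x)))" by (rule growth)
      also have "\<dots> \<le> 2 * C1 * C2 * exp (2 * t) * exp (2 * t * 1)"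
        using 3 t0 C1(1) C2(1) by (intro mult_left_mono) (auto intro!: mult_left_le)
      finally show ?thesis unfolding B_def using nn by simp
    qed
  next
    have ev: "eventually (\<lambda>x::real. norm (G (of_real x)) \<le> 2 * (C1 * D2 + C2 * D1) / sqrt (- x)) at_bot"
      using eventually_gt_at_bot[of 0]
    proof eventually_elim
      case (elim x)
      then have "of_real x = - complex_of_real ((sqrt (- x))\<^sup>2)" by simp
      then show ?case using Gneg[of "sqrt (- x)"] elim by simp
    qed
    have "filterlim (\<lambda>x::real. sqrt (- x)) at_top at_bot" by real_asymp
    then have "((\<lambda>x::real. 2 * (C1 * D2 + C2 * D1) / sqrt (- x)) \<longlongrightarrow> 0) at_bot"
      by (intro tendsto_divide_0[OF tendsto_const] filterlim_at_top_imp_at_infinity)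
    then show "((\<lambda>x::real. G (of_real x)) \<longlongrightarrow> 0) at_bot"
      by (rule Lim_null_comparison[OF ev])
  qed
  from this[of 0] show ?thesis by (simp add: G_def s1_def c1_def s2_def c2_def ysol_zero_parameter)
qed

text \<open>If the travel times to the same depth differed, the intermediate value theorem would give two different depths
with the same travel time.  So the travel times agree as functions, and so do their derivatives \<open>sqrt \<rho>\<close>.\<close>

theorem coefficient_determined_by_boundary_data:
  assumes r1: "regular_coeff b M1 \<rho>1" and r2: "regular_coeff b M2 \<rho>2"
    and end1: "\<rho>1 b = 1" "\<rho>2 b = 1"
    and same: "\<And>K. 0 < K \<Longrightarrow> ysol \<rho>1 0 1 (- of_real (K\<^sup>2)) b = ysol \<rho>2 0 1 (- of_real (K\<^sup>2)) b"
      "\<And>K. 0 < K \<Longrightarrow> zsol \<rho>1 0 1 (- of_real (K\<^sup>2)) b = zsol \<rho>2 0 1 (- of_real (K\<^sup>2)) b"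
    and x: "x \<in> {0..b}"
  shows "\<rho>1 x = \<rho>2 x"
proof -
  define q1 where "q1 x = \<rho>1 (b - x)" for x
  define q2 where "q2 x = \<rho>2 (b - x)" for x
  have q: "regular_coeff b M1 q1" "regular_coeff b M2 q2"
    unfolding q1_def q2_def by (rule regular_coeff_reflect[OF r1], rule regular_coeff_reflect[OF r2])
  have b: "0 < b" by (rule regular_coeffD(1)[OF r1])
  have dep: "\<xi>1 = \<xi>2" if "\<xi>1 \<in> {0..b}" "\<xi>2 \<in> {0..b}" "travel q1 \<xi>1 = travel q2 \<xi>2" for \<xi>1 \<xi>2
    using equal_travel_imp_equal_depth[OF r1 r2 end1 same that(1,2)] that(3)
    by (simp add: q1_def[abs_def] q2_def[abs_def])
  have tc: "continuous_on {0..b} (travel q)" if "regular_coeff b M q" for M q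
    by (rule DERIV_continuous_on[OF travel_deriv[OF that]])
  have ivt: "\<exists>\<eta>\<in>{0..\<xi>}. travel q \<eta> = s" if q: "regular_coeff b M q" and \<xi>: "\<xi> \<in> {0..b}" and s: "0 \<le> s" "s \<le> travel q \<xi>" for M q \<xi> s
  proof -
    have "continuous_on {0..\<xi>} (travel q)"
      by (rule continuous_on_subset[OF tc[OF q]]) (use \<xi> in auto)
    then have "\<exists>\<eta>\<ge>0. \<eta> \<le> \<xi> \<and> travel q \<eta> = s" by (intro IVT') (use s \<xi> in simp_all)
    then show ?thesis by (metis atLeastAtMost_iff)
  qed
  have eq: "travel q1 \<xi> = travel q2 \<xi>" if \<xi>: "\<xi> \<in> {0..b}" for \<xi>
  proof (cases "travel q1 \<xi> \<le> travel q2 \<xi>")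
    case True
    then obtain \<eta> where \<eta>: "\<eta> \<in> {0..\<xi>}" "travel q2 \<eta> = travel q1 \<xi>"
      using ivt[OF q(2) \<xi> travel_nonneg[OF q(1) \<xi>]] by blast
    have "\<xi> = \<eta>" by (rule dep[rotated 2]) (use \<xi> \<eta> in auto)
    then show ?thesis using \<eta> by simp
  next
    case False
    then obtain \<eta> where \<eta>: "\<eta> \<in> {0..\<xi>}" "travel q1 \<eta> = travel q2 \<xi>"
      using ivt[OF q(1) \<xi> travel_nonneg[OF q(2) \<xi>]] by auto
    have "\<eta> = \<xi>" by (rule dep[rotated 2]) (use \<xi> \<eta> in auto)
    then show ?thesis using \<eta> by simp
  qed
  have \<xi>: "b - x \<in> {0..b}" using x by auto
  have d: "(travel q1 has_vector_derivative sqrt (q1 (b - x))) (at (b - x) within {0..b})"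
    "(travel q2 has_vector_derivative sqrt (q2 (b - x))) (at (b - x) within {0..b})"
    using travel_deriv[OF q(1) \<xi>] travel_deriv[OF q(2) \<xi>]
    by (simp_all add: has_real_derivative_iff_has_vector_derivative)
  have "(travel q2 has_vector_derivative sqrt (q1 (b - x))) (at (b - x) within {0..b})"
    by (rule has_vector_derivative_transform[OF \<xi> _ d(1)]) (use eq in simp)
  then have "sqrt (q1 (b - x)) = sqrt (q2 (b - x))"
    using vector_derivative_unique_within_closed_interval[OF b, of "b - x" "travel q2", unfolded box_real] \<xi> d(2)
    by blast
  then show ?thesis by (simp add: q1_def q2_def)
qed

section \<open>Radial functions in the ball\<close>

lemma C2_line_derivatives:
  fixes f :: "'a::euclidean_space \<Rightarrow> complex"
  assumes f': "\<And>x. x \<in> S \<Longrightarrow> (f has_derivative blinfun_apply (f' x)) (at x)"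
    and f'': "\<And>x. x \<in> S \<Longrightarrow> (f' has_derivative blinfun_apply (f'' x)) (at x)"
    and x: "x + t *\<^sub>R i \<in> S"
  shows "((\<lambda>s. f (x + s *\<^sub>R i)) has_vector_derivative f' (x + t *\<^sub>R i) i) (at t)"
    and "((\<lambda>s. f' (x + s *\<^sub>R i) j) has_vector_derivative f'' (x + t *\<^sub>R i) i j) (at t)"
proof -
  have l: "((\<lambda>s. x + s *\<^sub>R i) has_derivative (\<lambda>h. h *\<^sub>R i)) (at t)"
    by (auto intro!: derivative_eq_intros)
  show "((\<lambda>s. f (x + s *\<^sub>R i)) has_vector_derivative f' (x + t *\<^sub>R i) i) (at t)"
    using has_derivative_compose[OF l f'[OF x]]
    by (simp add: has_vector_derivative_def blinfun.scaleR_right)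
  have "((\<lambda>s. f' (x + s *\<^sub>R i)) has_derivative (\<lambda>h. f'' (x + t *\<^sub>R i) (h *\<^sub>R i))) (at t)"
    by (rule has_derivative_compose[OF l f''[OF x]])
  from bounded_linear.has_derivative[OF blinfun.bounded_linear_left this, of j]
  show "((\<lambda>s. f' (x + s *\<^sub>R i) j) has_vector_derivative f'' (x + t *\<^sub>R i) i j) (at t)"
    by (simp add: has_vector_derivative_def blinfun.scaleR_right blinfun.scaleR_left)
qed

lemma laplacian_C2:
  fixes f :: "'a::euclidean_space \<Rightarrow> complex"
  assumes S: "open S" and f': "\<And>x. x \<in> S \<Longrightarrow> (f has_derivative blinfun_apply (f' x)) (at x)"
    and f'': "\<And>x. x \<in> S \<Longrightarrow> (f' has_derivative blinfun_apply (f'' x)) (at x)"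
    and x: "x \<in> S"
  shows "laplacian f x = (\<Sum>i\<in>Basis. f'' x i i)"
  unfolding laplacian_def
proof (rule sum.cong[OF refl])
  fix i :: 'a
  let ?T = "(\<lambda>s. x + s *\<^sub>R i) -` S"
  have T: "open ?T" by (intro open_vimage[OF S] continuous_intros)
  have "((\<lambda>t. f' (x + t *\<^sub>R i) i) has_vector_derivative f'' (x + 0 *\<^sub>R i) i i) (at 0)"
    by (rule C2_line_derivatives(2)[where S=S, OF f' f'']) (use x in auto)
  then have "((\<lambda>t. vector_derivative (\<lambda>s. f (x + s *\<^sub>R i)) (at t)) has_vector_derivative f'' (x + 0 *\<^sub>R i) i i) (at 0)"
  proof (rule has_vector_derivative_transform_within_open[OF _ T])
    show "0 \<in> ?T" using x by simp
    fix t assume "t \<in> ?T"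
    then have "((\<lambda>s. f (x + s *\<^sub>R i)) has_vector_derivative f' (x + t *\<^sub>R i) i) (at t)"
      by (intro C2_line_derivatives(1)[where S=S, OF f' f'']) auto
    then show "f' (x + t *\<^sub>R i) i = vector_derivative (\<lambda>s. f (x + s *\<^sub>R i)) (at t)"
      by (simp add: vector_derivative_at)
  qed
  then show "vector_derivative (\<lambda>t. vector_derivative (\<lambda>s. f (x + s *\<^sub>R i)) (at t)) (at 0) = f'' x i i"
    by (simp add: vector_derivative_at)
qed

text \<open>Along a line orthogonal to the ray, \<open>f\<close> is the radial profile evaluated at \<open>sqrt (t\<^sup>2 + s\<^sup>2)\<close>.  Its derivative
is \<open>s\<close> times a differentiable function of \<open>s\<close>, whose value at \<open>s = 0\<close> is the second derivative.\<close>

lemma radial_tangential_second_derivative: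
  fixes f :: "'a::euclidean_space \<Rightarrow> complex"
  assumes f': "\<And>x. x \<in> ball 0 b \<Longrightarrow> (f has_derivative blinfun_apply (f' x)) (at x)"
    and f'': "\<And>x. x \<in> ball 0 b \<Longrightarrow> (f' has_derivative blinfun_apply (f'' x)) (at x)"
    and sym: "\<And>x y. x \<in> ball 0 b \<Longrightarrow> y \<in> ball 0 b \<Longrightarrow> norm x = norm y \<Longrightarrow> f x = f y"
    and e: "e \<in> Basis" "i \<in> Basis" "i \<noteq> e" and t: "0 < t" "t < b"
  shows "f'' (t *\<^sub>R e) i i = f' (t *\<^sub>R e) e /\<^sub>R t"
proof -
  define \<sigma> where "\<sigma> s = sqrt (t\<^sup>2 + s\<^sup>2)" for s
  define u1 where "u1 s = f' (0 + s *\<^sub>R e) e" for s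
  define v where "v s = inverse (\<sigma> s) *\<^sub>R u1 (\<sigma> s)" for s
  have ne: "norm (s *\<^sub>R e) = \<bar>s\<bar>" for s using e by simp
  have \<sigma>: "0 < \<sigma> s" for s using t by (auto simp: \<sigma>_def add_pos_nonneg)
  have n: "norm (t *\<^sub>R e + s *\<^sub>R i) = \<sigma> s" for s
  proof -
    have "e \<bullet> i = 0" using e by (metis inner_not_same_Basis)
    then have "(norm (t *\<^sub>R e + s *\<^sub>R i))\<^sup>2 = t\<^sup>2 + s\<^sup>2"
      unfolding power2_norm_eq_inner using e by (simp add: inner_add inner_commute power2_eq_square)
    then show ?thesis unfolding \<sigma>_def by (metis norm_ge_zero real_sqrt_unique)
  qed
  have n': "norm (0 + \<sigma> s *\<^sub>R e) = \<sigma> s" for s using e \<sigma>[of s] by simp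
  have \<sigma>': "(\<sigma> has_vector_derivative s / \<sigma> s) (at s)" for s
  proof -
    have "(\<sigma> has_real_derivative s / \<sigma> s) (at s)"
    proof -
      have "((\<lambda>s. t\<^sup>2 + s\<^sup>2) has_real_derivative 2 * s) (at s)"
        by (auto intro!: derivative_eq_intros)
      moreover have "0 < t\<^sup>2 + s\<^sup>2" using t by (simp add: add_pos_nonneg)
      ultimately have "((\<lambda>s. sqrt (t\<^sup>2 + s\<^sup>2)) has_real_derivative inverse (sqrt (t\<^sup>2 + s\<^sup>2)) / 2 * (2 * s)) (at s)"
        by (intro DERIV_chain2[OF DERIV_real_sqrt])
      moreover have "inverse w / 2 * (2 * s) = s / w" for w :: real by (cases "w = 0") (simp_all add: field_simps)
      ultimately show ?thesis unfolding \<sigma>_def[abs_def] by simp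
    qed
    then show ?thesis by (simp add: has_real_derivative_iff_has_vector_derivative)
  qed
  define T where "T = {s. \<sigma> s < b}"
  have T: "open T" "0 \<in> T"
    unfolding T_def using t by (auto simp: \<sigma>_def intro!: open_Collect_less continuous_intros)
  have first: "f' (t *\<^sub>R e + s *\<^sub>R i) i = s *\<^sub>R v s" if s: "s \<in> T" for s
  proof -
    have "((\<lambda>s. f (t *\<^sub>R e + s *\<^sub>R i)) has_vector_derivative f' (t *\<^sub>R e + s *\<^sub>R i) i) (at s)"
      by (rule C2_line_derivatives(1)[where S="ball 0 b", OF f' f'']) (use s n in \<open>auto simp: T_def\<close>)
    moreover have "((\<lambda>s. f (t *\<^sub>R e + s *\<^sub>R i)) has_vector_derivative (s / \<sigma> s) *\<^sub>R u1 (\<sigma> s)) (at s)"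
    proof (rule has_vector_derivative_transform_within_open[OF _ T(1) s])
      have "((\<lambda>s. f (0 + s *\<^sub>R e)) has_vector_derivative u1 (\<sigma> s)) (at (\<sigma> s))"
        unfolding u1_def by (rule C2_line_derivatives(1)[where S="ball 0 b", OF f' f'']) (use s n' in \<open>auto simp: T_def\<close>)
      from vector_diff_chain_at[OF \<sigma>' this]
      show "((\<lambda>s. f (0 + \<sigma> s *\<^sub>R e)) has_vector_derivative (s / \<sigma> s) *\<^sub>R u1 (\<sigma> s)) (at s)"
        by (simp add: o_def)
      show "f (0 + \<sigma> r *\<^sub>R e) = f (t *\<^sub>R e + r *\<^sub>R i)" if "r \<in> T" for r
        by (rule sym) (use that n[of r] n'[of r] in \<open>auto simp: T_def\<close>)
    qed
    ultimately show ?thesis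
      by (simp add: v_def divide_inverse vector_derivative_unique_at)
  qed
  obtain v' where v': "(v has_vector_derivative v') (at 0)"
  proof -
    have 1: "(u1 has_vector_derivative f'' (0 + \<sigma> 0 *\<^sub>R e) e e) (at (\<sigma> 0))"
      unfolding u1_def[abs_def] by (rule C2_line_derivatives(2)[where S="ball 0 b", OF f' f'']) (use T n' in \<open>auto simp: T_def\<close>)
    have 2: "(u1 \<circ> \<sigma> has_vector_derivative (0 / \<sigma> 0) *\<^sub>R f'' (0 + \<sigma> 0 *\<^sub>R e) e e) (at 0)"
      by (rule vector_diff_chain_at[OF \<sigma>' 1])
    have 3: "((\<lambda>s. inverse (\<sigma> s)) has_real_derivative - (inverse (\<sigma> 0) * (0 / \<sigma> 0) * inverse (\<sigma> 0))) (at 0)"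
      by (rule DERIV_inverse') (use \<sigma>'[of 0] \<sigma>[of 0] in \<open>auto simp: has_real_derivative_iff_has_vector_derivative\<close>)
    from has_vector_derivative_scaleR[OF 3 2] show thesis
      by (intro that) (simp add: v_def[abs_def] o_def)
  qed
  have "((\<lambda>s. s *\<^sub>R v s) has_vector_derivative v 0) (at 0)"
    using has_vector_derivative_scaleR[OF DERIV_ident v'] by simp
  then have "((\<lambda>s. f' (t *\<^sub>R e + s *\<^sub>R i) i) has_vector_derivative v 0) (at 0)"
    by (rule has_vector_derivative_transform_within_open[OF _ T]) (simp add: first)
  moreover have "((\<lambda>s. f' (t *\<^sub>R e + s *\<^sub>R i) i) has_vector_derivative f'' (t *\<^sub>R e + 0 *\<^sub>R i) i i) (at 0)"
    by (rule C2_line_derivatives(2)[where S="ball 0 b", OF f' f'']) (use t e in auto)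
  ultimately have "f'' (t *\<^sub>R e) i i = v 0" by (simp add: vector_derivative_unique_at)
  also have "\<sigma> 0 = t" using t by (simp add: \<sigma>_def)
  then have "v 0 = f' (t *\<^sub>R e) e /\<^sub>R t" by (simp add: v_def u1_def)
  finally show ?thesis .
qed

text \<open>The Laplacian of a radial function in three dimensions is \<open>u'' + 2 u' / t\<close>, and \<open>t (u'' + 2 u' / t) = (t u)''\<close>.  The
normal derivative \<open>d\<close> at the sphere supplies the derivative of \<open>t u\<close> at \<open>b\<close>.\<close>

lemma radial_laplacian_to_ode:
  fixes \<Psi> :: "real^3 \<Rightarrow> complex" and e :: "real^3"
  assumes b: "0 < b" and r: "continuous_on {0..b} r" and cont: "continuous_on (cball 0 b) \<Psi>"
    and C2: "C2_on \<Psi> (ball 0 b)" and sym: "spherically_symmetric_on \<Psi> (cball 0 b)"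
    and eq: "\<And>x. x \<in> ball 0 b \<Longrightarrow> laplacian \<Psi> x + \<kappa> * of_real (r (norm x)) * \<Psi> x = 0"
    and e: "e \<in> Basis" and nd: "has_outward_normal_derivative b \<Psi> d (b *\<^sub>R e)"
  obtains w where "solves b r \<kappa> (\<lambda>t. of_real t * \<Psi> (t *\<^sub>R e)) w" "w 0 = \<Psi> 0"
    "w b = \<Psi> (b *\<^sub>R e) + of_real b * d"
proof -
  obtain f' f'' where f': "\<And>x. x \<in> ball 0 b \<Longrightarrow> (\<Psi> has_derivative blinfun_apply (f' x)) (at x)"
    and f'': "\<And>x. x \<in> ball 0 b \<Longrightarrow> (f' has_derivative blinfun_apply (f'' x)) (at x)"
    using C2 unfolding C2_on_def by metis
  have sy: "\<Psi> x = \<Psi> y" if "x \<in> ball 0 b" "y \<in> ball 0 b" "norm x = norm y" for x y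
    using sym that unfolding spherically_symmetric_on_def by auto
  define u where "u t = \<Psi> (t *\<^sub>R e)" for t
  define u1 where "u1 t = f' (t *\<^sub>R e) e" for t
  define u2 where "u2 t = f'' (t *\<^sub>R e) e e" for t
  have ne: "norm (s *\<^sub>R e) = \<bar>s\<bar>" for s using e by simp
  have u': "(u has_vector_derivative u1 t) (at t)" and u'': "(u1 has_vector_derivative u2 t) (at t)"
    if "\<bar>t\<bar> < b" for t
    using C2_line_derivatives(1)[where S="ball 0 b", OF f' f'', where x=0 and t=t and i=e]
      C2_line_derivatives(2)[where S="ball 0 b", OF f' f'', where x=0 and t=t and i=e and j=e] that e unfolding u_def[abs_def] u1_def[abs_def] u2_def by simp_all
  let ?y = "\<lambda>t. of_real t * u t" and ?z = "\<lambda>t. u t + of_real t * u1 t"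
  have idt: "((\<lambda>t. complex_of_real t) has_vector_derivative 1) (at t within X)" for t X
    by (rule has_vector_derivative_of_real[OF DERIV_ident, unfolded of_real_1])
  have y': "(?y has_vector_derivative ?z t) (at t)" if "\<bar>t\<bar> < b" for t
    using has_vector_derivative_mult[OF idt u'[OF that]] by (simp add: add.commute)
  have z': "(?z has_vector_derivative 2 * u1 t + of_real t * u2 t) (at t)" if "\<bar>t\<bar> < b" for t
    using has_vector_derivative_add[OF u'[OF that] has_vector_derivative_mult[OF idt u''[OF that]]]
    by (simp add: algebra_simps)
  have ode: "2 * u1 t + of_real t * u2 t = - (\<kappa> * of_real (r t) * ?y t)" if t: "t \<in> {0<..<b}" for t
  proof -
    have x: "t *\<^sub>R e \<in> ball 0 b" using t e by simp
    have "laplacian \<Psi> (t *\<^sub>R e) = (\<Sum>i\<in>Basis. f'' (t *\<^sub>R e) i i)"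
      by (rule laplacian_C2[OF open_ball f' f'' x])
    also have "\<dots> = u2 t + (\<Sum>i\<in>Basis - {e}. f'' (t *\<^sub>R e) i i)"
      using e by (simp add: sum.remove[of _ e] u2_def)
    also have "(\<Sum>i\<in>Basis - {e}. f'' (t *\<^sub>R e) i i) = (\<Sum>i\<in>Basis - {e}. u1 t /\<^sub>R t)"
    proof (rule sum.cong[OF refl])
      fix i assume "i \<in> Basis - {e}"
      then show "f'' (t *\<^sub>R e) i i = u1 t /\<^sub>R t" unfolding u1_def
        by (intro radial_tangential_second_derivative[OF f' f'' sy e]) (use t in auto)
    qed
    also have "\<dots> = 2 * (u1 t / of_real t)"
      using e by (simp add: card_Diff_singleton scaleR_conv_of_real divide_inverse mult.commute)
    finally have "u2 t + 2 * (u1 t / of_real t) + \<kappa> * of_real (r t) * u t = 0"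
      using eq[OF x] t e by (simp add: u_def)
    then have "of_real t * (u2 t + 2 * (u1 t / of_real t) + \<kappa> * of_real (r t) * u t) = 0" by simp
    then have "(2 * u1 t + of_real t * u2 t) + \<kappa> * of_real (r t) * ?y t = 0"
      using t by (simp add: algebra_simps)
    then show ?thesis by (simp add: add_eq_0_iff)
  qed
  have uc: "continuous_on {0..b} u"
    unfolding u_def[abs_def]
    by (rule continuous_on_compose2[OF cont]) (use e in \<open>auto intro!: continuous_intros\<close>)
  obtain w where w: "solves b r \<kappa> ?y w" "w 0 = ?z 0"
  proof (rule solves_of_interior[OF b r])
    show "continuous_on {0..b} ?y" by (intro continuous_intros uc)
    show "(?y has_vector_derivative ?z x) (at x within {0..b})" if "x \<in> {0..<b}" for x
      by (rule has_vector_derivative_at_within[OF y']) (use that in auto)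
    show "continuous_on {0..<b} ?z"
      by (rule continuous_on_vector_derivative, rule has_vector_derivative_at_within[OF z']) auto
    show "(?z has_vector_derivative - (\<kappa> * of_real (r x) * ?y x)) (at x)" if "x \<in> {0<..<b}" for x
      using z'[of x] ode[OF that] that by simp
  qed blast
  have "(u has_vector_derivative d) (at b within {0..b})"
  proof -
    have "((\<lambda>t. \<Psi> (b *\<^sub>R e + t *\<^sub>R (b *\<^sub>R e /\<^sub>R b))) has_vector_derivative d) (at 0 within {..0})"
      using nd unfolding has_outward_normal_derivative_def .
    moreover have "b *\<^sub>R e + t *\<^sub>R (b *\<^sub>R e /\<^sub>R b) = (b + t) *\<^sub>R e" for t
      using b by (simp add: algebra_simps)
    ultimately have "((\<lambda>t. u (b + t)) has_vector_derivative d) (at 0 within {..0})" by (simp add: u_def)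
    then have "((\<lambda>t. u (b + t)) has_vector_derivative d) (at (b - b) within (\<lambda>t. t - b) ` {0..b})"
      using has_vector_derivative_within_subset[of "\<lambda>t. u (b + t)" d 0 "{..0}" "(\<lambda>t. t - b) ` {0..b}"] by auto
    moreover have "((\<lambda>t. t - b) has_vector_derivative 1) (at b within {0..b})"
      by (auto intro!: derivative_eq_intros)
    ultimately show ?thesis
      using vector_diff_chain_within[of "\<lambda>t. t - b" 1 b "{0..b}" "\<lambda>t. u (b + t)" d] by (simp add: o_def)
  qed
  then have "(?y has_vector_derivative u b + of_real b * d) (at b within {0..b})"
    using has_vector_derivative_mult[OF idt, of u d b "{0..b}"] by (simp add: add.commute)
  moreover have "(?y has_vector_derivative w b) (at b within {0..b})"
    using w(1) b unfolding solves_def by auto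
  ultimately have "w b = u b + of_real b * d"
    using vector_derivative_unique_within_closed_interval[of 0 b b, unfolded box_real] b by auto
  then show thesis using w by (intro that[of w]) (simp_all add: u_def)
qed

text \<open>The functional \<open>h \<mapsto> (h \<bullet> x) c\<close>.  The gradient of a radial function is of this form with \<open>c = u'(|x|) / |x|\<close>, and
bilinearity in \<open>c\<close> and \<open>x\<close> lets the product rule give the Hessian.\<close>

definition scaled_inner :: "complex \<Rightarrow> 'a::euclidean_space \<Rightarrow> 'a \<Rightarrow>\<^sub>L complex" where
  "scaled_inner c x = blinfun_scaleR_left c o\<^sub>L blinfun_inner_left x"

lemma scaled_inner_apply [simp]: "scaled_inner c x h = (h \<bullet> x) *\<^sub>R c"
  by (simp add: scaled_inner_def)

lemma bounded_bilinear_scaled_inner: "bounded_bilinear scaled_inner"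
  unfolding scaled_inner_def
  by (intro bounded_bilinear.comp[OF bounded_bilinear_blinfun_compose]
      bounded_linear_blinfun_scaleR_left bounded_linear_blinfun_inner_left)

interpretation scaled_inner: bounded_bilinear scaled_inner
  by (rule bounded_bilinear_scaled_inner)

lemma scaled_inner_derivative_at_0:
  fixes g :: "'a::euclidean_space \<Rightarrow> complex"
  assumes "isCont g 0"
  shows "((\<lambda>x. scaled_inner (g x) x) has_derivative (\<lambda>h. scaled_inner (g 0) h)) (at 0)"
proof -
  obtain K where K: "\<And>a x. norm (scaled_inner a x :: 'a \<Rightarrow>\<^sub>L complex) \<le> norm a * norm x * K"
    using scaled_inner.bounded by blast
  show ?thesis unfolding has_derivative_at
  proof (intro conjI scaled_inner.bounded_linear_right)
    have "(g \<longlongrightarrow> g 0) (at 0)" using assms by (simp add: isCont_def)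
    then have "((\<lambda>h. norm (g h - g 0) * K) \<longlongrightarrow> norm (g 0 - g 0) * K) (at 0)"
      by (intro tendsto_intros)
    then have lim: "((\<lambda>h. norm (g h - g 0) * K) \<longlongrightarrow> 0) (at 0)" by simp
    have le: "norm (norm (scaled_inner (g (0 + h)) (0 + h) - scaled_inner (g 0) 0 - scaled_inner (g 0) h) / norm h)
        \<le> norm (g h - g 0) * K" if h: "h \<noteq> 0" for h :: 'a
    proof -
      have "scaled_inner (g (0 + h)) (0 + h) - scaled_inner (g 0) 0 - scaled_inner (g 0) h = scaled_inner (g h - g 0) h"
        by (simp add: scaled_inner.diff_left scaled_inner.zero_right)
      then show ?thesis using K[of "g h - g 0" h] h by (simp add: pos_divide_le_eq mult_ac)
    qed
    have "\<forall>\<^sub>F h in at 0. norm (norm (scaled_inner (g (0 + h)) (0 + h) - scaled_inner (g 0) 0 - scaled_inner (g 0) h) / norm h)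
        \<le> norm (g h - g 0) * K"
      unfolding eventually_at_filter using le by (intro always_eventually) blast
    then show "(\<lambda>h. norm (scaled_inner (g (0 + h)) (0 + h) - scaled_inner (g 0) 0 - scaled_inner (g 0) h) / norm h) \<midarrow>0\<rightarrow> 0"
      by (rule Lim_null_comparison[OF _ lim])
  qed
qed

text \<open>The regularity at the centre.  The profile \<open>U = y / t\<close> satisfies \<open>U' = t v\<close> with \<open>v = (t z - y) / t\<^sup>3\<close>.  As
\<open>(t z - y)' = - \<kappa> r U t\<^sup>2\<close>, the function \<open>v\<close> has the limit \<open>- \<kappa> r(0) U(0) / 3\<close> at 0, and \<open>t v'\<close> tends to 0.\<close>

lemma radial_profile:
  assumes b: "0 < b" and r: "continuous_on {0..b} r" and s: "solves b r \<kappa> y z" and y0: "y 0 = 0"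
  obtains U v where "continuous_on {0..b} U" "continuous_on {0..b} v" "U 0 = z 0"
    "\<And>t. t \<in> {0..b} \<Longrightarrow> of_real t * U t = y t"
    "v 0 = - (\<kappa> * of_real (r 0) * U 0) / 3"
    "\<And>t. t \<in> {0<..<b} \<Longrightarrow> (U has_vector_derivative of_real t * v t) (at t)"
    "\<And>t. t \<in> {0<..<b} \<Longrightarrow> (v has_vector_derivative (- (\<kappa> * of_real (r t) * U t) - 3 * v t) / of_real t) (at t)"
proof -
  define U where "U t = (if t = 0 then z 0 else y t / of_real t)" for t
  define v where "v t = (if t = 0 then - (\<kappa> * of_real (r 0) * z 0) / 3 else (of_real t * z t - y t) / of_real t ^ 3)" for t
  have dy: "(y has_vector_derivative z t) (at t within {0..b})"
    and dz: "(z has_vector_derivative - (\<kappa> * of_real (r t) * y t)) (at t within {0..b})" if "t \<in> {0..b}" for t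
    using s that unfolding solves_def by auto
  have yc: "continuous_on {0..b} y" and zc: "continuous_on {0..b} z"
    using continuous_on_vector_derivative[OF dy] continuous_on_vector_derivative[OF dz] by auto
  have Uy: "of_real t * U t = y t" for t by (simp add: U_def y0)
  have nz: "continuous_on {0<..b} f" if "continuous_on {0<..b} g" "\<And>t. t \<in> {0<..b} \<Longrightarrow> f t = g t" for f g :: "real \<Rightarrow> complex"
    using that continuous_on_cong by metis
  have glue: "continuous_on {0..b} f" if "continuous_on {0<..b} f" "(f \<longlongrightarrow> f 0) (at 0 within {0..b})" for f :: "real \<Rightarrow> complex"
    unfolding continuous_on_eq_continuous_within
  proof
    fix t assume t: "t \<in> {0..b}"
    show "continuous (at t within {0..b}) f"
    proof (cases "t = 0")
      case True then show ?thesis using that(2) by (simp add: continuous_within)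
    next
      case False
      then have "at t within {0..b} = at t within {0<..b}"
        using t by (intro at_within_nhd[of _ "{0<..}"]) auto
      then show ?thesis using that(1) False t by (auto simp: continuous_on_eq_continuous_within)
    qed
  qed
  have Uc: "continuous_on {0..b} U"
  proof (rule glue)
    show "continuous_on {0<..b} U"
    proof (rule nz)
      show "continuous_on {0<..b} (\<lambda>t. y t / of_real t)"
        by (intro continuous_intros continuous_on_subset[OF yc]) auto
    qed (auto simp: U_def)
    show "(U \<longlongrightarrow> U 0) (at 0 within {0..b})"
      unfolding Lim_within
    proof (intro allI impI)
      fix \<epsilon> :: real assume "0 < \<epsilon>"
      have "(y has_derivative (\<lambda>h. h *\<^sub>R z 0)) (at 0 within {0..b})"
        using dy[of 0] b by (simp add: has_vector_derivative_def)
      from this[unfolded has_derivative_within'] \<open>0 < \<epsilon>\<close> obtain d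
        where d: "0 < d" "\<And>t. t \<in> {0..b} \<Longrightarrow> 0 < norm (t - 0) \<Longrightarrow> norm (t - 0) < d \<Longrightarrow>
          norm (y t - y 0 - (t - 0) *\<^sub>R z 0) / norm (t - 0) < \<epsilon>" by blast
      have "dist (U t) (U 0) < \<epsilon>" if t: "t \<in> {0..b}" "0 < dist t 0" "dist t 0 < d" for t
      proof -
        have "U t - U 0 = (y t - y 0 - (t - 0) *\<^sub>R z 0) / of_real t"
          using t by (simp add: U_def y0 scaleR_conv_of_real field_simps)
        then show ?thesis using d(2)[of t] t by (simp add: dist_norm norm_divide)
      qed
      then show "\<exists>d>0. \<forall>t\<in>{0..b}. 0 < dist t 0 \<and> dist t 0 < d \<longrightarrow> dist (U t) (U 0) < \<epsilon>"
        using d(1) by blast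
    qed
  qed
  define q where "q t = of_real (r t) * U t" for t
  have qc: "continuous_on {0..b} q" unfolding q_def by (intro continuous_intros r Uc)
  have dw: "((\<lambda>t. of_real t * z t - y t + \<kappa> * q 0 * of_real t ^ 3 / 3) has_vector_derivative
      - (\<kappa> * (q t - q 0) * of_real t ^ 2)) (at t within {0..b})" if t: "t \<in> {0..b}" for t
  proof -
    have idt: "((\<lambda>t. complex_of_real t) has_vector_derivative 1) (at t within {0..b})"
      by (rule has_vector_derivative_of_real[OF DERIV_ident, unfolded of_real_1])
    have "((\<lambda>t. t ^ 3 / 3) has_real_derivative t\<^sup>2) (at t within {0..b})"
      by (auto intro!: derivative_eq_intros)
    then have cub: "((\<lambda>t. complex_of_real (t ^ 3 / 3)) has_vector_derivative of_real (t\<^sup>2)) (at t within {0..b})"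
      by (rule has_vector_derivative_of_real)
    have "((\<lambda>t. (of_real t * z t - y t) + \<kappa> * q 0 * of_real (t ^ 3 / 3)) has_vector_derivative
        ((of_real t * (- (\<kappa> * of_real (r t) * y t)) + 1 * z t) - z t) + \<kappa> * q 0 * of_real (t\<^sup>2)) (at t within {0..b})"
      by (intro has_vector_derivative_add has_vector_derivative_diff has_vector_derivative_mult
          has_vector_derivative_mult_right idt dy[OF t] dz[OF t] cub)
    moreover have "((of_real t * (- (\<kappa> * of_real (r t) * y t)) + 1 * z t) - z t) + \<kappa> * q 0 * of_real (t\<^sup>2)
        = - (\<kappa> * (q t - q 0) * of_real t ^ 2)"
      unfolding q_def Uy[of t, symmetric] by (simp add: algebra_simps power2_eq_square)
    ultimately show ?thesis by simp
  qed
  have vc: "continuous_on {0..b} v"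
  proof (rule glue)
    show "continuous_on {0<..b} v"
    proof (rule nz)
      show "continuous_on {0<..b} (\<lambda>t. (of_real t * z t - y t) / of_real t ^ 3)"
        by (intro continuous_intros continuous_on_subset[OF yc] continuous_on_subset[OF zc]) auto
    qed (auto simp: v_def)
    show "(v \<longlongrightarrow> v 0) (at 0 within {0..b})"
      unfolding tendsto_iff
    proof (intro allI impI)
      fix \<epsilon> :: real assume \<epsilon>: "0 < \<epsilon>"
      define \<epsilon>' where "\<epsilon>' = \<epsilon> / (norm \<kappa> + 1)"
      have \<epsilon>': "0 < \<epsilon>'" "norm \<kappa> * \<epsilon>' < \<epsilon>"
      proof -
        have n: "0 < norm \<kappa> + 1" by (simp add: add_nonneg_pos)
        show "0 < \<epsilon>'" using n \<epsilon> by (simp add: \<epsilon>'_def)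
        show "norm \<kappa> * \<epsilon>' < \<epsilon>" using n \<epsilon> by (simp add: \<epsilon>'_def pos_divide_less_eq algebra_simps)
      qed
      obtain \<delta> where \<delta>: "0 < \<delta>" "\<And>t. t \<in> {0..b} \<Longrightarrow> t < \<delta> \<Longrightarrow> norm (q t - q 0) < \<epsilon>'"
        using qc[unfolded continuous_on_iff, rule_format, of 0 \<epsilon>'] \<epsilon>'(1) b by (auto simp: dist_norm)
      have "dist (v t) (v 0) < \<epsilon>" if t: "t \<in> {0..b}" "t < \<delta>" "t \<noteq> 0" for t
      proof -
        have t0: "0 < t" using t by auto
        let ?w = "\<lambda>t. of_real t * z t - y t + \<kappa> * q 0 * of_real t ^ 3 / 3"
        have "norm (?w t - ?w 0) \<le> (norm \<kappa> * \<epsilon>' * t\<^sup>2) * norm (t - 0)"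
        proof (rule differentiable_bound[of "{0..t}" ?w "\<lambda>\<tau> h. h *\<^sub>R (- (\<kappa> * (q \<tau> - q 0) * of_real \<tau> ^ 2))"])
          fix \<tau> assume \<tau>: "\<tau> \<in> {0..t}"
          then have \<tau>b: "\<tau> \<in> {0..b}" using t by auto
          show "(?w has_derivative (\<lambda>h. h *\<^sub>R (- (\<kappa> * (q \<tau> - q 0) * of_real \<tau> ^ 2)))) (at \<tau> within {0..t})"
            using dw[OF \<tau>b] t unfolding has_vector_derivative_def
            by (elim has_derivative_subset) auto
          have "norm (- (\<kappa> * (q \<tau> - q 0) * of_real \<tau> ^ 2)) \<le> norm \<kappa> * \<epsilon>' * t\<^sup>2"
            unfolding norm_minus_cancel norm_mult norm_power norm_of_real
            using \<delta>(2)[OF \<tau>b] \<tau> t \<epsilon>'(1) by (intro mult_mono power_mono) auto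
          moreover have "norm (h *\<^sub>R c) \<le> norm c * norm h" for h and c :: complex by simp
          then have "onorm (\<lambda>h. h *\<^sub>R c) \<le> norm c" for c :: complex by (intro onorm_bound) auto
          ultimately show "onorm (\<lambda>h. h *\<^sub>R (- (\<kappa> * (q \<tau> - q 0) * of_real \<tau> ^ 2))) \<le> norm \<kappa> * \<epsilon>' * t\<^sup>2"
            by (meson order_trans)
        qed (use t0 in auto)
        then have "norm (?w t) \<le> norm \<kappa> * \<epsilon>' * t ^ 3" using t0 by (simp add: y0 power3_eq_cube power2_eq_square mult_ac)
        moreover have "v t - v 0 = ?w t / of_real t ^ 3"
          using t0 by (simp add: v_def q_def U_def field_simps)
        ultimately have "norm (v t - v 0) \<le> norm \<kappa> * \<epsilon>'"
          using t0 by (simp add: norm_divide norm_power pos_divide_le_eq)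
        then show ?thesis using \<epsilon>'(2) by (simp add: dist_norm)
      qed
      then show "\<forall>\<^sub>F t in at 0 within {0..b}. dist (v t) (v 0) < \<epsilon>"
        unfolding eventually_at using \<delta>(1) by (intro exI[of _ \<delta>]) auto
    qed
  qed
  have int: "(f has_vector_derivative f') (at t)" if "(f has_vector_derivative f') (at t within {0..b})" "t \<in> {0<..<b}" for f f' t
    using that at_within_interior[of t "{0..b}"] by simp
  show thesis
  proof (rule that[OF Uc vc])
    show "U 0 = z 0" "v 0 = - (\<kappa> * of_real (r 0) * U 0) / 3" by (simp_all add: U_def v_def)
    show "of_real t * U t = y t" if "t \<in> {0..b}" for t by (rule Uy)
    fix t assume t: "t \<in> {0<..<b}"
    then have t0: "t \<noteq> 0" and tb: "t \<in> {0..b}" by auto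
    have idt: "((\<lambda>t. complex_of_real t) has_vector_derivative 1) (at t)"
      by (rule has_vector_derivative_of_real[OF DERIV_ident, unfolded of_real_1])
    show "(U has_vector_derivative of_real t * v t) (at t)"
    proof (rule has_vector_derivative_transform_within_open[of "\<lambda>t. inverse t *\<^sub>R y t" _ t "{0<..}"])
      have "((\<lambda>t. inverse t) has_real_derivative - (inverse t * 1 * inverse t)) (at t)"
        by (rule DERIV_inverse'[OF DERIV_ident t0])
      from has_vector_derivative_scaleR[OF this int[OF dy[OF tb] t]]
      show "((\<lambda>t. inverse t *\<^sub>R y t) has_vector_derivative of_real t * v t) (at t)"
        by (rule has_vector_derivative_eq_rhs)
          (use t0 in \<open>simp add: v_def scaleR_conv_of_real field_simps power3_eq_cube\<close>)
    qed (use t in \<open>auto simp: U_def scaleR_conv_of_real divide_inverse mult.commute\<close>)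
    show "(v has_vector_derivative (- (\<kappa> * of_real (r t) * U t) - 3 * v t) / of_real t) (at t)"
    proof (rule has_vector_derivative_transform_within_open[of "\<lambda>t. inverse (t ^ 3) *\<^sub>R (of_real t * z t - y t)" _ t "{0<..}"])
      have "((\<lambda>t. inverse (t ^ 3)) has_real_derivative - (inverse (t ^ 3) * (3 * t\<^sup>2) * inverse (t ^ 3))) (at t)"
        by (rule DERIV_inverse') (use t0 in \<open>auto intro!: derivative_eq_intros\<close>)
      moreover have "((\<lambda>t. of_real t * z t - y t) has_vector_derivative
          (of_real t * (- (\<kappa> * of_real (r t) * y t)) + 1 * z t) - z t) (at t)"
        by (intro has_vector_derivative_diff has_vector_derivative_mult idt int[OF dy[OF tb] t] int[OF dz[OF tb] t])
      ultimately have "((\<lambda>t. inverse (t ^ 3) *\<^sub>R (of_real t * z t - y t)) has_vector_derivative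
          inverse (t ^ 3) *\<^sub>R ((of_real t * (- (\<kappa> * of_real (r t) * y t)) + 1 * z t) - z t)
          + (- (inverse (t ^ 3) * (3 * t\<^sup>2) * inverse (t ^ 3))) *\<^sub>R (of_real t * z t - y t)) (at t)"
        by (rule has_vector_derivative_scaleR)
      then show "((\<lambda>t. inverse (t ^ 3) *\<^sub>R (of_real t * z t - y t)) has_vector_derivative
          (- (\<kappa> * of_real (r t) * U t) - 3 * v t) / of_real t) (at t)"
        by (rule has_vector_derivative_eq_rhs)
          (use t0 in \<open>simp add: v_def U_def scaleR_conv_of_real field_simps power3_eq_cube power2_eq_square\<close>)
    qed (use t in \<open>auto simp: v_def scaleR_conv_of_real divide_inverse mult.commute\<close>)
  qed
qed

text \<open>With the profile \<open>U\<close> and \<open>v = U' / t\<close>, the gradient of \<open>U(|x|)\<close> is \<open>v(|x|) x\<close> and its Hessian is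
\<open>v I + (w / |x|\<^sup>2) x x\<^sup>T\<close> with \<open>w(t) = t v'(t)\<close>.  Since \<open>w(0) = 0\<close>, the Hessian is continuous at the origin, where
\<open>x / |x|\<close> has no limit.  Its trace is \<open>w + 3 v = - \<kappa> r U\<close>.\<close>

lemma radial_ode_to_laplacian:
  fixes r :: "real \<Rightarrow> real"
  assumes b: "0 < b" and r: "continuous_on {0..b} r" and s: "solves b r \<kappa> y z" and y0: "y 0 = 0"
  obtains \<Psi> :: "real^3 \<Rightarrow> complex" where "continuous_on (cball 0 b) \<Psi>" "C2_on \<Psi> (ball 0 b)"
    "spherically_symmetric_on \<Psi> (cball 0 b)"
    "\<And>x. x \<in> ball 0 b \<Longrightarrow> laplacian \<Psi> x + \<kappa> * of_real (r (norm x)) * \<Psi> x = 0"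
    "\<Psi> 0 = z 0" "\<And>x. x \<in> sphere 0 b \<Longrightarrow> \<Psi> x = y b / of_real b"
    "\<And>x. x \<in> sphere 0 b \<Longrightarrow> has_outward_normal_derivative b \<Psi> ((z b - y b / of_real b) / of_real b) x"
proof -
  obtain U v where Uc: "continuous_on {0..b} U" and vc: "continuous_on {0..b} v" and U0: "U 0 = z 0"
    and Uy: "\<And>t. t \<in> {0..b} \<Longrightarrow> of_real t * U t = y t"
    and v0: "v 0 = - (\<kappa> * of_real (r 0) * U 0) / 3"
    and U': "\<And>t. t \<in> {0<..<b} \<Longrightarrow> (U has_vector_derivative of_real t * v t) (at t)"
    and v': "\<And>t. t \<in> {0<..<b} \<Longrightarrow> (v has_vector_derivative (- (\<kappa> * of_real (r t) * U t) - 3 * v t) / of_real t) (at t)"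
    by (rule radial_profile[OF b r s y0]) blast
  define w where "w t = - (\<kappa> * of_real (r t) * U t) - 3 * v t" for t
  have wc: "continuous_on {0..b} w" unfolding w_def by (intro continuous_intros r Uc vc)
  have w0: "w 0 = 0" by (simp add: w_def v0)
  define \<Psi> :: "real^3 \<Rightarrow> complex" where "\<Psi> x = U (norm x)" for x
  define g :: "real^3 \<Rightarrow> complex" where "g x = v (norm x)" for x
  define f' where "f' x = scaled_inner (g x) x" for x
  define F where "F x h = scaled_inner (((x \<bullet> h) / (norm x)\<^sup>2) *\<^sub>R w (norm x)) x + scaled_inner (g x) h" for x h :: "real^3"
  have Fbl: "bounded_linear (F x)" for x
  proof -
    have "bounded_linear (\<lambda>h. (x \<bullet> h) / (norm x)\<^sup>2)"
      by (intro bounded_linear_compose[OF bounded_linear_divide bounded_linear_inner_right])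
    then have "bounded_linear (\<lambda>h. ((x \<bullet> h) / (norm x)\<^sup>2) *\<^sub>R w (norm x))"
      by (rule bounded_linear_compose[OF bounded_linear_scaleR_left])
    then have "bounded_linear (\<lambda>h. scaled_inner (((x \<bullet> h) / (norm x)\<^sup>2) *\<^sub>R w (norm x)) x)"
      by (rule bounded_linear_compose[OF scaled_inner.bounded_linear_left])
    then show ?thesis unfolding F_def
      by (intro bounded_linear_add scaled_inner.bounded_linear_right)
  qed
  define f'' where "f'' x = Blinfun (F x)" for x
  have f''_apply: "blinfun_apply (f'' x) = F x" for x
    unfolding f''_def by (rule bounded_linear_Blinfun_apply[OF Fbl])
  have cont_norm: "continuous_on (cball 0 b) (\<lambda>x::real^3. h (norm x))" if "continuous_on {0..b} h" for h :: "real \<Rightarrow> complex"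
    by (rule continuous_on_compose2[OF that]) (auto intro!: continuous_intros)
  have cont_at: "isCont (\<lambda>x::real^3. h (norm x)) x" if "continuous_on {0..b} h" "x \<in> ball 0 b" for h :: "real \<Rightarrow> complex" and x
    using continuous_on_subset[OF cont_norm[OF that(1)] ball_subset_cball] that(2)
    by (simp add: continuous_on_eq_continuous_at)
  have radial_deriv: "((\<lambda>x::real^3. h (norm x)) has_derivative (\<lambda>k. ((x \<bullet> k) / norm x) *\<^sub>R h')) (at x)"
    if "x \<noteq> 0" "(h has_vector_derivative h') (at (norm x))" for h :: "real \<Rightarrow> complex" and h' x
  proof -
    have "((\<lambda>x::real^3. norm x) has_derivative (\<lambda>k. (x \<bullet> k) / norm x)) (at x)"
      by (rule has_derivative_eq_rhs[OF has_derivative_norm[OF that(1)]])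
        (auto simp: sgn_div_norm inner_commute divide_inverse mult.commute)
    from has_derivative_compose[OF this that(2)[unfolded has_vector_derivative_def]] show ?thesis .
  qed
  have dPsi: "(\<Psi> has_derivative blinfun_apply (f' x)) (at x)" if x: "x \<in> ball 0 b" for x
  proof (cases "x = 0")
    case False
    have "(\<Psi> has_derivative (\<lambda>k. ((x \<bullet> k) / norm x) *\<^sub>R (of_real (norm x) * v (norm x)))) (at x)"
      unfolding \<Psi>_def[abs_def] by (rule radial_deriv[OF False U']) (use x False in auto)
    then show ?thesis
      by (rule has_derivative_eq_rhs)
        (use False in \<open>auto simp: f'_def g_def scaleR_conv_of_real inner_commute\<close>)
  next
    case True
    obtain V where "\<forall>c\<in>v ` {0..b}. norm c \<le> V"
      using compact_imp_bounded[OF compact_continuous_image[OF vc compact_Icc]] unfolding bounded_iff by blast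
    then have V: "norm (v t) \<le> V" if "t \<in> {0..b}" for t using that by blast
    \<comment> \<open>the gradient vanishes at the origin because \<open>U' = t v\<close> makes the profile quadratic there\<close>
    have quad: "norm (U t - U 0) \<le> V * t * t" if t: "0 < t" "t < b" for t
    proof -
      have "\<exists>\<tau>\<in>{0<..<t}. norm (U t - U 0) \<le> norm ((t - 0) *\<^sub>R (of_real \<tau> * v \<tau>))"
      proof (rule mvt_general[OF t(1)])
        show "continuous_on {0..t} U" by (rule continuous_on_subset[OF Uc]) (use t in auto)
        show "(U has_derivative (\<lambda>h. h *\<^sub>R (of_real \<tau> * v \<tau>))) (at \<tau>)" if "0 < \<tau>" "\<tau> < t" for \<tau>
          using U'[of \<tau>] that t by (simp add: has_vector_derivative_def)
      qed
      then obtain \<tau> where \<tau>: "\<tau> \<in> {0<..<t}" "norm (U t - U 0) \<le> norm ((t - 0) *\<^sub>R (of_real \<tau> * v \<tau>))" by blast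
      have "norm ((t - 0) *\<^sub>R (of_real \<tau> * v \<tau>)) = t * (\<tau> * norm (v \<tau>))" using \<tau> t by (simp add: norm_mult)
      also have "\<dots> \<le> t * (t * V)" using \<tau> t V[of \<tau>] by (intro mult_left_mono mult_mono) auto
      finally show ?thesis using \<tau>(2) by (simp add: mult_ac)
    qed
    have "(\<Psi> has_derivative (\<lambda>h. 0)) (at 0)"
      unfolding has_derivative_at
    proof (intro conjI bounded_linear_zero)
      have lim: "((\<lambda>h::real^3. V * norm h) \<longlongrightarrow> 0) (at 0)"
        by (rule tendsto_eq_intros refl | simp)+
      have "norm (norm (\<Psi> (0 + h) - \<Psi> 0 - 0) / norm h) \<le> V * norm h" if "h \<in> ball 0 b" "h \<noteq> 0" for h
        using quad[of "norm h"] that by (simp add: \<Psi>_def pos_divide_le_eq)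
      then have "\<forall>\<^sub>F h in at 0. norm (norm (\<Psi> (0 + h) - \<Psi> 0 - 0) / norm h) \<le> V * norm h"
        unfolding eventually_at_topological using b by (intro exI[of _ "ball 0 b"]) auto
      then show "(\<lambda>h. norm (\<Psi> (0 + h) - \<Psi> 0 - 0) / norm h) \<midarrow>0\<rightarrow> 0"
        by (rule Lim_null_comparison[OF _ lim])
    qed
    then show ?thesis unfolding True
      by (rule has_derivative_eq_rhs) (simp add: f'_def scaled_inner.zero_right fun_eq_iff)
  qed
  have df': "(f' has_derivative blinfun_apply (f'' x)) (at x)" if x: "x \<in> ball 0 b" for x
  proof (cases "x = 0")
    case True
    have "(f' has_derivative (\<lambda>h. scaled_inner (g 0) h)) (at 0)"
      unfolding f'_def[abs_def] by (rule scaled_inner_derivative_at_0) (use cont_at[OF vc] b in \<open>simp add: g_def[abs_def]\<close>)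
    then show ?thesis unfolding True f''_apply
      by (rule has_derivative_eq_rhs) (simp add: F_def scaled_inner.zero_right fun_eq_iff)
  next
    case False
    have "(g has_derivative (\<lambda>k. ((x \<bullet> k) / norm x) *\<^sub>R (w (norm x) / of_real (norm x)))) (at x)"
      unfolding g_def[abs_def] w_def by (rule radial_deriv[OF False v']) (use x False in auto)
    from scaled_inner.FDERIV[OF this has_derivative_ident]
    show ?thesis unfolding f'_def[abs_def] f''_apply
      by (rule has_derivative_eq_rhs)
        (use False in \<open>auto simp: F_def fun_eq_iff scaleR_conv_of_real power2_eq_square add.commute\<close>)
  qed
  have cf'': "continuous_on (ball 0 b) f''"
  proof (rule continuous_on_blinfun_componentwise)
    fix h :: "real^3"
    obtain K where K: "\<And>a x. norm (scaled_inner a x :: (real^3) \<Rightarrow>\<^sub>L complex) \<le> norm a * norm x * K" "0 \<le> K"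
      using scaled_inner.nonneg_bounded by blast
    have "isCont (\<lambda>x. F x h) x" if x: "x \<in> ball 0 b" for x
    proof -
      have g': "isCont (\<lambda>x. scaled_inner (g x) h) x"
        unfolding g_def isCont_def
        by (intro scaled_inner.tendsto tendsto_const cont_at[OF vc x, unfolded isCont_def])
      have "isCont (\<lambda>x. scaled_inner (((x \<bullet> h) / (norm x)\<^sup>2) *\<^sub>R w (norm x)) x) x"
      proof (cases "x = 0")
        case False
        have wl: "((\<lambda>x. w (norm x)) \<longlongrightarrow> w (norm x)) (at x)" using cont_at[OF wc x] by (simp add: isCont_def)
        show ?thesis unfolding isCont_def
          by (intro scaled_inner.tendsto tendsto_intros wl) (use False in auto)
      next
        case True
        have "((\<lambda>x::real^3. norm h * norm (w (norm x)) * K) \<longlongrightarrow> norm h * norm (w (norm (0::real^3))) * K) (at 0)"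
          using cont_at[OF wc x] unfolding True isCont_def by (intro tendsto_intros)
        then have lim: "((\<lambda>x::real^3. norm h * norm (w (norm x)) * K) \<longlongrightarrow> 0) (at 0)" by (simp add: w0)
        have le: "norm (scaled_inner (((x \<bullet> h) / (norm x)\<^sup>2) *\<^sub>R w (norm x)) x) \<le> norm h * norm (w (norm x)) * K" for x
        proof (cases "x = 0")
          case True then show ?thesis using K(2) by (simp add: scaled_inner.zero_right)
        next
          case False
          have "norm (scaled_inner (((x \<bullet> h) / (norm x)\<^sup>2) *\<^sub>R w (norm x)) x)
             \<le> (\<bar>x \<bullet> h\<bar> / (norm x)\<^sup>2 * norm (w (norm x))) * norm x * K"
            using K(1)[of "((x \<bullet> h) / (norm x)\<^sup>2) *\<^sub>R w (norm x)" x] by simp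
          also have "\<dots> \<le> ((norm x * norm h) / (norm x)\<^sup>2 * norm (w (norm x))) * norm x * K"
            using K(2) Cauchy_Schwarz_ineq2[of x h] by (intro mult_right_mono divide_right_mono) auto
          also have "\<dots> = norm h * norm (w (norm x)) * K" using False by (simp add: power2_eq_square)
          finally show ?thesis .
        qed
        show ?thesis unfolding True isCont_def
          by (rule Lim_null_comparison[OF always_eventually lim, THEN tendsto_eq_rhs])
            (use le in \<open>auto simp: scaled_inner.zero_right\<close>)
      qed
      then show ?thesis unfolding F_def using g' by (intro isCont_add)
    qed
    then show "continuous_on (ball 0 b) (\<lambda>x. blinfun_apply (f'' x) h)"
      by (simp add: f''_apply continuous_at_imp_continuous_on)
  qed
  show thesis
  proof (rule that[of \<Psi>])
    show "continuous_on (cball 0 b) \<Psi>" unfolding \<Psi>_def by (rule cont_norm[OF Uc])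
    show "C2_on \<Psi> (ball 0 b)" unfolding C2_on_def using dPsi df' cf'' by blast
    show "spherically_symmetric_on \<Psi> (cball 0 b)" by (simp add: spherically_symmetric_on_def \<Psi>_def)
    show "\<Psi> 0 = z 0" by (simp add: \<Psi>_def U0)
    have Ub: "U b = y b / of_real b" using Uy[of b] b by (simp add: field_simps)
    then show "\<Psi> x = y b / of_real b" if "x \<in> sphere 0 b" for x using that by (simp add: \<Psi>_def)
    show "laplacian \<Psi> x + \<kappa> * of_real (r (norm x)) * \<Psi> x = 0" if x: "x \<in> ball 0 b" for x
    proof -
      have "laplacian \<Psi> x = (\<Sum>i\<in>Basis. f'' x i i)"
        by (rule laplacian_C2[OF open_ball dPsi df' x])
      also have "\<dots> = (\<Sum>i\<in>Basis. of_real ((x \<bullet> i) * (x \<bullet> i)) * (w (norm x) / of_real ((norm x)\<^sup>2)) + g x)"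
        by (intro sum.cong refl) (simp add: f''_apply F_def blinfun.add_left scaleR_conv_of_real inner_commute)
      also have "\<dots> = of_real (\<Sum>i\<in>Basis. (x \<bullet> i) * (x \<bullet> i)) * (w (norm x) / of_real ((norm x)\<^sup>2)) + 3 * g x"
        by (simp add: sum.distrib sum_distrib_right sum_divide_distrib)
      also have "(\<Sum>i\<in>Basis. (x \<bullet> i) * (x \<bullet> i)) = (norm x)\<^sup>2"
        by (simp add: power2_norm_eq_inner flip: euclidean_inner)
      also have "of_real ((norm x)\<^sup>2) * (w (norm x) / of_real ((norm x)\<^sup>2)) = w (norm x)"
        by (cases "x = 0") (simp_all add: w0)
      finally have "laplacian \<Psi> x = w (norm x) + 3 * g x" .
      moreover have "w (norm x) + 3 * g x + \<kappa> * of_real (r (norm x)) * \<Psi> x = 0"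
        by (simp add: w_def g_def \<Psi>_def)
      ultimately show ?thesis by simp
    qed
    show "has_outward_normal_derivative b \<Psi> ((z b - y b / of_real b) / of_real b) x" if x: "x \<in> sphere 0 b" for x
    proof -
      have nx: "norm x = b" using x by simp
      have line: "\<Psi> (x + t *\<^sub>R (x /\<^sub>R b)) = inverse (b + t) *\<^sub>R y (b + t)" if "t \<in> {-b<..0}" for t
      proof -
        have "x + t *\<^sub>R (x /\<^sub>R b) = ((b + t) / b) *\<^sub>R x" using b by (simp add: add_divide_distrib scaleR_add_left) (simp add: divide_inverse)
        then have n: "norm (x + t *\<^sub>R (x /\<^sub>R b)) = b + t" using that b by (simp add: nx)
        have "of_real (b + t) * U (b + t) = y (b + t)" by (rule Uy) (use that in auto)
        then have "y (b + t) = (b + t) *\<^sub>R U (b + t)" by (simp only: scaleR_conv_of_real)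
        moreover have "b + t \<noteq> 0" using that by auto
        ultimately show ?thesis unfolding \<Psi>_def n by (simp only: scaleR_scaleR left_inverse scaleR_one not_False_eq_True)
      qed
      have "(y has_vector_derivative z b) (at b within {0..b})" using s b unfolding solves_def by auto
      then have "(y has_vector_derivative z b) (at (b + 0) within (\<lambda>t. b + t) ` {-b..0})"
        by (simp add: image_add_atLeastAtMost)
      moreover have "((\<lambda>t. b + t) has_vector_derivative 1) (at 0 within {-b..0})"
        by (auto intro!: derivative_eq_intros)
      ultimately have Y: "((\<lambda>t. y (b + t)) has_vector_derivative z b) (at 0 within {-b..0})"
        using vector_diff_chain_within[of "\<lambda>t. b + t" 1 0 "{-b..0}" y "z b"] by (simp add: o_def)
      have "((\<lambda>t. inverse (b + t)) has_real_derivative - (inverse (b + 0) * 1 * inverse (b + 0))) (at 0 within {-b..0})"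
        by (rule DERIV_inverse') (use b in \<open>auto intro!: derivative_eq_intros\<close>)
      from has_vector_derivative_scaleR[OF this Y]
      have "((\<lambda>t. inverse (b + t) *\<^sub>R y (b + t)) has_vector_derivative (z b - y b / of_real b) / of_real b) (at 0 within {-b..0})"
        by (rule has_vector_derivative_eq_rhs) (use b in \<open>simp add: scaleR_conv_of_real field_simps\<close>)
      then have "((\<lambda>t. inverse (b + t) *\<^sub>R y (b + t)) has_vector_derivative (z b - y b / of_real b) / of_real b) (at 0 within {-b<..0})"
        by (rule has_vector_derivative_within_subset) auto
      then have "((\<lambda>t. \<Psi> (x + t *\<^sub>R (x /\<^sub>R b))) has_vector_derivative (z b - y b / of_real b) / of_real b) (at 0 within {-b<..0})"
        by (rule has_vector_derivative_transform[rotated 2]) (use line b in auto)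
      moreover have "at 0 within {-b<..0} = at 0 within {..0::real}"
        by (rule at_within_nhd[of _ "{-b<..}"]) (use b in auto)
      ultimately show ?thesis by (simp add: has_outward_normal_derivative_def)
    qed
  qed
qed

section \<open>Special transmission eigenvalues and the function D\<close>

lemma admissible_regular:
  assumes b: "0 < b" and adm: "admissible b \<rho>"
  obtains M where "regular_coeff b M \<rho>" "\<rho> b = 1"
proof -
  obtain \<rho>' where \<rho>': "\<And>x. 0 \<le> x \<Longrightarrow> (\<rho> has_real_derivative \<rho>' x) (at x within {0..})"
    and c: "continuous_on {0..} \<rho>'" and pos: "\<And>x. 0 \<le> x \<Longrightarrow> 0 < \<rho> x" and one: "\<And>x. b \<le> x \<Longrightarrow> \<rho> x = 1"
    using adm unfolding admissible_def by blast
  have d: "(\<rho> has_real_derivative \<rho>' x) (at x within {0..b})" if "x \<in> {0..b}" for x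
    by (rule has_field_derivative_subset[OF \<rho>']) (use that in auto)
  have nz: "\<rho> x \<noteq> 0" if "x \<in> {0..b}" for x using pos[of x] that by auto
  have "continuous_on {0..b} (\<lambda>x. \<rho>' x / \<rho> x)"
    by (intro continuous_on_divide continuous_on_subset[OF c] DERIV_continuous_on[OF d]) (use nz in auto)
  then obtain M where M: "\<And>x. x \<in> {0..b} \<Longrightarrow> \<bar>\<rho>' x / \<rho> x\<bar> \<le> M"
    by (rule continuous_on_Icc_bounded) blast
  have "0 \<le> M" using M[of 0] b by (meson abs_ge_zero atLeastAtMost_iff less_imp_le order.refl order_trans)
  moreover have "\<bar>\<rho>' x\<bar> \<le> M * \<rho> x" if "x \<in> {0..b}" for x
    using M[OF that] pos[of x] that by (simp add: abs_divide pos_divide_le_eq)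
  ultimately have "regular_coeff b M \<rho>"
    unfolding regular_coeff_def using b pos d by (metis atLeastAtMost_iff)
  then show thesis using one[of b] by (intro that) auto
qed

lemma free_solution:
  assumes b: "0 < b" and x: "x \<in> {0..b}"
  shows "ysol (\<lambda>_. 1) 0 1 (k\<^sup>2) x = (if k = 0 then of_real x else sin (k * of_real x) / k)"
    and "zsol (\<lambda>_. 1) 0 1 (k\<^sup>2) x = cos (k * of_real x)"
proof -
  have c: "continuous_on {0..b} (\<lambda>_. 1 :: real)" by simp
  have id: "((\<lambda>t. k * complex_of_real t) has_vector_derivative k) (at t within {0..b})" for t
    by (rule has_vector_derivative_eq_rhs[OF has_vector_derivative_mult_right[OF has_vector_derivative_of_real[OF DERIV_ident]]]) simp
  have s: "((\<lambda>t. sin (k * complex_of_real t)) has_vector_derivative k * cos (k * of_real t)) (at t within {0..b})"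
    and cs: "((\<lambda>t. cos (k * complex_of_real t)) has_vector_derivative k * (- sin (k * of_real t))) (at t within {0..b})" for t
  proof -
    have "(sin \<circ> (\<lambda>t. k * complex_of_real t) has_vector_derivative k * cos (k * of_real t)) (at t within {0..b})"
      by (rule field_vector_diff_chain_within[OF id]) (auto intro!: derivative_eq_intros)
    then show "((\<lambda>t. sin (k * complex_of_real t)) has_vector_derivative k * cos (k * of_real t)) (at t within {0..b})"
      by (simp add: o_def)
    have "(cos \<circ> (\<lambda>t. k * complex_of_real t) has_vector_derivative k * (- sin (k * of_real t))) (at t within {0..b})"
      by (rule field_vector_diff_chain_within[OF id]) (auto intro!: derivative_eq_intros)
    then show "((\<lambda>t. cos (k * complex_of_real t)) has_vector_derivative k * (- sin (k * of_real t))) (at t within {0..b})"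
      by (simp add: o_def)
  qed
  have "solves b (\<lambda>_. 1) (k\<^sup>2) (\<lambda>t. if k = 0 then of_real t else sin (k * of_real t) / k) (\<lambda>t. cos (k * of_real t))"
  proof (cases "k = 0")
    case True
    then show ?thesis unfolding solves_def
      by (auto intro!: has_vector_derivative_of_real[OF DERIV_ident, unfolded of_real_1] derivative_eq_intros)
  next
    case False
    have "((\<lambda>t. sin (k * of_real t) / k) has_vector_derivative k * cos (k * of_real t) / k) (at t within {0..b})" for t
      by (rule has_vector_derivative_divide[OF s])
    then have "((\<lambda>t. sin (k * of_real t) / k) has_vector_derivative cos (k * of_real t)) (at t within {0..b})" for t
      using False by simp
    then show ?thesis unfolding solves_def using cs False by (simp add: power2_eq_square)
  qed
  note u = solves_unique[OF c solves_ysol[OF c, of "k\<^sup>2" 0 1] this _ _ x]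
  show "ysol (\<lambda>_. 1) 0 1 (k\<^sup>2) x = (if k = 0 then of_real x else sin (k * of_real x) / k)"
    using u(1) b by (simp add: ysol_0 zsol_0)
  show "zsol (\<lambda>_. 1) 0 1 (k\<^sup>2) x = cos (k * of_real x)"
    using u(2) b by (simp add: ysol_0 zsol_0)
qed

lemma regular_solution_ysol:
  assumes b: "0 < b" and r: "continuous_on {0..b} \<rho>"
  shows "regular_solution b \<rho> k (ysol \<rho> 0 1 (k\<^sup>2))"
    and "regular_solution b \<rho> k f \<Longrightarrow> f b = ysol \<rho> 0 1 (k\<^sup>2) b \<and>
           vector_derivative f (at b within {0..b}) = zsol \<rho> 0 1 (k\<^sup>2) b"
proof -
  have s: "solves b \<rho> (k\<^sup>2) (ysol \<rho> 0 1 (k\<^sup>2)) (zsol \<rho> 0 1 (k\<^sup>2))"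
    using solves_ysol[OF r] b by simp
  have zc: "continuous_on {0..b} (zsol \<rho> 0 1 (k\<^sup>2))"
    by (rule continuous_on_vector_derivative) (use s in \<open>auto simp: solves_def\<close>)
  show "regular_solution b \<rho> k (ysol \<rho> 0 1 (k\<^sup>2))"
    unfolding regular_solution_def
  proof (intro exI[of _ "zsol \<rho> 0 1 (k\<^sup>2)"] conjI ballI zc)
    fix x assume x: "x \<in> {0<..<b}"
    then have "(zsol \<rho> 0 1 (k\<^sup>2) has_vector_derivative - (k\<^sup>2 * of_real (\<rho> x) * ysol \<rho> 0 1 (k\<^sup>2) x)) (at x within {0..b})"
      using s unfolding solves_def by auto
    then show "(zsol \<rho> 0 1 (k\<^sup>2) has_vector_derivative - (k\<^sup>2 * of_real (\<rho> x) * ysol \<rho> 0 1 (k\<^sup>2) x)) (at x)"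
      using x at_within_interior[of x "{0..b}"] by simp
  qed (use s in \<open>auto simp: solves_def ysol_0 zsol_0\<close>)
  assume "regular_solution b \<rho> k f"
  then obtain f' where f: "\<And>x. x \<in> {0..b} \<Longrightarrow> (f has_vector_derivative f' x) (at x within {0..b})"
    "continuous_on {0..b} f'"
    "\<And>x. x \<in> {0<..<b} \<Longrightarrow> (f' has_vector_derivative - (k\<^sup>2 * of_real (\<rho> x) * f x)) (at x)"
    "f 0 = 0" "f' 0 = 1" unfolding regular_solution_def by blast
  obtain w where w: "solves b \<rho> (k\<^sup>2) f w" "w 0 = f' 0"
    by (rule solves_of_interior[OF b r continuous_on_vector_derivative[OF f(1)] f(1) _ f(3)])
      (auto intro: continuous_on_subset[OF f(2)])
  have bb: "b \<in> {0..b}" using b by simp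
  have "f b = ysol \<rho> 0 1 (k\<^sup>2) b" "w b = zsol \<rho> 0 1 (k\<^sup>2) b"
    using solves_unique[OF r w(1) s _ _ bb] f(4,5) w(2) by (simp_all add: ysol_0 zsol_0)
  moreover have "vector_derivative f (at b within {0..b}) = w b"
    using w(1) bb b unfolding solves_def
    by (intro vector_derivative_within_closed_interval) auto
  ultimately show "f b = ysol \<rho> 0 1 (k\<^sup>2) b \<and> vector_derivative f (at b within {0..b}) = zsol \<rho> 0 1 (k\<^sup>2) b"
    by simp
qed

text \<open>The function \<open>D\<close> in the variable \<open>\<kappa> = k\<^sup>2\<close>, as the Wronskian at \<open>b\<close> of the free solution and the
solution for \<open>\<rho>\<close>.\<close>

definition char_fun :: "real \<Rightarrow> (real \<Rightarrow> real) \<Rightarrow> complex \<Rightarrow> complex" where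
  "char_fun b \<rho> \<kappa> = ysol (\<lambda>_. 1) 0 1 \<kappa> b * zsol \<rho> 0 1 \<kappa> b - zsol (\<lambda>_. 1) 0 1 \<kappa> b * ysol \<rho> 0 1 \<kappa> b"

lemma D_fun_eq_char_fun:
  assumes b: "0 < b" and r: "continuous_on {0..b} \<rho>"
  shows "D_fun b \<rho> k = char_fun b \<rho> (k\<^sup>2)"
proof -
  have "regular_solution b \<rho> k (phi b \<rho> k)"
    unfolding phi_def by (rule someI[of _ "ysol \<rho> 0 1 (k\<^sup>2)"]) (rule regular_solution_ysol(1)[OF b r])
  from regular_solution_ysol(2)[OF b r this] show ?thesis
    using free_solution[OF b, of b k] b by (simp add: D_fun_def char_fun_def)
qed

lemma regular_coeff_1: "0 < b \<Longrightarrow> regular_coeff b 0 (\<lambda>_. 1)"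
  unfolding regular_coeff_def by (auto intro!: exI[of _ 0])

lemma travel_1: "0 \<le> x \<Longrightarrow> travel (\<lambda>_. 1) x = x"
  by (simp add: travel_def)

lemma char_fun_holomorphic:
  assumes "0 < b" "continuous_on {0..b} \<rho>"
  shows "char_fun b \<rho> holomorphic_on S"
  unfolding char_fun_def[abs_def]
  by (intro holomorphic_intros solution_holomorphic[of b]) (use assms in auto)

lemma char_fun_estimate:
  assumes r: "regular_coeff b M \<rho>"
  obtains C where "0 < C"
    "\<And>k. norm k * norm (char_fun b \<rho> (k\<^sup>2)) \<le> C * exp (\<bar>Im k\<bar> * (b + travel \<rho> b))"
proof -
  have b: "0 < b" by (rule regular_coeffD(1)[OF r])
  then have bb: "b \<in> {0..b}" by simp
  obtain C0 where C0: "0 < C0"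
    "\<And>k. norm k * norm (ysol (\<lambda>_. 1) 0 1 (k\<^sup>2) b) \<le> C0 * exp (\<bar>Im k\<bar> * b)"
    "\<And>k. norm (zsol (\<lambda>_. 1) 0 1 (k\<^sup>2) b) \<le> C0 * exp (\<bar>Im k\<bar> * b)"
    using normalised_solution_growth[OF regular_coeff_1[OF b]] bb travel_1[of b] b by (metis less_imp_le)
  obtain C1 where C1: "0 < C1"
    "\<And>k. norm k * norm (ysol \<rho> 0 1 (k\<^sup>2) b) \<le> C1 * exp (\<bar>Im k\<bar> * travel \<rho> b)"
    "\<And>k. norm (zsol \<rho> 0 1 (k\<^sup>2) b) \<le> C1 * exp (\<bar>Im k\<bar> * travel \<rho> b)"
    using normalised_solution_growth[OF r] bb by metis
  show thesis
  proof (rule that[of "2 * C0 * C1"])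
    fix k
    let ?S = "ysol (\<lambda>_. 1) 0 1 (k\<^sup>2) b" and ?c = "zsol (\<lambda>_. 1) 0 1 (k\<^sup>2) b"
      and ?Y = "ysol \<rho> 0 1 (k\<^sup>2) b" and ?Z = "zsol \<rho> 0 1 (k\<^sup>2) b"
    have "norm k * norm (char_fun b \<rho> (k\<^sup>2)) \<le> norm k * (norm ?S * norm ?Z + norm ?c * norm ?Y)"
      unfolding char_fun_def by (intro mult_left_mono) (metis norm_mult norm_triangle_ineq4, simp)
    also have "\<dots> = (norm k * norm ?S) * norm ?Z + norm ?c * (norm k * norm ?Y)" by (simp add: algebra_simps)
    also have "\<dots> \<le> (C0 * exp (\<bar>Im k\<bar> * b)) * (C1 * exp (\<bar>Im k\<bar> * travel \<rho> b))
        + (C0 * exp (\<bar>Im k\<bar> * b)) * (C1 * exp (\<bar>Im k\<bar> * travel \<rho> b))"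
      by (intro add_mono mult_mono C0 C1) (use C0(1) C1(1) in auto)
    also have "\<dots> = 2 * C0 * C1 * exp (\<bar>Im k\<bar> * (b + travel \<rho> b))" by (simp add: distrib_left exp_add)
    finally show "norm k * norm (char_fun b \<rho> (k\<^sup>2)) \<le> 2 * C0 * C1 * exp (\<bar>Im k\<bar> * (b + travel \<rho> b))" .
  qed (use C0 C1 in auto)
qed

lemma char_fun_growth:
  assumes r: "regular_coeff b M \<rho>"
  obtains C c where "0 \<le> c" "\<And>w. norm (char_fun b \<rho> w) \<le> C * exp (c * sqrt (norm w))"
proof -
  have b: "0 < b" and rc: "continuous_on {0..b} \<rho>" using regular_coeffD[OF r] by auto
  obtain C where C: "0 < C"
    "\<And>k. norm k * norm (char_fun b \<rho> (k\<^sup>2)) \<le> C * exp (\<bar>Im k\<bar> * (b + travel \<rho> b))"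
    by (rule char_fun_estimate[OF r]) blast
  let ?\<tau> = "b + travel \<rho> b"
  have \<tau>: "0 \<le> ?\<tau>" using travel_nonneg[OF r, of b] b by simp
  have "norm (char_fun b \<rho> w) \<le> C * exp ?\<tau> * exp (?\<tau> * sqrt (norm w))" for w
  proof (rule half_order_growth[OF char_fun_holomorphic[OF b rc] \<tau>])
    fix k :: complex assume k: "1 \<le> norm k"
    have "1 * norm (char_fun b \<rho> (k\<^sup>2)) \<le> norm k * norm (char_fun b \<rho> (k\<^sup>2))"
      by (rule mult_right_mono[OF k]) simp
    also have "\<dots> \<le> C * exp (\<bar>Im k\<bar> * ?\<tau>)" by (rule C(2))
    also have "\<dots> \<le> C * exp (?\<tau> * norm k)"
      using C(1) abs_Im_le_cmod[of k] mult_right_mono[OF abs_Im_le_cmod[of k] \<tau>] by (simp add: mult.commute)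
    finally show "norm (char_fun b \<rho> (k\<^sup>2)) \<le> C * exp (?\<tau> * norm k)" by simp
  qed (use C in simp)
  then show thesis by (rule that[OF \<tau>])
qed

lemma char_fun_tendsto_0:
  assumes r: "regular_coeff b M \<rho>"
  shows "((\<lambda>x::real. char_fun b \<rho> (of_real x)) \<longlongrightarrow> 0) at_top"
proof -
  obtain C where C: "0 < C"
    "\<And>k. norm k * norm (char_fun b \<rho> (k\<^sup>2)) \<le> C * exp (\<bar>Im k\<bar> * (b + travel \<rho> b))"
    by (rule char_fun_estimate[OF r]) blast
  have ev: "eventually (\<lambda>x::real. norm (char_fun b \<rho> (of_real x)) \<le> C / sqrt x) at_top"
    using eventually_gt_at_top[of 0]
  proof eventually_elim
    case (elim x)
    have "of_real x = (complex_of_real (sqrt x))\<^sup>2" using elim by (simp flip: of_real_power)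
    then have "sqrt x * norm (char_fun b \<rho> (of_real x)) \<le> C" using C(2)[of "of_real (sqrt x)"] elim by simp
    then show ?case using elim by (simp add: field_simps)
  qed
  have "((\<lambda>x::real. C / sqrt x) \<longlongrightarrow> 0) at_top" by real_asymp
  then show ?thesis by (rule Lim_null_comparison[OF ev])
qed

text \<open>The power series in \<open>\<kappa>\<close> have real coefficients.\<close>

lemma char_fun_real:
  assumes "0 < b" "continuous_on {0..b} \<rho>"
  shows "char_fun b \<rho> (of_real x) \<in> \<real>"
proof -
  have bb: "b \<in> {0..b}" using assms by simp
  show ?thesis
    unfolding char_fun_def solution_real[OF assms(2) bb] solution_real[OF continuous_on_const bb]
    by (intro Reals_diff Reals_mult Reals_of_real)
qed

text \<open>A symmetric pair \<open>\<Psi>, \<Psi>0\<close> consists of multiples \<open>A\<close>, \<open>B\<close> of the two regular radial solutions.  The boundary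
conditions form a homogeneous linear system for \<open>(A, B)\<close> with determinant \<open>D\<close> up to sign.\<close>

lemma eigenvalue_iff_char_fun_zero:
  assumes b: "0 < b" and r: "continuous_on {0..b} \<rho>"
  shows "special_transmission_eigenvalue b \<rho> \<kappa> \<longleftrightarrow> char_fun b \<rho> \<kappa> = 0"
proof -
  have bb: "b \<in> {0..b}" using b by simp
  have r1: "continuous_on {0..b} (\<lambda>_. 1 :: real)" by simp
  let ?Y = "ysol \<rho> 0 1 \<kappa> b" and ?Z = "zsol \<rho> 0 1 \<kappa> b"
    and ?S = "ysol (\<lambda>_. 1) 0 1 \<kappa> b" and ?c = "zsol (\<lambda>_. 1) 0 1 \<kappa> b"
  have scaled: "solves b q \<kappa> (\<lambda>x. A * ysol q 0 1 \<kappa> x) (\<lambda>x. A * zsol q 0 1 \<kappa> x)" if q: "continuous_on {0..b} q" for q A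
  proof -
    have s: "solves b q \<kappa> (ysol q 0 1 \<kappa>) (zsol q 0 1 \<kappa>)" using solves_ysol[OF q] b by simp
    from solves_linear_combination[OF s s, of A 0] show ?thesis by simp
  qed
  show ?thesis
  proof
    assume "special_transmission_eigenvalue b \<rho> \<kappa>"
    then obtain \<Psi> \<Psi>0 where ef: "special_transmission_eigenfunctions b \<rho> \<kappa> \<Psi> \<Psi>0"
      and nt: "\<exists>x\<in>ball 0 b. \<Psi> x \<noteq> 0 \<or> \<Psi>0 x \<noteq> 0"
      unfolding special_transmission_eigenvalue_def by blast
    note ef' = ef[unfolded special_transmission_eigenfunctions_def]
    obtain e :: "real^3" where e: "e \<in> Basis" using nonempty_Basis by blast
    have be: "b *\<^sub>R e \<in> sphere 0 b" using e b by simp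
    obtain d where d: "has_outward_normal_derivative b \<Psi> d (b *\<^sub>R e)" "has_outward_normal_derivative b \<Psi>0 d (b *\<^sub>R e)"
      using ef' be by blast
    have bdry: "\<Psi> (b *\<^sub>R e) = \<Psi>0 (b *\<^sub>R e)" using ef' be by blast
    define A where "A = \<Psi> 0"
    define B where "B = \<Psi>0 0"
    have ray: "(\<forall>t\<in>{0..b}. of_real t * \<Phi> (t *\<^sub>R e) = \<Phi> 0 * ysol q 0 1 \<kappa> t) \<and>
        \<Phi> (b *\<^sub>R e) + of_real b * d = \<Phi> 0 * zsol q 0 1 \<kappa> b"
      if q: "continuous_on {0..b} q" and \<Phi>: "continuous_on (cball 0 b) \<Phi>" "C2_on \<Phi> (ball 0 b)"
        "spherically_symmetric_on \<Phi> (cball 0 b)"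
        "\<And>x. x \<in> ball 0 b \<Longrightarrow> laplacian \<Phi> x + \<kappa> * of_real (q (norm x)) * \<Phi> x = 0"
        "has_outward_normal_derivative b \<Phi> d (b *\<^sub>R e)" for q and \<Phi> :: "real^3 \<Rightarrow> complex"
    proof -
      obtain w where w: "solves b q \<kappa> (\<lambda>t. of_real t * \<Phi> (t *\<^sub>R e)) w" "w 0 = \<Phi> 0"
        "w b = \<Phi> (b *\<^sub>R e) + of_real b * d"
        by (rule radial_laplacian_to_ode[OF b q \<Phi>(1-4) e \<Phi>(5)]) blast
      note u = solves_unique[OF q w(1) scaled[OF q, of "\<Phi> 0"]]
      show ?thesis using u(1) u(2)[OF _ _ bb] w(2,3) by (auto simp: ysol_0 zsol_0)
    qed
    have rA: "\<And>t. t \<in> {0..b} \<Longrightarrow> of_real t * \<Psi> (t *\<^sub>R e) = A * ysol \<rho> 0 1 \<kappa> t"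
      "\<Psi> (b *\<^sub>R e) + of_real b * d = A * ?Z"
      using ray[OF r, of \<Psi>] ef' d(1) by (auto simp: A_def)
    have rB: "\<And>t. t \<in> {0..b} \<Longrightarrow> of_real t * \<Psi>0 (t *\<^sub>R e) = B * ysol (\<lambda>_. 1) 0 1 \<kappa> t"
      "\<Psi>0 (b *\<^sub>R e) + of_real b * d = B * ?c"
      using ray[OF r1, of \<Psi>0] ef' d(2) by (auto simp: B_def)
    have AB: "A * ?Y = B * ?S" "A * ?Z = B * ?c"
      using rA(1)[OF bb] rB(1)[OF bb] rA(2) rB(2) bdry by simp_all
    have trivial: "\<Phi> x = 0" if x: "x \<in> ball 0 b" and sym: "spherically_symmetric_on \<Phi> (cball 0 b)"
        and z: "\<Phi> 0 = 0" "\<And>t. t \<in> {0..b} \<Longrightarrow> of_real t * \<Phi> (t *\<^sub>R e) = 0"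
      for \<Phi> :: "real^3 \<Rightarrow> complex" and x
    proof (cases "x = 0")
      case False
      have "\<Phi> x = \<Phi> (norm x *\<^sub>R e)"
        using sym x e unfolding spherically_symmetric_on_def by auto
      then show ?thesis using z(2)[of "norm x"] x False by auto
    qed (use z in simp)
    have "A \<noteq> 0 \<or> B \<noteq> 0"
    proof (rule ccontr)
      assume "\<not> (A \<noteq> 0 \<or> B \<noteq> 0)"
      then have AB0: "A = 0" "B = 0" by auto
      have "\<Psi> x = 0" "\<Psi>0 x = 0" if "x \<in> ball 0 b" for x
        using trivial[OF that, of \<Psi>] trivial[OF that, of \<Psi>0] rA(1) rB(1) ef' AB0 by (auto simp: A_def B_def)
      then show False using nt by blast
    qed
    moreover have "A * char_fun b \<rho> \<kappa> = 0"
    proof -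
      have "A * char_fun b \<rho> \<kappa> = ?S * (A * ?Z) - ?c * (A * ?Y)" by (simp add: char_fun_def algebra_simps)
      also have "\<dots> = 0" unfolding AB by simp
      finally show ?thesis .
    qed
    moreover have "B * char_fun b \<rho> \<kappa> = 0"
    proof -
      have "B * char_fun b \<rho> \<kappa> = (B * ?S) * ?Z - (B * ?c) * ?Y" by (simp add: char_fun_def algebra_simps)
      also have "\<dots> = 0" unfolding AB[symmetric] by simp
      finally show ?thesis .
    qed
    ultimately show "char_fun b \<rho> \<kappa> = 0" by auto
  next
    assume zero: "char_fun b \<rho> \<kappa> = 0"
    then have det: "?S * ?Z = ?c * ?Y" by (simp add: char_fun_def)
    \<comment> \<open>a kernel vector of a singular matrix: a nonzero row gives one, and for the zero matrix any vector will do\<close>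
    obtain A B where AB: "A * ?Y = B * ?S" "A * ?Z = B * ?c" "A \<noteq> 0 \<or> B \<noteq> 0"
    proof (cases "?S = 0 \<and> ?Y = 0")
      case False
      then show thesis using det by (intro that[of ?S ?Y]) (auto simp: mult.commute)
    next
      case SY: True
      show thesis
      proof (cases "?c = 0 \<and> ?Z = 0")
        case False
        then show thesis using SY by (intro that[of ?c ?Z]) (auto simp: mult.commute)
      next
        case True
        then show thesis using SY by (intro that[of 1 1]) auto
      qed
    qed
    have vanish: "C * ysol q 0 1 \<kappa> 0 = 0" for C q by (simp add: ysol_0)
    obtain \<Psi> :: "real^3 \<Rightarrow> complex" where \<Psi>: "continuous_on (cball 0 b) \<Psi>" "C2_on \<Psi> (ball 0 b)"
      "spherically_symmetric_on \<Psi> (cball 0 b)"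
      "\<And>x. x \<in> ball 0 b \<Longrightarrow> laplacian \<Psi> x + \<kappa> * of_real (\<rho> (norm x)) * \<Psi> x = 0"
      "\<Psi> 0 = A * zsol \<rho> 0 1 \<kappa> 0" "\<And>x. x \<in> sphere 0 b \<Longrightarrow> \<Psi> x = A * ?Y / of_real b"
      "\<And>x. x \<in> sphere 0 b \<Longrightarrow> has_outward_normal_derivative b \<Psi> ((A * ?Z - A * ?Y / of_real b) / of_real b) x"
      by (rule radial_ode_to_laplacian[OF b r scaled[OF r, of A] vanish]) blast
    obtain \<Psi>0 :: "real^3 \<Rightarrow> complex" where \<Psi>0: "continuous_on (cball 0 b) \<Psi>0" "C2_on \<Psi>0 (ball 0 b)"
      "spherically_symmetric_on \<Psi>0 (cball 0 b)"
      "\<And>x. x \<in> ball 0 b \<Longrightarrow> laplacian \<Psi>0 x + \<kappa> * of_real 1 * \<Psi>0 x = 0"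
      "\<Psi>0 0 = B * zsol (\<lambda>_. 1) 0 1 \<kappa> 0" "\<And>x. x \<in> sphere 0 b \<Longrightarrow> \<Psi>0 x = B * ?S / of_real b"
      "\<And>x. x \<in> sphere 0 b \<Longrightarrow> has_outward_normal_derivative b \<Psi>0 ((B * ?c - B * ?S / of_real b) / of_real b) x"
      by (rule radial_ode_to_laplacian[OF b r1 scaled[OF r1, of B] vanish]) blast
    have "special_transmission_eigenfunctions b \<rho> \<kappa> \<Psi> \<Psi>0"
      unfolding special_transmission_eigenfunctions_def
    proof (intro conjI ballI)
      fix x :: "real^3" assume x: "x \<in> sphere 0 b"
      show "\<Psi> x = \<Psi>0 x" using \<Psi>(6)[OF x] \<Psi>0(6)[OF x] AB by simp
      show "\<exists>d. has_outward_normal_derivative b \<Psi> d x \<and> has_outward_normal_derivative b \<Psi>0 d x"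
        using \<Psi>(7)[OF x] \<Psi>0(7)[OF x] unfolding AB by blast
    next
      fix x :: "real^3" assume x: "x \<in> ball 0 b"
      show "laplacian \<Psi>0 x + \<kappa> * \<Psi>0 x = 0" using \<Psi>0(4)[OF x] by simp
    qed (use \<Psi> \<Psi>0 in auto)
    moreover have "\<Psi> 0 \<noteq> 0 \<or> \<Psi>0 0 \<noteq> 0" using AB(3) \<Psi>(5) \<Psi>0(5) by (simp add: zsol_0)
    moreover have "0 \<in> ball (0::real^3) b" using b by simp
    ultimately show "special_transmission_eigenvalue b \<rho> \<kappa>"
      unfolding special_transmission_eigenvalue_def by blast
  qed
qed

text \<open>Away from 0 the map \<open>z \<mapsto> z\<^sup>2\<close> is locally biholomorphic.\<close>

lemma zorder_square:
  assumes F: "F holomorphic_on UNIV" "F w0 \<noteq> 0" and k: "k \<noteq> 0"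
  shows "zorder (\<lambda>z. F (z\<^sup>2)) k = zorder F (k\<^sup>2)"
proof -
  obtain g where g: "0 \<le> zorder F (k\<^sup>2)" "g holomorphic_on UNIV" "g (k\<^sup>2) \<noteq> 0"
    "\<And>w. F w = (w - k\<^sup>2) ^ nat (zorder F (k\<^sup>2)) * g w"
    using entire_factor_power[OF F, of "k\<^sup>2"] by blast
  show ?thesis
  proof (rule zorder_eqI[of UNIV k "\<lambda>z. (z + k) ^ nat (zorder F (k\<^sup>2)) * g (z\<^sup>2)"])
    have "(\<lambda>z. g (z\<^sup>2)) holomorphic_on UNIV"
      using holomorphic_on_compose_gen[of "\<lambda>z. z\<^sup>2" UNIV g UNIV] g(2) by (simp add: o_def holomorphic_intros)
    then show "(\<lambda>z. (z + k) ^ nat (zorder F (k\<^sup>2)) * g (z\<^sup>2)) holomorphic_on UNIV"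
      by (intro holomorphic_intros)
    show "(k + k) ^ nat (zorder F (k\<^sup>2)) * g (k\<^sup>2) \<noteq> 0" using k g(3) by simp
    fix z :: complex assume "z \<noteq> k"
    have "z\<^sup>2 - k\<^sup>2 = (z + k) * (z - k)" by (simp add: power2_eq_square algebra_simps)
    then show "F (z\<^sup>2) = (z + k) ^ nat (zorder F (k\<^sup>2)) * g (z\<^sup>2) * (z - k) powi zorder F (k\<^sup>2)"
      using g(1) by (simp add: g(4) power_mult_distrib power_int_def)
  qed auto
qed

lemma multiplicity_eq_zorder:
  assumes b: "0 < b" and r: "continuous_on {0..b} \<rho>" and nz: "char_fun b \<rho> w0 \<noteq> 0"
  shows "multiplicity_ste b \<rho> \<kappa> = nat (zorder (char_fun b \<rho>) \<kappa>)"
proof (cases "\<kappa> = 0")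
  case True
  then show ?thesis by (simp add: multiplicity_ste_def D_fun_eq_char_fun[OF b r])
next
  case False
  have "zorder (D_fun b \<rho>) (csqrt \<kappa>) = zorder (\<lambda>z. char_fun b \<rho> (z\<^sup>2)) (csqrt \<kappa>)"
    by (simp add: D_fun_eq_char_fun[OF b r, abs_def])
  also have "\<dots> = zorder (char_fun b \<rho>) ((csqrt \<kappa>)\<^sup>2)"
    by (rule zorder_square[OF char_fun_holomorphic[OF b r] nz]) (use False in simp)
  finally show ?thesis using False by (simp add: multiplicity_ste_def)
qed

text \<open>The Hadamard product of \<open>D\<close>, for whichever enumeration of the eigenvalues was selected.  The constant is real
because it is the limit of \<open>D / \<kappa>\<^sup>d\<close> as \<open>\<kappa>\<close> tends to 0 along the positive axis.\<close>

lemma D_fun_eq_gamma_E: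
  assumes r: "regular_coeff b M \<rho>" and nz: "char_fun b \<rho> w0 \<noteq> 0"
  shows "D_fun b \<rho> k = of_real (gamma_const b \<rho>) * E_fun b \<rho> k"
proof -
  have b: "0 < b" and rc: "continuous_on {0..b} \<rho>" using regular_coeffD[OF r] by auto
  note hol = char_fun_holomorphic[OF b rc, of UNIV]
  note mult = multiplicity_eq_zorder[OF b rc nz]
  note eig = eigenvalue_iff_char_fun_zero[OF b rc]
  obtain C c where growth: "0 \<le> c" "\<And>w. norm (char_fun b \<rho> w) \<le> C * exp (c * sqrt (norm w))"
    by (rule char_fun_growth[OF r]) blast
  have inf: "infinite (zeros_with_multiplicity (char_fun b \<rho>))"
    by (rule infinitely_many_zeros[OF hol nz growth char_fun_tendsto_0[OF r]])
  have ex: "\<exists>\<mu>. enumerates_nonzero_ste b \<rho> \<mu>"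
    by (rule enumeration_of_zeros[OF hol nz inf]) (unfold enumerates_nonzero_ste_def eig mult, blast)
  define \<mu> where "\<mu> = (SOME \<mu>. enumerates_nonzero_ste b \<rho> \<mu>)"
  have "enumerates_nonzero_ste b \<rho> \<mu>"
    unfolding \<mu>_def by (rule someI_ex[OF ex])
  then have \<mu>: "\<And>n. \<mu> n \<noteq> 0" "\<And>n. char_fun b \<rho> (\<mu> n) = 0"
    "\<And>a. a \<noteq> 0 \<Longrightarrow> char_fun b \<rho> a = 0 \<Longrightarrow> finite {n. \<mu> n = a} \<and> card {n. \<mu> n = a} = nat (zorder (char_fun b \<rho>) a)"
    unfolding enumerates_nonzero_ste_def eig mult by blast+
  let ?d = "nat (zorder (char_fun b \<rho>) 0)"
  obtain f where f: "f holomorphic_on UNIV" "\<And>w. char_fun b \<rho> w = w ^ ?d * f w"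
    "\<And>w. char_fun b \<rho> w = f 0 * (w ^ ?d * (\<Prod>n. 1 - w / \<mu> n))"
    by (rule hadamard_half_order[where \<mu>=\<mu>, OF hol nz growth \<mu>(1,2)])
      (rule \<mu>(3), assumption, assumption, rule that)
  have E: "E_fun b \<rho> k = (k\<^sup>2) ^ ?d * (\<Prod>n. 1 - k\<^sup>2 / \<mu> n)" for k
    unfolding E_fun_def \<mu>_def mult by (simp add: power_mult)
  have DE: "D_fun b \<rho> k = f 0 * E_fun b \<rho> k" for k
    unfolding D_fun_eq_char_fun[OF b rc] E by (rule f(3))
  have "f 0 \<in> \<real>"
  proof -
    have "((\<lambda>x::real. f (of_real x)) \<longlongrightarrow> f (of_real 0)) (at_right 0)"
    proof -
      have "f field_differentiable (at 0)" using f(1) by (simp add: holomorphic_on_def)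
      then have "isCont f (of_real 0)" by (simp add: field_differentiable_imp_continuous_at)
      moreover have "((\<lambda>x. complex_of_real x) \<longlongrightarrow> of_real 0) (at_right 0)"
        by (intro tendsto_of_real tendsto_ident_at)
      ultimately show ?thesis by (rule isCont_tendsto_compose)
    qed
    moreover have "eventually (\<lambda>x::real. f (of_real x) \<in> \<real>) (at_right 0)"
      using eventually_at_right_less[of 0]
    proof eventually_elim
      case (elim x)
      then have "f (of_real x) = char_fun b \<rho> (of_real x) / of_real (x ^ ?d)" by (simp add: f(2))
      then show ?case using char_fun_real[OF b rc, of x] by (simp add: Reals_divide)
    qed
    ultimately have "f (of_real 0) \<in> \<real>"
      by (intro Lim_in_closed_set[of \<real> "\<lambda>x::real. f (of_real x)" "at_right 0"]) (auto simp: closed_complex_Reals)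
    then show ?thesis by simp
  qed
  then obtain \<gamma> where \<gamma>: "f 0 = of_real \<gamma>" by (auto simp: Reals_def)
  have D0: "D_fun b \<rho> (csqrt w0) \<noteq> 0" using nz by (simp add: D_fun_eq_char_fun[OF b rc])
  have "gamma_const b \<rho> = \<gamma>"
  proof -
    have "(THE \<gamma>. \<forall>k. D_fun b \<rho> k = of_real \<gamma> * E_fun b \<rho> k) = \<gamma>"
    proof (rule the_equality)
      show "\<forall>k. D_fun b \<rho> k = of_real \<gamma> * E_fun b \<rho> k" using DE \<gamma> by simp
      fix \<gamma>' assume "\<forall>k. D_fun b \<rho> k = of_real \<gamma>' * E_fun b \<rho> k"
      then have "of_real \<gamma>' * E_fun b \<rho> (csqrt w0) = of_real \<gamma> * E_fun b \<rho> (csqrt w0)"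
        using DE[of "csqrt w0"] \<gamma> by simp
      moreover have "E_fun b \<rho> (csqrt w0) \<noteq> 0" using D0 DE[of "csqrt w0"] by auto
      ultimately show "\<gamma>' = \<gamma>" by simp
    qed
    then show ?thesis using D0 by (auto simp: gamma_const_def)
  qed
  then show ?thesis using DE \<gamma> by simp
qed

text \<open>Both functions \<open>D\<close> vanish identically or neither does; in the second case they are multiples of one and the
same product.\<close>

lemma same_ste_imp_proportional:
  assumes r1: "regular_coeff b M1 \<rho>1" and r2: "regular_coeff b M2 \<rho>2"
    and same: "same_ste_with_multiplicities b \<rho>1 \<rho>2"
  obtains c where "\<And>w. char_fun b \<rho>1 w = c * char_fun b \<rho>2 w"
    "gamma_const b \<rho>1 = gamma_const b \<rho>2 \<Longrightarrow> c = 1"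
proof -
  have b: "0 < b" and rc: "continuous_on {0..b} \<rho>1" "continuous_on {0..b} \<rho>2"
    using regular_coeffD[OF r1] regular_coeffD[OF r2] by auto
  note eig = eigenvalue_iff_char_fun_zero[OF b rc(1)] eigenvalue_iff_char_fun_zero[OF b rc(2)]
  have zeros: "char_fun b \<rho>1 w = 0 \<longleftrightarrow> char_fun b \<rho>2 w = 0" for w
    using same unfolding same_ste_with_multiplicities_def eig by blast
  show thesis
  proof (cases "\<exists>w0. char_fun b \<rho>1 w0 \<noteq> 0")
    case False
    then show thesis using zeros by (intro that[of 1]) auto
  next
    case True
    then obtain w0 where nz1: "char_fun b \<rho>1 w0 \<noteq> 0" by blast
    then have nz2: "char_fun b \<rho>2 w0 \<noteq> 0" using zeros by blast
    have c0: "char_fun b \<rho>1 0 = 0" using b by (simp add: char_fun_def ysol_zero_parameter zsol_zero_parameter)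
    have mult: "multiplicity_ste b \<rho>1 \<kappa> = multiplicity_ste b \<rho>2 \<kappa>" if "special_transmission_eigenvalue b \<rho>1 \<kappa>" for \<kappa>
      using same that unfolding same_ste_with_multiplicities_def by blast
    have steq: "special_transmission_eigenvalue b \<rho>1 \<kappa> \<longleftrightarrow> special_transmission_eigenvalue b \<rho>2 \<kappa>" for \<kappa>
      using same unfolding same_ste_with_multiplicities_def by blast
    have "enumerates_nonzero_ste b \<rho>1 = enumerates_nonzero_ste b \<rho>2"
      unfolding enumerates_nonzero_ste_def fun_eq_iff using mult steq by metis
    moreover have "multiplicity_ste b \<rho>1 0 = multiplicity_ste b \<rho>2 0"
      by (rule mult) (simp add: eig c0)
    ultimately have E: "E_fun b \<rho>1 = E_fun b \<rho>2" unfolding E_fun_def[abs_def] by simp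
    let ?g1 = "complex_of_real (gamma_const b \<rho>1)" and ?g2 = "complex_of_real (gamma_const b \<rho>2)"
    have F: "char_fun b \<rho>1 w = ?g1 * E_fun b \<rho>2 (csqrt w)" "char_fun b \<rho>2 w = ?g2 * E_fun b \<rho>2 (csqrt w)" for w
      using D_fun_eq_gamma_E[OF r1 nz1, of "csqrt w"] D_fun_eq_gamma_E[OF r2 nz2, of "csqrt w"]
      by (simp_all add: D_fun_eq_char_fun[OF b rc(1)] D_fun_eq_char_fun[OF b rc(2)] E)
    have g2: "?g2 \<noteq> 0" using nz2 F(2)[of w0] by auto
    show thesis
    proof (rule that[of "?g1 / ?g2"])
      show "char_fun b \<rho>1 w = ?g1 / ?g2 * char_fun b \<rho>2 w" for w using F[of w] g2 by simp
      show "?g1 / ?g2 = 1" if "gamma_const b \<rho>1 = gamma_const b \<rho>2" using that g2 by simp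
    qed
  qed
qed

text \<open>The hypothesis \<open>alt\<close> covers the two cases of the theorem: strict inequality of the travel times yields
\<open>c = 1\<close>, and \<open>c = 1\<close> replaces it otherwise.  Negative \<open>\<kappa>\<close> are chosen because \<open>sin(kb) / k\<close> has no zeros there.\<close>

lemma proportional_imp_equal_data:
  assumes r1: "regular_coeff b M1 \<rho>1" and r2: "regular_coeff b M2 \<rho>2"
    and proportional: "\<And>w. char_fun b \<rho>1 w = c * char_fun b \<rho>2 w"
    and trav: "travel \<rho>1 b \<le> b" "travel \<rho>2 b \<le> b"
    and alt: "(travel \<rho>1 b < b \<and> travel \<rho>2 b < b) \<or> c = 1"
    and K: "0 < K"
  shows "ysol \<rho>1 0 1 (- of_real (K\<^sup>2)) b = ysol \<rho>2 0 1 (- of_real (K\<^sup>2)) b"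
    and "zsol \<rho>1 0 1 (- of_real (K\<^sup>2)) b = zsol \<rho>2 0 1 (- of_real (K\<^sup>2)) b"
proof -
  have b: "0 < b" and rc: "continuous_on {0..b} \<rho>1" "continuous_on {0..b} \<rho>2"
    using regular_coeffD[OF r1] regular_coeffD[OF r2] by auto
  have bb: "b \<in> {0..b}" using b by simp
  define g where "g k = ysol \<rho>1 0 1 (k\<^sup>2) b - c * ysol \<rho>2 0 1 (k\<^sup>2) b" for k
  have sq: "(\<lambda>k. f (k\<^sup>2)) holomorphic_on UNIV" if "f holomorphic_on UNIV" for f :: "complex \<Rightarrow> complex"
    using holomorphic_on_compose_gen[of "\<lambda>z. z\<^sup>2" UNIV f UNIV] that by (simp add: o_def holomorphic_intros)
  have hg: "g holomorphic_on UNIV"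
    unfolding g_def[abs_def] using sq[OF solution_holomorphic(1)[OF rc(1) bb]] sq[OF solution_holomorphic(1)[OF rc(2) bb]]
    by (intro holomorphic_intros)
  obtain C1 where C1: "0 < C1" "\<And>k. norm k * norm (ysol \<rho>1 0 1 (k\<^sup>2) b) \<le> C1 * exp (\<bar>Im k\<bar> * travel \<rho>1 b)"
    using normalised_solution_growth[OF r1] bb by metis
  obtain C2 where C2: "0 < C2" "\<And>k. norm k * norm (ysol \<rho>2 0 1 (k\<^sup>2) b) \<le> C2 * exp (\<bar>Im k\<bar> * travel \<rho>2 b)"
    using normalised_solution_growth[OF r2] bb by metis
  have growth: "norm (k * g k) \<le> (C1 + norm c * C2) * exp (a * \<bar>Im k\<bar>)"
    if a: "travel \<rho>1 b \<le> a" "travel \<rho>2 b \<le> a" for a k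
  proof -
    have "norm (k * g k) \<le> norm k * norm (ysol \<rho>1 0 1 (k\<^sup>2) b) + norm c * (norm k * norm (ysol \<rho>2 0 1 (k\<^sup>2) b))"
      using norm_triangle_ineq4[of "k * ysol \<rho>1 0 1 (k\<^sup>2) b" "k * (c * ysol \<rho>2 0 1 (k\<^sup>2) b)"]
      by (simp add: g_def norm_mult right_diff_distrib mult_ac)
    also have "\<dots> \<le> C1 * exp (\<bar>Im k\<bar> * travel \<rho>1 b) + norm c * (C2 * exp (\<bar>Im k\<bar> * travel \<rho>2 b))"
      by (intro add_mono mult_left_mono C1 C2) auto
    also have "\<dots> \<le> C1 * exp (a * \<bar>Im k\<bar>) + norm c * (C2 * exp (a * \<bar>Im k\<bar>))"
      using a C1(1) C2(1) by (intro add_mono mult_left_mono) (auto simp: mult.commute[of a] intro!: mult_left_mono)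
    finally show ?thesis by (simp add: algebra_simps)
  qed
  \<comment> \<open>at these points \<open>S = 0\<close>, so \<open>D\<^sub>j = - C Y\<^sub>j\<close> with \<open>C \<noteq> 0\<close>\<close>
  have zero: "g (of_real (of_int n * pi / b)) = 0" if n: "n \<noteq> 0" for n :: int
  proof -
    define k where "k = complex_of_real (of_int n * pi / b)"
    have kb: "k * of_real b = of_real (of_int n * pi)" using b by (simp add: k_def)
    have k0: "k \<noteq> 0" using n b by (simp add: k_def)
    have s: "sin (k * of_real b) = 0" unfolding kb sin_of_real using sin_npi_int[of n] by (simp add: mult.commute)
    then have "zsol (\<lambda>_. 1) 0 1 (k\<^sup>2) b \<noteq> 0"
      using sin_cos_squared_add[of "k * of_real b"] free_solution(2)[OF b bb, of k] by auto
    moreover have S0: "ysol (\<lambda>_. 1) 0 1 (k\<^sup>2) b = 0" using free_solution(1)[OF b bb, of k] k0 s by simp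
    have "zsol (\<lambda>_. 1) 0 1 (k\<^sup>2) b * g k = 0"
      using proportional[of "k\<^sup>2"] unfolding char_fun_def S0 g_def by algebra
    ultimately show ?thesis unfolding k_def[symmetric] by simp
  qed
  obtain c0 where c0: "\<And>k. k * g k = c0 * sin (k * of_real b)" "g 0 = c0 * of_real b"
    by (rule sine_type_interpolation[OF b hg growth[of b] zero]) (use trav in auto)
  have g0: "g 0 = of_real b * (1 - c)" by (simp add: g_def ysol_zero_parameter algebra_simps)
  have "c0 = 0"
    using alt
  proof
    assume "travel \<rho>1 b < b \<and> travel \<rho>2 b < b"
    then show "c0 = 0"
      by (intro sine_type_small_growth[OF c0(1) growth[of "max (travel \<rho>1 b) (travel \<rho>2 b)"] _ b]) auto
  next
    assume "c = 1"
    then show "c0 = 0" using g0 c0(2) b by simp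
  qed
  then have c1: "c = 1" using g0 c0(2) b by simp
  let ?\<kappa> = "- complex_of_real (K\<^sup>2)" and ?k = "\<i> * complex_of_real K"
  have kk: "?k\<^sup>2 = ?\<kappa>" by (simp add: power_mult_distrib)
  have "?k * g ?k = 0" using c0(1)[of ?k] \<open>c0 = 0\<close> by simp
  then have Y: "ysol \<rho>1 0 1 ?\<kappa> b = ysol \<rho>2 0 1 ?\<kappa> b"
    using K c1 unfolding g_def kk by simp
  then show "ysol \<rho>1 0 1 ?\<kappa> b = ysol \<rho>2 0 1 ?\<kappa> b" .
  have "sin (?k * of_real b) \<noteq> 0"
  proof
    assume "sin (?k * of_real b) = 0"
    then have "sinh (Im (?k * of_real b)) = 0" using abs_sinh_le_norm_sin[of "?k * of_real b"] by simp
    then show False using K b by simp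
  qed
  then have S: "ysol (\<lambda>_. 1) 0 1 ?\<kappa> b \<noteq> 0"
    using free_solution(1)[OF b bb, of ?k] K unfolding kk by simp
  have "ysol (\<lambda>_. 1) 0 1 ?\<kappa> b * zsol \<rho>1 0 1 ?\<kappa> b = ysol (\<lambda>_. 1) 0 1 ?\<kappa> b * zsol \<rho>2 0 1 ?\<kappa> b"
    using proportional[of ?\<kappa>] unfolding char_fun_def c1 Y by simp
  then show "zsol \<rho>1 0 1 ?\<kappa> b = zsol \<rho>2 0 1 ?\<kappa> b" using S by simp
qed

theorem theorem1p2:
  fixes b :: real and \<rho>1 \<rho>2 :: "real \<Rightarrow> real"
  assumes "b > 0"
    and "admissible b \<rho>1" and "admissible b \<rho>2"
    and "same_ste_with_multiplicities b \<rho>1 \<rho>2"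
  shows "(travel_time b \<rho>1 < b \<and> travel_time b \<rho>2 < b \<longrightarrow> (\<forall>x\<ge>0. \<rho>1 x = \<rho>2 x)) \<and>
         (travel_time b \<rho>1 = b \<and> travel_time b \<rho>2 = b \<and> gamma_const b \<rho>1 = gamma_const b \<rho>2 \<longrightarrow>
            (\<forall>x\<ge>0. \<rho>1 x = \<rho>2 x))"
proof -
  obtain M1 where r1: "regular_coeff b M1 \<rho>1" "\<rho>1 b = 1"
    by (rule admissible_regular[OF assms(1,2)]) blast
  obtain M2 where r2: "regular_coeff b M2 \<rho>2" "\<rho>2 b = 1"
    by (rule admissible_regular[OF assms(1,3)]) blast
  obtain c where c: "\<And>w. char_fun b \<rho>1 w = c * char_fun b \<rho>2 w"
    "gamma_const b \<rho>1 = gamma_const b \<rho>2 \<Longrightarrow> c = 1"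
    by (rule same_ste_imp_proportional[OF r1(1) r2(1) assms(4)]) blast
  have tt: "travel_time b \<rho> = travel \<rho> b" for \<rho> by (simp add: travel_time_def travel_def)
  have main: "\<rho>1 x = \<rho>2 x"
    if trav: "travel \<rho>1 b \<le> b" "travel \<rho>2 b \<le> b"
      and alt: "(travel \<rho>1 b < b \<and> travel \<rho>2 b < b) \<or> c = 1" and x: "0 \<le> x" for x
  proof (cases "x \<le> b")
    case True
    show ?thesis
      by (rule coefficient_determined_by_boundary_data[OF r1(1) r2(1) r1(2) r2(2)
            proportional_imp_equal_data[OF r1(1) r2(1) c(1) trav alt]])
        (use x True in auto)
  next
    case False
    then show ?thesis using assms(2,3) unfolding admissible_def by simp
  qed
  show ?thesis unfolding tt
  proof (intro conjI impI allI)
    fix x :: real assume "0 \<le> x"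
    { assume "travel \<rho>1 b < b \<and> travel \<rho>2 b < b"
      then show "\<rho>1 x = \<rho>2 x" using \<open>0 \<le> x\<close> by (intro main) auto }
    { assume "travel \<rho>1 b = b \<and> travel \<rho>2 b = b \<and> gamma_const b \<rho>1 = gamma_const b \<rho>2"
      then show "\<rho>1 x = \<rho>2 x" using \<open>0 \<le> x\<close> c(2) by (intro main) auto }
  qed
qed

end
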